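(* Let $O_t$ and $O^n_t$ be the solutions of the linear stochastic heat equation and of its discretisation with zero initial data: $$O_t(x)=\int_0^t\int_{\mathbb T}p_{t-s}(x,y)\,\xi(dy,ds)\ (x\in\mathbb T),\qquad O^n_t(x)=\int_0^t\int_{\mathbb T}p^n_{\kappa_n(t-s)}(x,\rho_n(y))\,\xi(dy,ds)\ (x\in\Pi_n).$$ For every $\alpha\in(-\infty,1/2)\setminus\{-1/2\}$ and $q\in[1,\infty)$ there is a constant $N=N(\alpha,q)$ such that for any $n\in\mathbb N$ and $t\in[0,1]$ one has the bounds $$\mathbb E\|O_t-\iota O^n_t\|_{B^\alpha_{\infty,\infty}(\mathbb T)}^q\le\begin{cases}N n^{-q(1/2-\alpha-1/q)}&\text{if }\alpha\in(-1/2,1/2),\\ N n^{-q}&\text{if }\alpha<-1/2,\end{cases}$$ $$\mathbb E\|\delta O_t-O^n_t\|_{B^\alpha_{\infty,\infty}(\Pi_n)}^q\le\begin{cases}N n^{-q(1/2-\alpha-1/q)}&\text{if }\alpha\in(-1/2,1/2),\\ N n^{-q}&\text{if }\alpha<-1/2.\end{cases}$$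
   Context: $\mathbb T=\mathbb R/\mathbb Z$. $\xi$ is a space-time white noise on $[0,\infty)\times\mathbb T$ on a complete probability space: a map from bounded Borel sets to $L_2(\Omega)$ such that $(\xi(A_1),\dots,\xi(A_k))$ is always centred Gaussian with covariance $\mathbb E(\xi(A_i)\xi(A_j))=|A_i\cap A_j|$; integrals against $\xi$ are Wiener integrals. $e_j(x)=e^{2\pi ijx}$, and $p_t(x,y)=\sum_{j\in\mathbb Z}e^{-4\pi^2j^2t}e_j(x-y)$ for $t>0$. The number $c\in(0,1/4)$ is fixed throughout. For an integer $n\ge1$ put $h=c(2n)^{-2}$, $\Pi_n=\{0,(2n)^{-1},\dots,(2n-1)(2n)^{-1}\}\subset\mathbb T$, $\Lambda_n=\{0,h,2h,\dots\}$, $\kappa_n(t)=\lfloor th^{-1}\rfloor h$, $\rho_n(x)=\lfloor2nx\rfloor(2n)^{-1}$ (for $x\in[0,1)$), $\lambda^n_j=-16n^2\sin^2\big(\frac{j\pi}{2n}\big)$, and for $t\in\Lambda_n$, $x,y\in\Pi_n$, $p^n_t(x,y)=\sum_{j=-n}^{n-1}(1+h\lambda^n_j)^{t/h}e_j(x-y)$. The formula for $O^n_t$ is used for all $t\ge0$. $\langle\cdot,\cdot\rangle$ is the complex inner product on $L^2(\mathbb T;\mathbb C)$ (and its extension to distributions tested against $e_k$), $\langle f,g\rangle_n=\frac1{2n}\sum_{x\in\Pi_n}f(x)\overline{g(x)}$, $\delta$ is restriction of continuous functions on $\mathbb T$ to $\Pi_n$, and $\iota f=\sum_{j=-n}^{n-1}\langle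 f,\delta e_j\rangle_n\,e_j$ (a function on $\mathbb T$) for $f:\Pi_n\to\mathbb C$. $\|f\|_{L^p(\Pi_n)}^p=\frac1{2n}\sum_{x\in\Pi_n}|f(x)|^p$ for $p<\infty$, and $\|\cdot\|_{L^\infty(\Pi_n)}$ is the maximum norm. **Besov norms.** Fix once and for all $\varepsilon_0\in(0,1/10)$ and a smooth even $\phi^0:\mathbb R\to[0,1]$ with $\phi^0\equiv1$ on $\{|x|\le1-\varepsilon_0\}$ and $\operatorname{supp}\phi^0\subset\{|x|\le1\}$; constants may depend on these. Let $\rho_0=\frac{3-2\varepsilon_0}{2}$, and for $\rho\in[1,2]$ let $\phi^0_\rho(x)=\phi^0((\rho_0/\rho)x)$ and $\phi^j_\rho(x)=\phi^0_\rho(2^{-j}x)-\phi^0_\rho(2^{-j+1}x)$ for integers $j\ge1$. For a distribution $f$ on $\mathbb T$: $f^{[j]}=\sum_{k\in\mathbb Z}\phi^j_1(k)\langle f,e_k\rangle e_k$ and $\|f\|_{B^\alpha_{p,q}(\mathbb T)}=\|j\mapsto2^{\alpha j}\|f^{[j]}\|_{L^p(\mathbb T)}\|_{\ell^q(\{0,1,\dots\})}$. With $J_n=\lfloor\log_2n\rfloor$, $\varrho_n=n2^{-J_n}\in[1,2]$, for $f$ on $\Pi_n$: $f^{[j],n}=\sum_{k=-n}^{n-1}\phi^j_{\varrho_n}(k)\langle f,\delta e_k\rangle_n\delta e_k$ and $\|f\|_{B^\alpha_{p,q}(\Pi_n)}=\|j\mapsto2^{\alpha j}\|f^{[j],n}\|_{L^p(\Pi_n)}\|_{\ell^q(\{0,1,\dots\})}$.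 *)

theory Defs
  imports "HOL-Probability.Probability"
begin

text \<open>
  Conventions. The torus is represented by the fundamental domain \<open>[0, 1)\<close>: its Haar measure is
  Lebesgue measure on \<open>[0, 1)\<close>, a subset of \<open>[0, \<infinity>) \<times> \<T>\<close> is a subset of \<open>[0, \<infinity>) \<times> [0, 1)\<close> (pairs are
  written time first), and a continuous function on the torus is a continuous function on the real
  line of period one. A function on the grid is a function on the reals of which only the values at
  grid points are used.
\<close>

section \<open>Space-time white noise and Wiener integrals\<close>

definition centred_normal :: "'w measure \<Rightarrow> ('w \<Rightarrow> real) \<Rightarrow> bool" where
  "centred_normal M X \<longleftrightarrow> X \<in> borel_measurable M \<and>
     ((AE \<omega> in M. X \<omega> = 0) \<or> (\<exists>\<sigma>>0. distributed M lborel X (normal_density 0 \<sigma>)))"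

definition centred_gaussian_vector :: "'w measure \<Rightarrow> nat \<Rightarrow> (nat \<Rightarrow> 'w \<Rightarrow> real) \<Rightarrow> bool" where
  "centred_gaussian_vector M k X \<longleftrightarrow>
     (\<forall>a :: nat \<Rightarrow> real. centred_normal M (\<lambda>\<omega>. \<Sum>i<k. a i * X i \<omega>))"

definition bounded_borel_sets :: "(real \<times> real) set set" where
  "bounded_borel_sets = {A. A \<in> sets borel \<and> bounded A \<and> A \<subseteq> {0..} \<times> {0..<1}}"

definition white_noise :: "'w measure \<Rightarrow> ((real \<times> real) set \<Rightarrow> 'w \<Rightarrow> real) \<Rightarrow> bool" where
  "white_noise M \<xi> \<longleftrightarrow>
     (\<forall>k A. (\<forall>i<k. A i \<in> bounded_borel_sets) \<longrightarrow>
        centred_gaussian_vector M k (\<lambda>i. \<xi> (A i)) \<and>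
        (\<forall>i<k. \<forall>j<k. (\<integral>\<omega>. \<xi> (A i) \<omega> * \<xi> (A j) \<omega> \<partial>M) = measure lborel (A i \<inter> A j)))"

text \<open>
  \<open>X\<close> is a version of the Wiener integral of \<open>f\<close> over \<open>[0, \<infinity>) \<times> \<T>\<close>: the value at \<open>f\<close> of the continuous
  extension to (complex) \<open>L\<^sup>2([0, \<infinity>) \<times> \<T>)\<close> of the linear map sending the indicator of \<open>A\<close> to \<open>\<xi> A\<close>.
\<close>

definition has_wiener_integral ::
    "'w measure \<Rightarrow> ((real \<times> real) set \<Rightarrow> 'w \<Rightarrow> real) \<Rightarrow> (real \<times> real \<Rightarrow> complex) \<Rightarrow>
      ('w \<Rightarrow> complex) \<Rightarrow> bool" where
  "has_wiener_integral M \<xi> f X \<longleftrightarrow>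
     f \<in> borel_measurable borel \<and> X \<in> borel_measurable M \<and>
     (\<exists>(k :: nat \<Rightarrow> nat) (a :: nat \<Rightarrow> nat \<Rightarrow> complex) (A :: nat \<Rightarrow> nat \<Rightarrow> (real \<times> real) set).
        (\<forall>m i. A m i \<in> bounded_borel_sets) \<and>
        (\<lambda>m. \<integral>\<^sup>+z\<in>{0..} \<times> {0..<1}.
           ennreal ((cmod (f z - (\<Sum>i<k m. a m i * indicator (A m i) z)))\<^sup>2) \<partial>lborel)
          \<longlonglongrightarrow> 0 \<and>
        (\<lambda>m. \<integral>\<^sup>+\<omega>.
           ennreal ((cmod (X \<omega> - (\<Sum>i<k m. a m i * complex_of_real (\<xi> (A m i) \<omega>))))\<^sup>2) \<partial>M)
          \<longlonglongrightarrow> 0)"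

section \<open>Kernels and grids\<close>

definition ee :: "int \<Rightarrow> real \<Rightarrow> complex" where
  "ee j x = exp (2 * of_real pi * \<i> * of_int j * of_real x)"

definition heat_kernel :: "real \<Rightarrow> real \<Rightarrow> real \<Rightarrow> complex" where
  "heat_kernel t x y = (\<Sum>\<^sub>\<infinity>j\<in>UNIV. exp (- 4 * pi\<^sup>2 * (of_int j)\<^sup>2 * t) *\<^sub>R ee j (x - y))"

definition grid :: "nat \<Rightarrow> real set" where
  "grid n = (\<lambda>i. real i / (2 * real n)) ` {..<2 * n}"

definition step :: "real \<Rightarrow> nat \<Rightarrow> real" where
  "step c n = c / (2 * real n)\<^sup>2"

definition kappa :: "real \<Rightarrow> nat \<Rightarrow> real \<Rightarrow> real" where
  "kappa c n t = of_int \<lfloor>t / step c n\<rfloor> * step c n"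

definition grid_round :: "nat \<Rightarrow> real \<Rightarrow> real" where
  "grid_round n x = of_int \<lfloor>2 * real n * x\<rfloor> / (2 * real n)"

definition eigval :: "nat \<Rightarrow> int \<Rightarrow> real" where
  "eigval n j = - 16 * (real n)\<^sup>2 * (sin (of_int j * pi / (2 * real n)))\<^sup>2"

text \<open>The base of the power is positive because \<open>c < 1/4\<close>, so \<open>powr\<close> is the usual power.\<close>

definition discrete_kernel :: "real \<Rightarrow> nat \<Rightarrow> real \<Rightarrow> real \<Rightarrow> real \<Rightarrow> complex" where
  "discrete_kernel c n t x y =
     (\<Sum>j = - int n..int n - 1. ((1 + step c n * eigval n j) powr (t / step c n)) *\<^sub>R ee j (x - y))"

section \<open>The stochastic heat equation and its discretisation\<close>

text \<open>
  For fixed \<open>t\<close> the Wiener integrals determine \<open>O\<^sub>t(x)\<close> only up to a null set depending on \<open>x\<close>; as usual,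
  the random function \<open>O\<^sub>t\<close> is a version which is almost surely continuous on the torus.
\<close>

definition heat_solution ::
    "'w measure \<Rightarrow> ((real \<times> real) set \<Rightarrow> 'w \<Rightarrow> real) \<Rightarrow> (real \<Rightarrow> real \<Rightarrow> 'w \<Rightarrow> complex) \<Rightarrow> bool" where
  "heat_solution M \<xi> Z \<longleftrightarrow>
     (\<forall>t\<ge>0.
        (\<forall>x. has_wiener_integral M \<xi>
               (\<lambda>(s, y). indicator ({0..<t} \<times> {0..<1}) (s, y) * heat_kernel (t - s) x y) (Z t x)) \<and>
        (AE \<omega> in M. continuous_on UNIV (\<lambda>x. Z t x \<omega>) \<and> (\<forall>x. Z t (x + 1) \<omega> = Z t x \<omega>)))"

definition discrete_solution ::
    "real \<Rightarrow> 'w measure \<Rightarrow> ((real \<times> real) set \<Rightarrow> 'w \<Rightarrow> real) \<Rightarrow> nat \<Rightarrow>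
      (real \<Rightarrow> real \<Rightarrow> 'w \<Rightarrow> complex) \<Rightarrow> bool" where
  "discrete_solution c M \<xi> n Y \<longleftrightarrow>
     (\<forall>t\<ge>0. \<forall>x\<in>grid n. has_wiener_integral M \<xi>
        (\<lambda>(s, y). indicator ({0..<t} \<times> {0..<1}) (s, y) *
                  discrete_kernel c n (kappa c n (t - s)) x (grid_round n y)) (Y t x))"

section \<open>Restriction and trigonometric interpolation\<close>

definition inner_torus :: "(real \<Rightarrow> complex) \<Rightarrow> (real \<Rightarrow> complex) \<Rightarrow> complex" where
  "inner_torus f g = (LINT x:{0..<1}|lborel. f x * cnj (g x))"

definition inner_grid :: "nat \<Rightarrow> (real \<Rightarrow> complex) \<Rightarrow> (real \<Rightarrow> complex) \<Rightarrow> complex" where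
  "inner_grid n f g = (\<Sum>x\<in>grid n. f x * cnj (g x)) / (2 * of_nat n)"

definition grid_restrict :: "nat \<Rightarrow> (real \<Rightarrow> complex) \<Rightarrow> real \<Rightarrow> complex" where
  "grid_restrict n f = restrict f (grid n)"

definition interp :: "nat \<Rightarrow> (real \<Rightarrow> complex) \<Rightarrow> real \<Rightarrow> complex" where
  "interp n f x = (\<Sum>j = - int n..int n - 1. inner_grid n f (grid_restrict n (ee j)) * ee j x)"

section \<open>Besov norms\<close>

definition ennreal_powr :: "ennreal \<Rightarrow> real \<Rightarrow> ennreal" where
  "ennreal_powr x r = (if x = \<infinity> then \<infinity> else ennreal (enn2real x powr r))"

definition Lp_norm :: "'a measure \<Rightarrow> ennreal \<Rightarrow> ('a \<Rightarrow> ennreal) \<Rightarrow> ennreal" where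
  "Lp_norm M p f =
     (if p = \<infinity> then esssup M f
      else ennreal_powr (\<integral>\<^sup>+x. ennreal_powr (f x) (enn2real p) \<partial>M) (1 / enn2real p))"

definition cutoff :: "real \<Rightarrow> (real \<Rightarrow> real) \<Rightarrow> bool" where
  "cutoff \<epsilon>\<^sub>0 \<phi> \<longleftrightarrow>
     (\<forall>k x. (deriv ^^ k) \<phi> field_differentiable at x) \<and>
     (\<forall>x. \<phi> (- x) = \<phi> x) \<and> (\<forall>x. \<phi> x \<in> {0..1}) \<and>
     (\<forall>x. \<bar>x\<bar> \<le> 1 - \<epsilon>\<^sub>0 \<longrightarrow> \<phi> x = 1) \<and> closure {x. \<phi> x \<noteq> 0} \<subseteq> {x. \<bar>x\<bar> \<le> 1}"

definition phi0_scaled :: "real \<Rightarrow> (real \<Rightarrow> real) \<Rightarrow> real \<Rightarrow> real \<Rightarrow> real" where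
  "phi0_scaled \<epsilon>\<^sub>0 \<phi> \<rho> x = (let \<rho>\<^sub>0 = (3 - 2 * \<epsilon>\<^sub>0) / 2 in \<phi> (\<rho>\<^sub>0 / \<rho> * x))"

definition phi_block :: "real \<Rightarrow> (real \<Rightarrow> real) \<Rightarrow> real \<Rightarrow> nat \<Rightarrow> real \<Rightarrow> real" where
  "phi_block \<epsilon>\<^sub>0 \<phi> \<rho> j x =
     (if j = 0 then phi0_scaled \<epsilon>\<^sub>0 \<phi> \<rho> x
      else phi0_scaled \<epsilon>\<^sub>0 \<phi> \<rho> (2 powr (- real j) * x)
         - phi0_scaled \<epsilon>\<^sub>0 \<phi> \<rho> (2 powr (- real j + 1) * x))"

text \<open>The infinite sum has only finitely many nonzero terms.\<close>

definition torus_block :: "real \<Rightarrow> (real \<Rightarrow> real) \<Rightarrow> (real \<Rightarrow> complex) \<Rightarrow> nat \<Rightarrow> real \<Rightarrow> complex" where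
  "torus_block \<epsilon>\<^sub>0 \<phi> f j x =
     (\<Sum>\<^sub>\<infinity>k\<in>UNIV. phi_block \<epsilon>\<^sub>0 \<phi> 1 j (of_int k) *\<^sub>R (inner_torus f (ee k) * ee k x))"

definition besov_torus ::
    "real \<Rightarrow> (real \<Rightarrow> real) \<Rightarrow> real \<Rightarrow> ennreal \<Rightarrow> ennreal \<Rightarrow> (real \<Rightarrow> complex) \<Rightarrow> ennreal" where
  "besov_torus \<epsilon>\<^sub>0 \<phi> \<alpha> p q f =
     Lp_norm (count_space (UNIV :: nat set)) q
       (\<lambda>j. ennreal (2 powr (\<alpha> * real j)) *
            Lp_norm (restrict_space lborel {0..<1}) p
              (\<lambda>x. ennreal (cmod (torus_block \<epsilon>\<^sub>0 \<phi> f j x))))"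

definition grid_scale :: "nat \<Rightarrow> real" where
  "grid_scale n = real n * 2 powr (- of_int \<lfloor>log 2 (real n)\<rfloor>)"

definition grid_block ::
    "real \<Rightarrow> (real \<Rightarrow> real) \<Rightarrow> nat \<Rightarrow> (real \<Rightarrow> complex) \<Rightarrow> nat \<Rightarrow> real \<Rightarrow> complex" where
  "grid_block \<epsilon>\<^sub>0 \<phi> n f j x =
     (\<Sum>k = - int n..int n - 1. phi_block \<epsilon>\<^sub>0 \<phi> (grid_scale n) j (of_int k) *\<^sub>R
        (inner_grid n f (grid_restrict n (ee k)) * grid_restrict n (ee k) x))"

text \<open>
  Every grid point has mass \<open>1/(2n)\<close> under the uniform measure on the grid, so the \<open>L\<^sup>\<infinity>\<close> norm is the
  maximum norm.
\<close>

definition besov_grid ::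
    "real \<Rightarrow> (real \<Rightarrow> real) \<Rightarrow> nat \<Rightarrow> real \<Rightarrow> ennreal \<Rightarrow> ennreal \<Rightarrow> (real \<Rightarrow> complex) \<Rightarrow> ennreal" where
  "besov_grid \<epsilon>\<^sub>0 \<phi> n \<alpha> p q f =
     Lp_norm (count_space (UNIV :: nat set)) q
       (\<lambda>j. ennreal (2 powr (\<alpha> * real j)) *
            Lp_norm (uniform_count_measure (grid n)) p
              (\<lambda>x. ennreal (cmod (grid_block \<epsilon>\<^sub>0 \<phi> n f j x))))"

end

theory Submission
  imports Defs
begin

text \<open>
  Each Littlewood--Paley block of either error is a linear combination of Fourier modes. In the
  space variable of the noise these modes are orthogonal: for \<open>k \<in> [-n, n)\<close> the heat mode and the
  rounded Euler mode with the same index are correlated, and all other pairs are not, because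
  \<open>e\<^sub>k \<circ> \<rho>\<^sub>n\<close> only contains frequencies congruent to \<open>k\<close> modulo \<open>2n\<close>. The two multipliers differ by
  \<open>O(\<bar>k\<bar>/n) exp (-8k\<^sup>2u)\<close> at time \<open>u\<close>, so every mode contributes variance \<open>O(1 / max(n, \<bar>k\<bar>)\<^sup>2)\<close>, and block
  \<open>j\<close> has variance \<open>O(2\<^sup>j min(n\<^sup>-\<^sup>2, 4\<^sup>-\<^sup>j))\<close>, that is \<open>O(n\<^sup>-\<^sup>2\<^sup>\<theta> 2\<^sup>j\<^sup>(\<^sup>2\<^sup>\<theta>\<^sup>-\<^sup>1\<^sup>))\<close> for every \<open>\<theta> \<in> [0, 1]\<close>.

  Gaussianity turns this into a bound for moments of a large even order \<open>2p\<close>. The supremum of a block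
  over the torus is controlled by its values on a grid with \<open>O(4\<^sup>j)\<close> points; the union over these points
  costs only \<open>4\<^sup>j\<close> in the \<open>2p\<close>-th moment, which is absorbed by taking \<open>p\<close> large, since only
  \<open>\<theta> < 1/2 - \<alpha>\<close> is needed. Pointwise values of \<open>O\<^sub>t\<close> enter the torus blocks through Riemann
  sums, whose aliasing errors obey the same variance bound as soon as the mesh resolves the block.
\<close>

section \<open>Gaussian moments of Wiener integrals\<close>

text \<open>The solution is given as a Wiener integral for one point x at a time, so its Fourier
  coefficients are not Wiener integrals by definition. All moments are therefore computed for
  \<open>mode_error\<close>, a finite combination of point values of the two solutions and hence a
  Wiener integral by linearity. It serves both norms: 2n sampling points reproduce the grid
  coefficients exactly, and letting the number of sampling points tend to infinity gives the torus
  coefficients almost surely, because the version of the heat solution is continuous.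

  The parameter \<theta> comes from min(n^-2, 4^-j) \<le> n^(-2\<theta>) 4^(-j(1-\<theta>)). The
  resulting q-th moment is O(n^(-q\<theta>)) for every \<theta> in [0, 1] with \<theta> < 1/2 -
  \<alpha>; the endpoint 1/2 - \<alpha> itself is not reached, because summing the blocks and paying
  for the union over points needs a strictly negative power of 2^j. For \<alpha> > -1/2 the term 1/q
  in the claim is exactly the room left below that endpoint. For \<alpha> < -1/2 the value \<theta>
  = 1 lies strictly below it, so the full rate 1 is available.\<close>

lemma (in prob_space) centred_normal_square_integrable:
  assumes "centred_normal M X"
  shows "integrable M (\<lambda>\<omega>. (X \<omega>)\<^sup>2)"
  using assms unfolding centred_normal_def
proof (elim conjE disjE exE)
  assume [measurable]: "X \<in> borel_measurable M" and "AE \<omega> in M. X \<omega> = 0"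
  then show ?thesis
    by (subst integrable_cong_AE[where g = "\<lambda>_. 0"]) auto
next
  fix \<sigma> :: real assume s: "0 < \<sigma>" "distributed M lborel X (normal_density 0 \<sigma>)"
  have "integrable lborel (\<lambda>x. normal_density 0 \<sigma> x * x\<^sup>2)"
    using integrable_normal_moment[of \<sigma> 0 2] s by simp
  then show ?thesis
    using distributed_integrable[OF s(2), of "\<lambda>x. x\<^sup>2"] by simp
qed

text \<open>The factor is the double factorial (2p-1)!!, the 2p-th moment of a standard normal
  variable. The almost surely vanishing variable is a separate case since it has no normal
  density.\<close>

lemma (in prob_space) centred_normal_even_moment:
  assumes "centred_normal M X"
  shows "(\<integral>\<^sup>+\<omega>. ennreal (X \<omega> ^ (2 * p)) \<partial>M)
      \<le> ennreal (fact (2 * p) / (2 ^ p * fact p) * (\<integral>\<omega>. (X \<omega>)\<^sup>2 \<partial>M) ^ p)"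
  using assms unfolding centred_normal_def
proof (elim conjE disjE exE)
  assume [measurable]: "X \<in> borel_measurable M" and X0: "AE \<omega> in M. X \<omega> = 0"
  have v: "(\<integral>\<omega>. (X \<omega>)\<^sup>2 \<partial>M) = 0"
    using X0 by (subst integral_cong_AE[where g = "\<lambda>_. 0"]) auto
  have "(\<integral>\<^sup>+\<omega>. ennreal (X \<omega> ^ (2 * p)) \<partial>M) = (\<integral>\<^sup>+\<omega>. ennreal (0 ^ (2 * p)) \<partial>M)"
    using X0 by (intro nn_integral_cong_AE) auto
  then show ?thesis
    by (cases p) (auto simp: v emeasure_space_1)
next
  fix \<sigma> :: real assume s: "0 < \<sigma>" and D: "distributed M lborel X (normal_density 0 \<sigma>)"
  have m: "(\<integral>\<omega>. X \<omega> ^ (2 * k) \<partial>M) = fact (2 * k) / ((2 / \<sigma>\<^sup>2) ^ k * fact k)" for k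
    using distributed_integral[OF D, of "\<lambda>x. x ^ (2 * k)"]
      integral_normal_moment_even[OF s, of 0 k] by simp
  have v: "(\<integral>\<omega>. (X \<omega>)\<^sup>2 \<partial>M) = \<sigma>\<^sup>2"
    using m[of 1] by (simp add: fact_numeral)
  have "integrable M (\<lambda>\<omega>. X \<omega> ^ (2 * p))"
    using distributed_integrable[OF D, of "\<lambda>x. x ^ (2 * p)"]
      integrable_normal_moment[OF s, of 0 "2 * p"] by simp
  then have "(\<integral>\<^sup>+\<omega>. ennreal (X \<omega> ^ (2 * p)) \<partial>M) = ennreal (\<integral>\<omega>. X \<omega> ^ (2 * p) \<partial>M)"
    by (intro nn_integral_eq_integral) auto
  then show ?thesis
    unfolding m v using s by (simp add: power_divide)
qed

lemma bounded_borel_sets_finite: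
  assumes "A \<in> bounded_borel_sets"
  shows "A \<in> sets borel" "emeasure lborel A < \<infinity>" "A \<subseteq> {0..} \<times> {0..<1}"
  using assms emeasure_bounded_finite unfolding bounded_borel_sets_def by auto

definition moment_const :: "nat \<Rightarrow> real" where
  "moment_const p = fact (2 * p) / (2 ^ p * fact p)"

lemma moment_const_pos: "0 < moment_const p"
  by (simp add: moment_const_def)

context prob_space
begin

lemma white_noise_sum_normal:
  fixes k :: nat
  assumes "white_noise M \<xi>" "\<And>i. i < k \<Longrightarrow> A i \<in> bounded_borel_sets"
  shows "centred_normal M (\<lambda>\<omega>. \<Sum>i<k. b i * \<xi> (A i) \<omega>)"
proof -
  have "\<forall>k A. (\<forall>i<k. A i \<in> bounded_borel_sets) \<longrightarrow> centred_gaussian_vector M k (\<lambda>i. \<xi> (A i))"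
    using assms(1) unfolding white_noise_def by blast
  with assms(2) have "centred_gaussian_vector M k (\<lambda>i. \<xi> (A i))"
    by blast
  then show ?thesis
    unfolding centred_gaussian_vector_def by blast
qed

lemma white_noise_normal:
  assumes "white_noise M \<xi>" "A \<in> bounded_borel_sets"
  shows "centred_normal M (\<xi> A)"
  using white_noise_sum_normal[OF assms(1), of "Suc 0" "\<lambda>_. A" "\<lambda>_. 1"] assms(2)
  by simp

lemma white_noise_measurable:
  assumes "white_noise M \<xi>" "A \<in> bounded_borel_sets"
  shows "\<xi> A \<in> borel_measurable M"
  using white_noise_normal[OF assms] by (simp add: centred_normal_def)

text \<open>The covariance in \<open>white_noise\<close> is a Bochner integral, which is 0 by
  default for a non-integrable function. Integrability of the product is therefore derived
  separately, from square integrability of the Gaussian factors.\<close>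

lemma white_noise_cov:
  assumes "white_noise M \<xi>" "A \<in> bounded_borel_sets" "B \<in> bounded_borel_sets"
  shows "integrable M (\<lambda>\<omega>. \<xi> A \<omega> * \<xi> B \<omega>)"
    and "(\<integral>\<omega>. \<xi> A \<omega> * \<xi> B \<omega> \<partial>M) = measure lborel (A \<inter> B)"
proof -
  note [measurable] = white_noise_measurable[OF assms(1,2)] white_noise_measurable[OF assms(1,3)]
  have "integrable M (\<lambda>\<omega>. (\<xi> A \<omega>)\<^sup>2 + (\<xi> B \<omega>)\<^sup>2)"
    using assms by (intro Bochner_Integration.integrable_add centred_normal_square_integrable
        white_noise_normal)
  then show "integrable M (\<lambda>\<omega>. \<xi> A \<omega> * \<xi> B \<omega>)"
  proof (rule Bochner_Integration.integrable_bound)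
    have "\<bar>x * y\<bar> \<le> \<bar>x\<^sup>2 + y\<^sup>2\<bar>" for x y :: real
    proof -
      have "2 * \<bar>x * y\<bar> \<le> x\<^sup>2 + y\<^sup>2"
        using sum_squares_bound[of "\<bar>x\<bar>" "\<bar>y\<bar>"] by (simp add: abs_mult)
      moreover have "0 \<le> \<bar>x * y\<bar>"
        by (rule abs_ge_zero)
      moreover have "x\<^sup>2 + y\<^sup>2 \<le> \<bar>x\<^sup>2 + y\<^sup>2\<bar>"
        by (rule abs_ge_self)
      moreover have "a \<le> c" if "2 * a \<le> b" "0 \<le> a" "b \<le> c" for a b c :: real
        using that by linarith
      ultimately show ?thesis
        by blast
    qed
    then show "AE \<omega> in M. norm (\<xi> A \<omega> * \<xi> B \<omega>) \<le> norm ((\<xi> A \<omega>)\<^sup>2 + (\<xi> B \<omega>)\<^sup>2)"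
      unfolding real_norm_def by (intro AE_I2)
  qed measurable
  show "(\<integral>\<omega>. \<xi> A \<omega> * \<xi> B \<omega> \<partial>M) = measure lborel (A \<inter> B)"
  proof -
    have "\<forall>(k::nat) A. (\<forall>i<k. A i \<in> bounded_borel_sets) \<longrightarrow>
        (\<forall>i<k. \<forall>j<k. (\<integral>\<omega>. \<xi> (A i) \<omega> * \<xi> (A j) \<omega> \<partial>M) = measure lborel (A i \<inter> A j))"
      using assms(1) unfolding white_noise_def by blast
    from this[rule_format, of 2 "\<lambda>i. if i = 0 then A else B" 0 1] show ?thesis
      using assms(2,3) by auto
  qed
qed

text \<open>Ito isometry for simple integrands. The sets may overlap: both squares expand into the
  same double sum over the measures of \<open>A i \<inter> A j\<close>.\<close>

lemma white_noise_isometry: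
  fixes b :: "nat \<Rightarrow> real"
  assumes W: "white_noise M \<xi>" and A: "\<And>i. i < k \<Longrightarrow> A i \<in> bounded_borel_sets"
  shows "ennreal (\<integral>\<omega>. (\<Sum>i<k. b i * \<xi> (A i) \<omega>)\<^sup>2 \<partial>M)
    = (\<integral>\<^sup>+z. ennreal ((\<Sum>i<k. b i * indicator (A i) z)\<^sup>2) \<partial>lborel)"
proof -
  have sq: "(\<Sum>i<k. b i * y i)\<^sup>2 = (\<Sum>i<k. \<Sum>j<k. b i * b j * (y i * y j))" for y :: "nat \<Rightarrow> real"
    by (simp add: power2_eq_square sum_product algebra_simps)
  have I: "integrable lborel (\<lambda>z. indicator (A i) z * indicator (A j) z :: real)"
    if "i < k" "j < k" for i j
  proof -
    have "emeasure lborel (A i \<inter> A j) \<le> emeasure lborel (A i)"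
      using bounded_borel_sets_finite[OF A[OF that(1)]] by (intro emeasure_mono) auto
    then have "emeasure lborel (A i \<inter> A j) < \<infinity>"
      using bounded_borel_sets_finite[OF A[OF that(1)]] by simp
    then show ?thesis
      using bounded_borel_sets_finite[OF A[OF that(1)]] bounded_borel_sets_finite[OF A[OF that(2)]]
      by (simp add: indicator_inter_arith[symmetric])
  qed
  have "(\<integral>\<omega>. (\<Sum>i<k. b i * \<xi> (A i) \<omega>)\<^sup>2 \<partial>M)
      = (\<Sum>i<k. \<Sum>j<k. b i * b j * measure lborel (A i \<inter> A j))"
    unfolding sq
    by (subst Bochner_Integration.integral_sum,
        intro Bochner_Integration.integrable_sum integrable_mult_right white_noise_cov W A, simp_all)
       (intro sum.cong refl, subst Bochner_Integration.integral_sum,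
        (intro integrable_mult_right white_noise_cov W A, simp_all add: white_noise_cov W A)+)
  moreover have "has_bochner_integral lborel (\<lambda>z. (\<Sum>i<k. b i * indicator (A i) z)\<^sup>2)
      (\<Sum>i<k. \<Sum>j<k. b i * b j * measure lborel (A i \<inter> A j))"
    unfolding sq
  proof (intro has_bochner_integral_sum has_bochner_integral_mult_right)
    fix i j assume "i \<in> {..<k}" "j \<in> {..<k}"
    then show "has_bochner_integral lborel (\<lambda>z. indicator (A i) z * indicator (A j) z)
        (measure lborel (A i \<inter> A j))"
      using I[of i j] by (auto simp: has_bochner_integral_iff indicator_inter_arith[symmetric])
  qed
  ultimately show ?thesis
    by (auto simp: has_bochner_integral_iff nn_integral_eq_integral)
qed

text \<open>With complex coefficients the sum is no longer a real normal variable, so real and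
  imaginary part are treated separately; each is normal with variance at most the squared norm of
  the integrand. The factor \<open>2 ^ (p + 1)\<close> consists of \<open>2 ^ p\<close> from
  splitting the power of the modulus and 2 for the two parts.\<close>

lemma white_noise_complex_moment:
  fixes a :: "nat \<Rightarrow> complex"
  assumes W: "white_noise M \<xi>" and A: "\<And>i. i < k \<Longrightarrow> A i \<in> bounded_borel_sets"
  shows "(\<integral>\<^sup>+\<omega>. ennreal (cmod (\<Sum>i<k. a i * complex_of_real (\<xi> (A i) \<omega>)) ^ (2 * p)) \<partial>M)
    \<le> ennreal (2 ^ (p + 1) * moment_const p) *
        (\<integral>\<^sup>+z\<in>{0..} \<times> {0..<1}. ennreal ((cmod (\<Sum>i<k. a i * indicator (A i) z))\<^sup>2) \<partial>lborel) ^ p"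
    (is "?L \<le> _ * ?V ^ p")
proof -
  define P where "P b \<omega> = (\<Sum>i<k. b i * \<xi> (A i) \<omega>)" for b :: "nat \<Rightarrow> real" and \<omega>
  define F where "F b z = (\<Sum>i<k. b i * indicator (A i) z)" for b :: "nat \<Rightarrow> real" and z :: "real \<times> real"
  have [measurable]: "P b \<in> borel_measurable M" for b
    unfolding P_def
    by (intro borel_measurable_sum borel_measurable_times borel_measurable_const
        white_noise_measurable[OF W A]) simp
  have re: "Re (\<Sum>i<k. a i * complex_of_real (\<xi> (A i) \<omega>)) = P (\<lambda>i. Re (a i)) \<omega>"
    and im: "Im (\<Sum>i<k. a i * complex_of_real (\<xi> (A i) \<omega>)) = P (\<lambda>i. Im (a i)) \<omega>" for \<omega>
    by (simp_all add: P_def)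
  have ref: "Re (\<Sum>i<k. a i * indicator (A i) z) = F (\<lambda>i. Re (a i)) z"
    and imf: "Im (\<Sum>i<k. a i * indicator (A i) z) = F (\<lambda>i. Im (a i)) z" for z
    unfolding F_def Re_sum Im_sum by (intro sum.cong refl; simp add: indicator_def)+
  have mom: "(\<integral>\<^sup>+\<omega>. ennreal (P b \<omega> ^ (2 * p)) \<partial>M) \<le> ennreal (moment_const p) * ?V ^ p"
    if le: "\<And>z. \<bar>F b z\<bar> \<le> cmod (\<Sum>i<k. a i * indicator (A i) z)" for b
  proof -
    have "(\<integral>\<^sup>+\<omega>. ennreal (P b \<omega> ^ (2 * p)) \<partial>M)
        \<le> ennreal (moment_const p) * ennreal (\<integral>\<omega>. (P b \<omega>)\<^sup>2 \<partial>M) ^ p"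
      using centred_normal_even_moment[OF white_noise_sum_normal[OF W A], of k, where p = p]
      by (simp add: P_def moment_const_def ennreal_mult[symmetric] ennreal_power)
    moreover have "ennreal (\<integral>\<omega>. (P b \<omega>)\<^sup>2 \<partial>M) \<le> ?V"
    proof -
      have "ennreal (\<integral>\<omega>. (P b \<omega>)\<^sup>2 \<partial>M) = (\<integral>\<^sup>+z. ennreal ((F b z)\<^sup>2) \<partial>lborel)"
        unfolding P_def F_def by (rule white_noise_isometry[OF W A])
      also have "\<dots> \<le> ?V"
      proof (rule nn_integral_mono)
        fix z
        have "F b z = 0" if "z \<notin> {0..} \<times> {0..<1}"
        proof -
          have "indicator (A i) z = (0::real)" if "i < k" for i
            using bounded_borel_sets_finite(3)[OF A[OF that]] \<open>z \<notin> _\<close> by (auto simp: indicator_def)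
          then show ?thesis by (simp add: F_def)
        qed
        moreover have "(F b z)\<^sup>2 \<le> (cmod (\<Sum>i<k. a i * indicator (A i) z))\<^sup>2"
          using le[of z] by (metis abs_ge_zero power2_abs power_mono)
        ultimately show "ennreal ((F b z)\<^sup>2) \<le>
            ennreal ((cmod (\<Sum>i<k. a i * indicator (A i) z))\<^sup>2) * indicator ({0..} \<times> {0..<1}) z"
          by (auto simp: indicator_def ennreal_leI)
      qed
      finally show ?thesis .
    qed
    ultimately show ?thesis
      by (meson mult_left_mono order_trans power_mono zero_le)
  qed
  have pw: "cmod w ^ (2 * p) \<le> 2 ^ p * (Re w ^ (2 * p) + Im w ^ (2 * p))" for w
  proof -
    have "(x + y) ^ p \<le> 2 ^ p * (x ^ p + y ^ p)" if "0 \<le> x" "0 \<le> y" for x y :: real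
    proof -
      have "(x + y) ^ p \<le> (2 * max x y) ^ p"
        using that by (intro power_mono) auto
      also have "\<dots> \<le> 2 ^ p * (x ^ p + y ^ p)"
        using that by (auto simp: power_mult_distrib max_def)
      finally show ?thesis .
    qed
    from this[of "(Re w)\<^sup>2" "(Im w)\<^sup>2"] show ?thesis
      by (simp add: power_mult cmod_power2)
  qed
  have "?L \<le> (\<integral>\<^sup>+\<omega>. ennreal (2 ^ p) * (ennreal (P (\<lambda>i. Re (a i)) \<omega> ^ (2 * p))
      + ennreal (P (\<lambda>i. Im (a i)) \<omega> ^ (2 * p))) \<partial>M)"
  proof (intro nn_integral_mono)
    fix \<omega>
    show "ennreal (cmod (\<Sum>i<k. a i * complex_of_real (\<xi> (A i) \<omega>)) ^ (2 * p))
      \<le> ennreal (2 ^ p) * (ennreal (P (\<lambda>i. Re (a i)) \<omega> ^ (2 * p))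
        + ennreal (P (\<lambda>i. Im (a i)) \<omega> ^ (2 * p)))"
      using pw[of "\<Sum>i<k. a i * complex_of_real (\<xi> (A i) \<omega>)"]
      by (simp only: re im ennreal_plus[symmetric] ennreal_mult[symmetric]
          zero_le_power zero_le_even_power even_mult_iff even_numeral simp_thms
          zero_le_numeral ennreal_leI add_nonneg_nonneg)
  qed
  also have "\<dots> = ennreal (2 ^ p) * ((\<integral>\<^sup>+\<omega>. ennreal (P (\<lambda>i. Re (a i)) \<omega> ^ (2 * p)) \<partial>M)
      + (\<integral>\<^sup>+\<omega>. ennreal (P (\<lambda>i. Im (a i)) \<omega> ^ (2 * p)) \<partial>M))"
    by (simp add: nn_integral_cmult nn_integral_add)
  also have "\<dots> \<le> ennreal (2 ^ p) * (ennreal (moment_const p) * ?V ^ p + ennreal (moment_const p) * ?V ^ p)"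
    by (intro mult_left_mono add_mono mom)
       (simp_all only: ref[symmetric] imf[symmetric] abs_Re_le_cmod abs_Im_le_cmod zero_le)
  also have "\<dots> = ennreal (2 ^ (p + 1) * moment_const p) * ?V ^ p"
  proof -
    have "ennreal x * (ennreal y * z + ennreal y * z) = ennreal (2 * (x * y)) * z"
      if "0 \<le> x" "0 \<le> y" for x y z
    proof -
      have "ennreal x * (ennreal y * z + ennreal y * z) = (ennreal x * ennreal y + ennreal x * ennreal y) * z"
        by (simp only: distrib_left distrib_right mult.assoc)
      also have "ennreal x * ennreal y + ennreal x * ennreal y = ennreal (x * y + x * y)"
        using that by (simp only: ennreal_mult ennreal_plus mult_nonneg_nonneg)
      also have "x * y + x * y = 2 * (x * y)"
        by (rule mult_2[symmetric])
      finally show ?thesis .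
    qed
    then have "ennreal (2 ^ p) * (ennreal (moment_const p) * z + ennreal (moment_const p) * z)
        = ennreal (2 * (2 ^ p * moment_const p)) * z" for z
      by (simp only: zero_le_power zero_le_numeral less_imp_le[OF moment_const_pos])
    moreover have "2 * (2 ^ p * moment_const p) = 2 ^ (p + 1) * moment_const p"
      by simp
    ultimately show ?thesis
      by (simp only:)
  qed
  finally show ?thesis .
qed

end

section \<open>Wiener integrals as mean-square limits: linearity and even moments\<close>

lemma nn_integral_limit_le:
  fixes u :: "nat \<Rightarrow> 'a \<Rightarrow> ennreal"
  assumes [measurable]: "\<And>n. u n \<in> borel_measurable M"
    and lim: "AE x in M. (\<lambda>n. u n x) \<longlonglongrightarrow> v x"
    and le: "\<forall>\<^sub>F n in sequentially. (\<integral>\<^sup>+x. u n x \<partial>M) \<le> C"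
  shows "(\<integral>\<^sup>+x. v x \<partial>M) \<le> C"
proof -
  have "(\<integral>\<^sup>+x. v x \<partial>M) \<le> (\<integral>\<^sup>+x. liminf (\<lambda>n. u n x) \<partial>M)"
    using lim by (intro nn_integral_mono_AE) (auto elim!: eventually_mono simp: lim_imp_Liminf)
  also have "\<dots> \<le> liminf (\<lambda>n. \<integral>\<^sup>+x. u n x \<partial>M)"
    by (rule nn_integral_liminf) simp
  also have "\<dots> \<le> liminf (\<lambda>n::nat. C)"
    by (rule Liminf_mono[OF le])
  also have "\<dots> = C"
    by (simp add: Liminf_const)
  finally show ?thesis .
qed

lemma cmod_add_sq: "(cmod (x + y))\<^sup>2 \<le> 2 * (cmod x)\<^sup>2 + 2 * (cmod y)\<^sup>2"
proof -
  have "(cmod (x + y))\<^sup>2 \<le> (cmod x + cmod y)\<^sup>2"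
    by (intro power_mono norm_triangle_ineq) auto
  also have "\<dots> \<le> 2 * (cmod x)\<^sup>2 + 2 * (cmod y)\<^sup>2"
    using zero_le_power2[of "cmod x - cmod y"] by (simp add: power2_sum power2_diff)
  finally show ?thesis .
qed

lemma nn_integral_cmod_add_sq:
  assumes [measurable]: "f \<in> borel_measurable M" "g \<in> borel_measurable M"
  shows "(\<integral>\<^sup>+x. ennreal ((cmod (f x + g x))\<^sup>2) \<partial>M)
    \<le> 2 * (\<integral>\<^sup>+x. ennreal ((cmod (f x))\<^sup>2) \<partial>M) + 2 * (\<integral>\<^sup>+x. ennreal ((cmod (g x))\<^sup>2) \<partial>M)"
proof -
  have "(\<integral>\<^sup>+x. ennreal ((cmod (f x + g x))\<^sup>2) \<partial>M)
     \<le> (\<integral>\<^sup>+x. 2 * ennreal ((cmod (f x))\<^sup>2) + 2 * ennreal ((cmod (g x))\<^sup>2) \<partial>M)"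
  proof (intro nn_integral_mono)
    fix x
    have "2 * ennreal ((cmod (f x))\<^sup>2) + 2 * ennreal ((cmod (g x))\<^sup>2)
      = ennreal (2 * (cmod (f x))\<^sup>2 + 2 * (cmod (g x))\<^sup>2)"
      by (simp add: ennreal_mult)
    then show "ennreal ((cmod (f x + g x))\<^sup>2) \<le> 2 * ennreal ((cmod (f x))\<^sup>2) + 2 * ennreal ((cmod (g x))\<^sup>2)"
      using cmod_add_sq[of "f x" "g x"] by (simp only: ennreal_leI)
  qed
  also have "\<dots> = 2 * (\<integral>\<^sup>+x. ennreal ((cmod (f x))\<^sup>2) \<partial>M) + 2 * (\<integral>\<^sup>+x. ennreal ((cmod (g x))\<^sup>2) \<partial>M)"
    by (simp add: nn_integral_add nn_integral_cmult)
  finally show ?thesis .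
qed

text \<open>By the Ito isometry this is the second absolute moment of the Wiener integral of
  \<open>f\<close>. With values in \<open>ennreal\<close> it makes sense before any integrability is
  known.\<close>

definition noise_sq :: "(real \<times> real \<Rightarrow> complex) \<Rightarrow> ennreal" where
  "noise_sq f = (\<integral>\<^sup>+z\<in>{0..} \<times> {0..<1}. ennreal ((cmod (f z))\<^sup>2) \<partial>lborel)"

lemma noise_sq_add:
  assumes [measurable]: "f \<in> borel_measurable borel" "g \<in> borel_measurable borel"
  shows "noise_sq (\<lambda>z. f z + g z) \<le> 2 * noise_sq f + 2 * noise_sq g"
proof -
  have eq: "noise_sq h = (\<integral>\<^sup>+z. ennreal ((cmod (h z * indicator ({0..} \<times> {0..<1}) z))\<^sup>2) \<partial>lborel)" for h
    unfolding noise_sq_def by (intro nn_integral_cong) (simp add: indicator_def)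
  have S[measurable]: "{0..} \<times> {0..<1} \<in> sets (borel :: (real \<times> real) measure)"
    by (intro borel_Times) auto
  show ?thesis
    unfolding eq distrib_right by (rule nn_integral_cmod_add_sq) measurable
qed

lemma noise_sq_cmult:
  assumes [measurable]: "f \<in> borel_measurable borel"
  shows "noise_sq (\<lambda>z. a * f z) = ennreal ((cmod a)\<^sup>2) * noise_sq f"
proof -
  have S[measurable]: "{0..} \<times> {0..<1} \<in> sets (borel :: (real \<times> real) measure)"
    by (intro borel_Times) auto
  show ?thesis
    unfolding noise_sq_def
    by (simp add: norm_mult power_mult_distrib ennreal_mult mult.assoc nn_integral_cmult)
qed

abbreviation simple_integrand :: "nat \<Rightarrow> (nat \<Rightarrow> complex) \<Rightarrow> (nat \<Rightarrow> (real \<times> real) set) \<Rightarrow>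
    real \<times> real \<Rightarrow> complex" where
  "simple_integrand k a A z \<equiv> \<Sum>i<k. a i * indicator (A i) z"

abbreviation simple_integral :: "((real \<times> real) set \<Rightarrow> 'w \<Rightarrow> real) \<Rightarrow> nat \<Rightarrow> (nat \<Rightarrow> complex) \<Rightarrow>
    (nat \<Rightarrow> (real \<times> real) set) \<Rightarrow> 'w \<Rightarrow> complex" where
  "simple_integral \<xi> k a A \<omega> \<equiv> \<Sum>i<k. a i * complex_of_real (\<xi> (A i) \<omega>)"

lemma has_wiener_integralD:
  assumes "has_wiener_integral M \<xi> f X"
  obtains k a A where "\<And>m i. A m i \<in> bounded_borel_sets"
    "(\<lambda>m. noise_sq (\<lambda>z. f z - simple_integrand (k m) (a m) (A m) z)) \<longlonglongrightarrow> 0"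
    "(\<lambda>m. \<integral>\<^sup>+\<omega>. ennreal ((cmod (X \<omega> - simple_integral \<xi> (k m) (a m) (A m) \<omega>))\<^sup>2) \<partial>M) \<longlonglongrightarrow> 0"
    "f \<in> borel_measurable borel" "X \<in> borel_measurable M"
  using assms unfolding has_wiener_integral_def noise_sq_def by auto

lemma has_wiener_integralI:
  assumes "\<And>m i. A m i \<in> bounded_borel_sets"
    "(\<lambda>m. noise_sq (\<lambda>z. f z - simple_integrand (k m) (a m) (A m) z)) \<longlonglongrightarrow> 0"
    "(\<lambda>m. \<integral>\<^sup>+\<omega>. ennreal ((cmod (X \<omega> - simple_integral \<xi> (k m) (a m) (A m) \<omega>))\<^sup>2) \<partial>M) \<longlonglongrightarrow> 0"
    "f \<in> borel_measurable borel" "X \<in> borel_measurable M"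
  shows "has_wiener_integral M \<xi> f X"
  using assms unfolding has_wiener_integral_def noise_sq_def by blast

lemma simple_integrand_measurable:
  assumes "\<And>i. A i \<in> bounded_borel_sets"
  shows "simple_integrand k a A \<in> borel_measurable borel"
proof -
  have [measurable]: "A i \<in> sets borel" for i
    using assms[of i] by (simp add: bounded_borel_sets_def)
  show ?thesis by measurable
qed

lemma tendsto_0_le_ennreal:
  fixes f g h :: "nat \<Rightarrow> ennreal"
  assumes "g \<longlonglongrightarrow> 0" "h \<longlonglongrightarrow> 0" "\<And>m. f m \<le> 2 * g m + 2 * h m"
  shows "f \<longlonglongrightarrow> 0"
proof -
  have "(\<lambda>m. 2 * g m + 2 * h m) \<longlonglongrightarrow> 2 * 0 + 2 * 0"
    by (rule tendsto_add[OF ennreal_tendsto_cmult[OF _ assms(1)] ennreal_tendsto_cmult[OF _ assms(2)]]) simp_all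
  then have lim: "(\<lambda>m. 2 * g m + 2 * h m) \<longlonglongrightarrow> 0"
    by simp
  show ?thesis
    by (rule tendsto_sandwich[OF _ _ tendsto_const lim]) (simp_all add: assms(3))
qed

lemma sum_lessThan_add:
  fixes g :: "nat \<Rightarrow> 'a::comm_monoid_add"
  shows "(\<Sum>i<k + l. g i) = (\<Sum>i<k. g i) + (\<Sum>i<l. g (k + i))"
  by (induction l) (simp_all add: add.assoc)

context prob_space
begin

lemma simple_integral_measurable:
  assumes "white_noise M \<xi>" "\<And>i. A i \<in> bounded_borel_sets"
  shows "simple_integral \<xi> k a A \<in> borel_measurable M"
proof -
  have [measurable]: "\<xi> (A i) \<in> borel_measurable M" for i
    using white_noise_measurable[OF assms(1)] assms(2) by blast
  show ?thesis by measurable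
qed

text \<open>The approximating simple functions are concatenated: at stage m the first
  \<open>k m\<close> terms approximate \<open>f\<close>, the remaining \<open>l m\<close> terms
  approximate \<open>g\<close>.\<close>

lemma has_wiener_integral_add:
  assumes W: "white_noise M \<xi>"
    and "has_wiener_integral M \<xi> f X" "has_wiener_integral M \<xi> g Y"
  shows "has_wiener_integral M \<xi> (\<lambda>z. f z + g z) (\<lambda>\<omega>. X \<omega> + Y \<omega>)"
proof -
  obtain k a A where 1: "\<And>m i. A m i \<in> bounded_borel_sets"
    "(\<lambda>m. noise_sq (\<lambda>z. f z - simple_integrand (k m) (a m) (A m) z)) \<longlonglongrightarrow> 0"
    "(\<lambda>m. \<integral>\<^sup>+\<omega>. ennreal ((cmod (X \<omega> - simple_integral \<xi> (k m) (a m) (A m) \<omega>))\<^sup>2) \<partial>M) \<longlonglongrightarrow> 0"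
    and [measurable]: "f \<in> borel_measurable borel" "X \<in> borel_measurable M"
    by (rule has_wiener_integralD[OF assms(2)]) (rule that)
  obtain l b B where 2: "\<And>m i. B m i \<in> bounded_borel_sets"
    "(\<lambda>m. noise_sq (\<lambda>z. g z - simple_integrand (l m) (b m) (B m) z)) \<longlonglongrightarrow> 0"
    "(\<lambda>m. \<integral>\<^sup>+\<omega>. ennreal ((cmod (Y \<omega> - simple_integral \<xi> (l m) (b m) (B m) \<omega>))\<^sup>2) \<partial>M) \<longlonglongrightarrow> 0"
    and [measurable]: "g \<in> borel_measurable borel" "Y \<in> borel_measurable M"
    by (rule has_wiener_integralD[OF assms(3)]) (rule that)
  define c where "c m i = (if i < k m then a m i else b m (i - k m))" for m i
  define C where "C m i = (if i < k m then A m i else B m (i - k m))" for m i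
  note [measurable] = simple_integrand_measurable[OF 1(1)] simple_integrand_measurable[OF 2(1)]
    simple_integral_measurable[OF W 1(1)] simple_integral_measurable[OF W 2(1)]
  have sum_split: "(\<Sum>i<k m + l m. h (c m i) (C m i))
      = (\<Sum>i<k m. h (a m i) (A m i)) + (\<Sum>i<l m. h (b m i) (B m i))" for m and h :: "_ \<Rightarrow> _ \<Rightarrow> complex"
  proof -
    have "(\<Sum>i<k m + l m. h (c m i) (C m i))
      = (\<Sum>i<k m. h (c m i) (C m i)) + (\<Sum>i<l m. h (c m (k m + i)) (C m (k m + i)))"
      by (rule sum_lessThan_add)
    then show ?thesis
      by (simp add: c_def C_def)
  qed
  show ?thesis
  proof (rule has_wiener_integralI[where k = "\<lambda>m. k m + l m" and a = c and A = C])
    show "C m i \<in> bounded_borel_sets" for m i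
      using 1(1) 2(1) by (simp add: C_def)
    show "(\<lambda>m. noise_sq (\<lambda>z. f z + g z - simple_integrand (k m + l m) (c m) (C m) z)) \<longlonglongrightarrow> 0"
    proof (rule tendsto_0_le_ennreal[OF 1(2) 2(2)])
      fix m
      show "noise_sq (\<lambda>z. f z + g z - simple_integrand (k m + l m) (c m) (C m) z) \<le>
         2 * noise_sq (\<lambda>z. f z - simple_integrand (k m) (a m) (A m) z) +
         2 * noise_sq (\<lambda>z. g z - simple_integrand (l m) (b m) (B m) z)"
        unfolding sum_split[of "\<lambda>x S. x * indicator S _"] add_diff_add
        by (rule noise_sq_add) measurable
    qed
    show "(\<lambda>m. \<integral>\<^sup>+\<omega>. ennreal ((cmod (X \<omega> + Y \<omega> - simple_integral \<xi> (k m + l m) (c m) (C m) \<omega>))\<^sup>2) \<partial>M) \<longlonglongrightarrow> 0"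
    proof (rule tendsto_0_le_ennreal[OF 1(3) 2(3)])
      fix m
      show "(\<integral>\<^sup>+\<omega>. ennreal ((cmod (X \<omega> + Y \<omega> - simple_integral \<xi> (k m + l m) (c m) (C m) \<omega>))\<^sup>2) \<partial>M) \<le>
         2 * (\<integral>\<^sup>+\<omega>. ennreal ((cmod (X \<omega> - simple_integral \<xi> (k m) (a m) (A m) \<omega>))\<^sup>2) \<partial>M) +
         2 * (\<integral>\<^sup>+\<omega>. ennreal ((cmod (Y \<omega> - simple_integral \<xi> (l m) (b m) (B m) \<omega>))\<^sup>2) \<partial>M)"
        unfolding sum_split[of "\<lambda>x S. x * complex_of_real (\<xi> S _)"] add_diff_add
        by (rule nn_integral_cmod_add_sq) measurable
    qed
  qed measurable
qed

lemma has_wiener_integral_cmult: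
  assumes W: "white_noise M \<xi>" and "has_wiener_integral M \<xi> f X"
  shows "has_wiener_integral M \<xi> (\<lambda>z. b * f z) (\<lambda>\<omega>. b * X \<omega>)"
proof -
  obtain k a A where 1: "\<And>m i. A m i \<in> bounded_borel_sets"
    "(\<lambda>m. noise_sq (\<lambda>z. f z - simple_integrand (k m) (a m) (A m) z)) \<longlonglongrightarrow> 0"
    "(\<lambda>m. \<integral>\<^sup>+\<omega>. ennreal ((cmod (X \<omega> - simple_integral \<xi> (k m) (a m) (A m) \<omega>))\<^sup>2) \<partial>M) \<longlonglongrightarrow> 0"
    and [measurable]: "f \<in> borel_measurable borel" "X \<in> borel_measurable M"
    by (rule has_wiener_integralD[OF assms(2)]) (rule that)
  note [measurable] = simple_integrand_measurable[OF 1(1)] simple_integral_measurable[OF W 1(1)]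
  show ?thesis
  proof (rule has_wiener_integralI[where k = k and a = "\<lambda>m i. b * a m i" and A = A])
    have "noise_sq (\<lambda>z. b * f z - simple_integrand (k m) (\<lambda>i. b * a m i) (A m) z)
        = ennreal ((cmod b)\<^sup>2) * noise_sq (\<lambda>z. f z - simple_integrand (k m) (a m) (A m) z)" for m
      unfolding mult.assoc sum_distrib_left[symmetric] right_diff_distrib[symmetric]
      by (rule noise_sq_cmult) measurable
    then show "(\<lambda>m. noise_sq (\<lambda>z. b * f z - simple_integrand (k m) (\<lambda>i. b * a m i) (A m) z)) \<longlonglongrightarrow> 0"
      using ennreal_tendsto_cmult[OF _ 1(2), of "ennreal ((cmod b)\<^sup>2)"] by simp
    have "(\<integral>\<^sup>+\<omega>. ennreal ((cmod (b * X \<omega> - simple_integral \<xi> (k m) (\<lambda>i. b * a m i) (A m) \<omega>))\<^sup>2) \<partial>M)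
        = ennreal ((cmod b)\<^sup>2) * (\<integral>\<^sup>+\<omega>. ennreal ((cmod (X \<omega> - simple_integral \<xi> (k m) (a m) (A m) \<omega>))\<^sup>2) \<partial>M)" for m
      unfolding mult.assoc sum_distrib_left[symmetric] right_diff_distrib[symmetric]
        norm_mult power_mult_distrib
      by (subst nn_integral_cmult[symmetric]) (auto simp: ennreal_mult)
    then show "(\<lambda>m. \<integral>\<^sup>+\<omega>. ennreal ((cmod (b * X \<omega> - simple_integral \<xi> (k m) (\<lambda>i. b * a m i) (A m) \<omega>))\<^sup>2) \<partial>M) \<longlonglongrightarrow> 0"
      using ennreal_tendsto_cmult[OF _ 1(3), of "ennreal ((cmod b)\<^sup>2)"] by simp
  qed (use 1(1) in measurable)
qed

lemma has_wiener_integral_zero: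
  "has_wiener_integral M \<xi> (\<lambda>z. 0) (\<lambda>\<omega>. 0)"
  by (rule has_wiener_integralI[where k = "\<lambda>m. 0" and A = "\<lambda>_ _. {}"])
     (auto simp: noise_sq_def bounded_borel_sets_def)

lemma has_wiener_integral_sum:
  assumes "white_noise M \<xi>" "finite I" "\<And>i. i \<in> I \<Longrightarrow> has_wiener_integral M \<xi> (f i) (X i)"
  shows "has_wiener_integral M \<xi> (\<lambda>z. \<Sum>i\<in>I. b i * f i z) (\<lambda>\<omega>. \<Sum>i\<in>I. b i * X i \<omega>)"
  using assms(2,3)
  by (induction I rule: finite_induct)
     (simp_all add: has_wiener_integral_zero has_wiener_integral_add has_wiener_integral_cmult assms(1))

text \<open>\<open>X\<close> is known only as an L2 limit of simple integrals, which does not by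
  itself pass 2p-th moments to the limit. The modulus is truncated at a level K; for the truncated
  moment an L2 error \<delta> costs only a multiple of \<delta>, which disappears as \<delta> tends
  to 0, and Fatou's lemma then removes K. The factor 2 in front of \<open>v\<close> stems from
  comparing the norm of a simple approximation with that of \<open>f\<close>.\<close>

lemma wiener_integral_even_moment:
  assumes W: "white_noise M \<xi>" and X: "has_wiener_integral M \<xi> f X" and p: "1 \<le> p"
    and v: "noise_sq f \<le> ennreal v" "0 \<le> v"
  shows "(\<integral>\<^sup>+\<omega>. ennreal (cmod (X \<omega>) ^ (2 * p)) \<partial>M)
    \<le> ennreal (4 ^ p * (2 ^ (p + 1) * moment_const p) * (2 * v) ^ p)"
proof -
  obtain k a A where 1: "\<And>m i. A m i \<in> bounded_borel_sets"
    "(\<lambda>m. noise_sq (\<lambda>z. f z - simple_integrand (k m) (a m) (A m) z)) \<longlonglongrightarrow> 0"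
    "(\<lambda>m. \<integral>\<^sup>+\<omega>. ennreal ((cmod (X \<omega> - simple_integral \<xi> (k m) (a m) (A m) \<omega>))\<^sup>2) \<partial>M) \<longlonglongrightarrow> 0"
    and [measurable]: "f \<in> borel_measurable borel" "X \<in> borel_measurable M"
    by (rule has_wiener_integralD[OF X]) (rule that)
  note [measurable] = simple_integrand_measurable[OF 1(1)] simple_integral_measurable[OF W 1(1)]
  define C where "C = 2 ^ (p + 1) * moment_const p"
  have C: "0 \<le> C" using moment_const_pos[of p] by (simp add: C_def)
  have trunc: "(\<integral>\<^sup>+\<omega>. ennreal (min (cmod (X \<omega>)) K ^ (2 * p)) \<partial>M) \<le> ennreal (4 ^ p * C * (2 * v) ^ p)"
    if K: "0 \<le> K" for K
  proof -
    have bd: "(\<integral>\<^sup>+\<omega>. ennreal (min (cmod (X \<omega>)) K ^ (2 * p)) \<partial>M)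
        \<le> ennreal (4 ^ p * C * (2 * v + 2 * \<delta>) ^ p + 4 * K ^ (2 * p - 2) * \<delta>)" if \<delta>: "0 < \<delta>" for \<delta>
    proof -
      have "\<forall>\<^sub>F m in sequentially. noise_sq (\<lambda>z. f z - simple_integrand (k m) (a m) (A m) z) < ennreal \<delta>"
        "\<forall>\<^sub>F m in sequentially. (\<integral>\<^sup>+\<omega>. ennreal ((cmod (X \<omega> - simple_integral \<xi> (k m) (a m) (A m) \<omega>))\<^sup>2) \<partial>M) < ennreal \<delta>"
        using order_tendstoD(2)[OF 1(2), of "ennreal \<delta>"] order_tendstoD(2)[OF 1(3), of "ennreal \<delta>"] \<delta>
        by auto
      then obtain m where m: "noise_sq (\<lambda>z. f z - simple_integrand (k m) (a m) (A m) z) < ennreal \<delta>"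
        "(\<integral>\<^sup>+\<omega>. ennreal ((cmod (X \<omega> - simple_integral \<xi> (k m) (a m) (A m) \<omega>))\<^sup>2) \<partial>M) < ennreal \<delta>"
        using eventually_happens[OF eventually_conj] trivial_limit_sequentially by blast
      define S where "S = simple_integral \<xi> (k m) (a m) (A m)"
      have [measurable]: "S \<in> borel_measurable M" unfolding S_def by measurable
      have "noise_sq (simple_integrand (k m) (a m) (A m))
          = noise_sq (\<lambda>z. f z + (- 1) * (f z - simple_integrand (k m) (a m) (A m) z))"
        by simp
      also have "\<dots> \<le> 2 * noise_sq f + 2 * noise_sq (\<lambda>z. (- 1) * (f z - simple_integrand (k m) (a m) (A m) z))"
        by (rule noise_sq_add) measurable
      also have "noise_sq (\<lambda>z. (- 1) * (f z - simple_integrand (k m) (a m) (A m) z))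
          = noise_sq (\<lambda>z. f z - simple_integrand (k m) (a m) (A m) z)"
        by (subst noise_sq_cmult, intro borel_measurable_diff \<open>f \<in> borel_measurable borel\<close>
            simple_integrand_measurable 1(1)) simp
      also have "2 * noise_sq f + 2 * \<dots> \<le> 2 * ennreal v + 2 * ennreal \<delta>"
        using v m by (intro add_mono mult_left_mono) auto
      also have "\<dots> = ennreal (2 * v + 2 * \<delta>)"
        using v \<delta> by (simp add: ennreal_mult)
      finally have F: "noise_sq (simple_integrand (k m) (a m) (A m)) \<le> ennreal (2 * v + 2 * \<delta>)" .
      have "(\<integral>\<^sup>+\<omega>. ennreal (cmod (S \<omega>) ^ (2 * p)) \<partial>M) \<le> ennreal C * noise_sq (simple_integrand (k m) (a m) (A m)) ^ p"
        unfolding S_def C_def noise_sq_def by (rule white_noise_complex_moment[OF W 1(1)])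
      also have "\<dots> \<le> ennreal C * ennreal (2 * v + 2 * \<delta>) ^ p"
        by (intro mult_left_mono power_mono F) auto
      also have "\<dots> = ennreal (C * (2 * v + 2 * \<delta>) ^ p)"
        using C v \<delta> by (simp only: ennreal_mult ennreal_power add_nonneg_nonneg mult_nonneg_nonneg
            zero_le_numeral zero_le_power less_imp_le)
      finally have S: "(\<integral>\<^sup>+\<omega>. ennreal (cmod (S \<omega>) ^ (2 * p)) \<partial>M) \<le> ennreal (C * (2 * v + 2 * \<delta>) ^ p)" .
      \<comment> \<open>Either the error is at most half of the truncated modulus, which is then at
        most \<open>2 * cmod s\<close>, or two factors of the truncated modulus are each below twice
        the error and the other \<open>2 * p - 2\<close> factors are at most K.\<close>
      have pw: "min (cmod x) K ^ (2 * p) \<le> 4 ^ p * cmod s ^ (2 * p) + 4 * K ^ (2 * p - 2) * (cmod (x - s))\<^sup>2" for x s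
      proof (cases "cmod (x - s) \<le> min (cmod x) K / 2")
        case True
        have "cmod x \<le> cmod s + cmod (x - s)"
          by (metis add.commute diff_add_cancel norm_triangle_ineq)
        then have "min (cmod x) K \<le> 2 * cmod s"
          using True by linarith
        then have "min (cmod x) K ^ (2 * p) \<le> (2 * cmod s) ^ (2 * p)"
          using K by (intro power_mono) auto
        also have "\<dots> = 4 ^ p * cmod s ^ (2 * p)"
          by (simp add: power_mult_distrib power_mult)
        finally show ?thesis
          using K by (simp add: add_increasing2)
      next
        case False
        have "min (cmod x) K ^ (2 * p) = min (cmod x) K ^ (2 * p - 2) * (min (cmod x) K)\<^sup>2"
        proof -
          have "2 * p = (2 * p - 2) + 2"
            using p by simp
          then show ?thesis
            by (metis power_add)
        qed
        also have "\<dots> \<le> K ^ (2 * p - 2) * (2 * cmod (x - s))\<^sup>2"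
          using False K by (intro mult_mono power_mono) auto
        finally show ?thesis
          by (simp add: power_mult_distrib add_increasing algebra_simps)
      qed
      have "(\<integral>\<^sup>+\<omega>. ennreal (min (cmod (X \<omega>)) K ^ (2 * p)) \<partial>M) \<le>
         (\<integral>\<^sup>+\<omega>. ennreal (4 ^ p) * ennreal (cmod (S \<omega>) ^ (2 * p))
            + ennreal (4 * K ^ (2 * p - 2)) * ennreal ((cmod (X \<omega> - S \<omega>))\<^sup>2) \<partial>M)"
      proof (intro nn_integral_mono)
        fix \<omega>
        show "ennreal (min (cmod (X \<omega>)) K ^ (2 * p)) \<le> ennreal (4 ^ p) * ennreal (cmod (S \<omega>) ^ (2 * p))
            + ennreal (4 * K ^ (2 * p - 2)) * ennreal ((cmod (X \<omega> - S \<omega>))\<^sup>2)"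
          using pw[of "X \<omega>" "S \<omega>"] K
          by (subst ennreal_mult[symmetric], simp, simp, subst ennreal_mult[symmetric], simp, simp,
              subst ennreal_plus[symmetric], simp, simp, intro ennreal_leI, simp)
      qed
      also have "\<dots> = ennreal (4 ^ p) * (\<integral>\<^sup>+\<omega>. ennreal (cmod (S \<omega>) ^ (2 * p)) \<partial>M)
            + ennreal (4 * K ^ (2 * p - 2)) * (\<integral>\<^sup>+\<omega>. ennreal ((cmod (X \<omega> - S \<omega>))\<^sup>2) \<partial>M)"
        by (subst nn_integral_add, measurable) (subst nn_integral_cmult, measurable)+
      also have "\<dots> \<le> ennreal (4 ^ p) * ennreal (C * (2 * v + 2 * \<delta>) ^ p) + ennreal (4 * K ^ (2 * p - 2)) * ennreal \<delta>"
        using m(2) by (intro add_mono mult_left_mono S) (auto simp: S_def)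
      also have "\<dots> = ennreal (4 ^ p * C * (2 * v + 2 * \<delta>) ^ p + 4 * K ^ (2 * p - 2) * \<delta>)"
        using K C v \<delta> by (simp add: ennreal_mult[symmetric] mult.assoc)
      finally show ?thesis .
    qed
    have "((\<lambda>\<delta>. ennreal (4 ^ p * C * (2 * v + 2 * \<delta>) ^ p + 4 * K ^ (2 * p - 2) * \<delta>)) \<longlongrightarrow>
        ennreal (4 ^ p * C * (2 * v + 2 * 0) ^ p + 4 * K ^ (2 * p - 2) * 0)) (at_right 0)"
      by (intro tendsto_ennrealI tendsto_intros)
    then have "(\<integral>\<^sup>+\<omega>. ennreal (min (cmod (X \<omega>)) K ^ (2 * p)) \<partial>M)
        \<le> ennreal (4 ^ p * C * (2 * v + 2 * 0) ^ p + 4 * K ^ (2 * p - 2) * 0)"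
      by (rule tendsto_lowerbound) (auto simp: eventually_at_right_less intro!: eventually_mono[OF eventually_at_right_less] bd)
    then show ?thesis by simp
  qed
  show ?thesis
  proof (rule nn_integral_limit_le[where u = "\<lambda>N \<omega>. ennreal (min (cmod (X \<omega>)) (real N) ^ (2 * p))"])
    show "AE \<omega> in M. (\<lambda>N. ennreal (min (cmod (X \<omega>)) (real N) ^ (2 * p))) \<longlonglongrightarrow> ennreal (cmod (X \<omega>) ^ (2 * p))"
    proof (intro AE_I2 tendsto_eventually)
      fix \<omega>
      show "\<forall>\<^sub>F N in sequentially. ennreal (min (cmod (X \<omega>)) (real N) ^ (2 * p)) = ennreal (cmod (X \<omega>) ^ (2 * p))"
        using eventually_ge_at_top[of "nat \<lceil>cmod (X \<omega>)\<rceil>"]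
        by eventually_elim (simp add: min_absorb1 ceiling_le_iff nat_le_iff)
    qed
  qed (use trunc in \<open>auto simp: C_def\<close>)
qed

end

section \<open>Parseval identities on grid cells\<close>

lemma ee_cis: "ee j x = cis (2 * pi * of_int j * x)"
  by (simp add: ee_def cis_conv_exp algebra_simps)

lemma ee_zero [simp]: "ee 0 x = 1" "ee k 0 = 1"
  by (simp_all add: ee_def)

lemma norm_ee [simp]: "cmod (ee k x) = 1"
  by (simp add: ee_cis)

lemma ee_add: "ee (j + k) x = ee j x * ee k x"
  by (simp add: ee_cis cis_mult algebra_simps)

lemma ee_add_arg: "ee k (x + y) = ee k x * ee k y"
  by (simp add: ee_cis cis_mult algebra_simps)

lemma cnj_ee [simp]: "cnj (ee k x) = ee (- k) x"
  by (simp add: ee_cis cis_cnj)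

lemma ee_diff_arg: "ee k (x - y) = ee k x * ee (- k) y"
  using ee_add_arg[of k x "- y"] by (simp add: ee_cis)

lemma ee_one [simp]: "ee k 1 = 1"
  by (simp add: ee_cis cis_multiple_2pi[of "of_int k"])

lemma ee_power: "ee k x ^ i = ee k (real i * x)"
  by (simp add: ee_cis Complex.DeMoivre algebra_simps)

lemma ee_measurable [measurable]: "ee k \<in> borel_measurable borel"
  unfolding ee_cis cis_conv_exp by (intro borel_measurable_continuous_onI continuous_intros)

lemma continuous_ee: "continuous_on A (ee k)"
  unfolding ee_cis cis_conv_exp by (intro continuous_intros)

lemma norm_ee_minus_1: "cmod (ee k x - 1) \<le> 2 * pi * \<bar>of_int k\<bar> * \<bar>x\<bar>"
proof -
  have "ee k x = iexp (2 * pi * of_int k * x)"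
    by (simp add: ee_cis cis_conv_exp)
  then show ?thesis
    using iexp_approx1[of "2 * pi * of_int k * x" 0] by (simp add: abs_mult)
qed

lemma norm_ee_diff: "cmod (ee k x - ee k y) \<le> 2 * pi * \<bar>of_int k\<bar> * \<bar>x - y\<bar>"
proof -
  have "ee k x - ee k y = ee k y * (ee k (x - y) - 1)"
    using ee_add_arg[of k y "x - y"] by (simp add: algebra_simps)
  then show ?thesis
    using norm_ee_minus_1[of k "x - y"] by (simp add: norm_mult)
qed

lemma sum_ee:
  assumes N: "0 < N"
  shows "(\<Sum>i<N. ee k (real i / real N)) = (if int N dvd k then of_nat N else 0)"
proof -
  define w where "w = ee k (1 / real N)"
  have pow: "ee k (real i / real N) = w ^ i" for i
    by (simp add: w_def ee_power)
  have wN: "w ^ N = 1"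
    using N by (simp add: w_def ee_power)
  have w1: "w = 1 \<longleftrightarrow> int N dvd k"
  proof -
    have "w = 1 \<longleftrightarrow> (\<exists>m::int. 2 * pi * of_int k * (1 / real N) = of_int (2 * m) * pi)"
      unfolding w_def ee_cis cis_conv_exp exp_eq_1 by simp
    also have "\<dots> \<longleftrightarrow> (\<exists>m::int. real_of_int k = of_int (int N * m))"
      using N by (intro ex_cong1) (auto simp: field_simps)
    also have "\<dots> \<longleftrightarrow> int N dvd k"
      unfolding dvd_def of_int_eq_iff by simp
    finally show ?thesis .
  qed
  show ?thesis
  proof (cases "int N dvd k")
    case True
    then show ?thesis
      using w1 by (simp add: pow)
  next
    case False
    then have "(\<Sum>i<N. w ^ i) = 0"
      using w1 wN by (simp add: geometric_sum)
    then show ?thesis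
      using False by (simp add: pow)
  qed
qed

text \<open>The condition that sampling at N equidistant points keeps the frequencies in
  \<open>F\<close> apart, i.e. that no two of them are aliases of each other.\<close>

definition inj_mod :: "nat \<Rightarrow> int set \<Rightarrow> bool" where
  "inj_mod N F \<longleftrightarrow> (\<forall>k\<in>F. \<forall>l\<in>F. int N dvd k - l \<longrightarrow> k = l)"

lemma inj_mod_interval:
  assumes "S \<subseteq> {- d..d}" "2 * d < int N"
  shows "inj_mod N S"
  unfolding inj_mod_def
proof (intro ballI impI)
  fix k l assume *: "k \<in> S" "l \<in> S" "int N dvd k - l"
  have "k \<in> {- d..d}" "l \<in> {- d..d}"
    using * assms(1) by auto
  then have "\<bar>k - l\<bar> < int N"
    using assms(2) by auto
  then show "k = l"
    using *(3) zdvd_not_zless[of "\<bar>k - l\<bar>" "int N"] by auto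
qed

text \<open>The exponentials carry \<open>- k\<close> because mode k enters a kernel as e_k(x)
  e_{-k}(y), and the orthogonality is used in the noise variable y.\<close>

lemma discrete_parseval:
  assumes N: "0 < N" and F: "finite F" "inj_mod N F"
  shows "(\<Sum>i<N. (cmod (\<Sum>k\<in>F. a k * ee (- k) (real i / real N)))\<^sup>2)
    = real N * (\<Sum>k\<in>F. (cmod (a k))\<^sup>2)"
proof -
  have "complex_of_real (\<Sum>i<N. (cmod (\<Sum>k\<in>F. a k * ee (- k) (real i / real N)))\<^sup>2)
      = (\<Sum>i<N. \<Sum>k\<in>F. \<Sum>l\<in>F. a k * cnj (a l) * ee (l - k) (real i / real N))"
    unfolding of_real_sum complex_norm_square
    by (simp add: sum_product ee_add[symmetric] mult_ac)
  also have "\<dots> = (\<Sum>k\<in>F. \<Sum>l\<in>F. a k * cnj (a l) * (\<Sum>i<N. ee (l - k) (real i / real N)))"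
    unfolding sum_distrib_left
    by (subst sum.swap, rule sum.cong[OF refl], subst sum.swap, rule refl)
  also have "\<dots> = (\<Sum>k\<in>F. \<Sum>l\<in>F. if k = l then of_nat N * (a k * cnj (a k)) else 0)"
    using F(2) unfolding inj_mod_def
    by (intro sum.cong refl) (auto simp: sum_ee[OF N])
  also have "\<dots> = (\<Sum>k\<in>F. of_nat N * (a k * cnj (a k)))"
    using F(1) by simp
  also have "\<dots> = complex_of_real (real N * (\<Sum>k\<in>F. (cmod (a k))\<^sup>2))"
    by (simp add: sum_distrib_left complex_norm_square del: of_real_power)
  finally show ?thesis
    by (simp only: of_real_eq_iff)
qed

text \<open>For N = 2n this is the rounding in the discrete equation; other N are used for Riemann
  sums and for the Bessel inequality below.\<close>

definition cell_round :: "nat \<Rightarrow> real \<Rightarrow> real" where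
  "cell_round N x = of_int \<lfloor>real N * x\<rfloor> / real N"

lemma cell_round_measurable [measurable]: "cell_round N \<in> borel_measurable borel"
  unfolding cell_round_def by measurable

lemma cell_round_grid:
  assumes "0 < N" "0 \<le> z" "z < 1 / real N"
  shows "cell_round N (real i / real N + z) = real i / real N"
proof -
  have "real N * (real i / real N + z) = real i + real N * z" "0 \<le> real N * z" "real N * z < 1"
    using assms by (simp_all add: field_simps)
  then have "\<lfloor>real N * (real i / real N + z)\<rfloor> = int i"
    by (simp only:) (intro floor_unique, auto)
  then show ?thesis
    by (simp add: cell_round_def)
qed

lemma unit_interval_cells:
  assumes N: "0 < N"
  shows "{0..<1::real} = (\<Union>i<N. {real i / real N..<real (Suc i) / real N})"
    and "disjoint_family_on (\<lambda>i. {real i / real N..<real (Suc i) / real N}) {..<N}"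
proof -
  let ?C = "\<lambda>i. {real i / real N..<real (Suc i) / real N}"
  show "{0..<1::real} = (\<Union>i<N. ?C i)"
  proof (intro equalityI subsetI)
    fix y :: real assume y: "y \<in> {0..<1}"
    define i where "i = nat \<lfloor>real N * y\<rfloor>"
    have "real i \<le> real N * y" "real N * y < real i + 1"
      using y N by (simp_all add: i_def)
    moreover have "real N * y < real N"
      using y N by simp
    ultimately have "real i < real N" "y \<in> ?C i"
      using N by (linarith, auto simp: field_simps)
    then have "i < N" "y \<in> ?C i"
      by simp_all
    then show "y \<in> (\<Union>i<N. ?C i)" by blast
  next
    fix y assume "y \<in> (\<Union>i<N. ?C i)"
    then obtain i where i: "i < N" "y \<in> ?C i" by blast
    have "0 \<le> real i / real N" by simp
    then have "0 \<le> y" using i(2) unfolding atLeastLessThan_iff by linarith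
    have "real (Suc i) / real N \<le> 1"
      using i N by (simp add: field_simps)
    then show "y \<in> {0..<1}" using i(2) \<open>0 \<le> y\<close> unfolding atLeastLessThan_iff by linarith
  qed
  show "disjoint_family_on ?C {..<N}"
    unfolding disjoint_family_on_def
  proof (intro ballI impI)
    fix i j :: nat assume "i \<noteq> j"
    have "?C i \<inter> ?C j = {}" if "i < j" for i j
    proof -
      have "real (Suc i) / real N \<le> real j / real N"
        using that by (intro divide_right_mono) auto
      then show ?thesis by (auto simp del: of_nat_Suc)
    qed
    with \<open>i \<noteq> j\<close> show "?C i \<inter> ?C j = {}"
      by (metis inf_commute linorder_neqE_nat)
  qed
qed

text \<open>Folds the unit interval onto one cell by writing y = i/N + z, so that for fixed offset z
  a sum over all grid points appears.\<close>

lemma nn_integral_cells: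
  assumes N: "0 < N" and [measurable]: "f \<in> borel_measurable borel"
  shows "(\<integral>\<^sup>+y\<in>{0..<1::real}. f y \<partial>lborel)
    = (\<integral>\<^sup>+z\<in>{0..<1 / real N}. (\<Sum>i<N. f (real i / real N + z)) \<partial>lborel)"
proof -
  let ?C = "\<lambda>i. {real i / real N..<real (Suc i) / real N}"
  have "(\<integral>\<^sup>+y\<in>{0..<1::real}. f y \<partial>lborel) = (\<Sum>i<N. \<integral>\<^sup>+y\<in>?C i. f y \<partial>lborel)"
    unfolding unit_interval_cells(1)[OF N] indicator_UN_disjoint[OF finite_lessThan unit_interval_cells(2)[OF N]] sum_distrib_left
    by (intro nn_integral_sum) measurable
  also have "\<dots> = (\<Sum>i<N. \<integral>\<^sup>+z. f (real i / real N + z) * indicator {0..<1 / real N} z \<partial>lborel)"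
  proof (intro sum.cong refl)
    fix i
    have "(\<integral>\<^sup>+y\<in>?C i. f y \<partial>lborel)
        = (\<integral>\<^sup>+z. f (real i / real N + 1 * z) * indicator (?C i) (real i / real N + 1 * z) \<partial>lborel)"
      by (subst nn_integral_real_affine[where c = 1 and t = "real i / real N"]) auto
    also have "\<dots> = (\<integral>\<^sup>+z. f (real i / real N + z) * indicator {0..<1 / real N} z \<partial>lborel)"
      by (intro nn_integral_cong) (auto simp: indicator_def add_divide_distrib)
    finally show "(\<integral>\<^sup>+y\<in>?C i. f y \<partial>lborel)
        = (\<integral>\<^sup>+z. f (real i / real N + z) * indicator {0..<1 / real N} z \<partial>lborel)" .
  qed
  also have "\<dots> = (\<integral>\<^sup>+z\<in>{0..<1 / real N}. (\<Sum>i<N. f (real i / real N + z)) \<partial>lborel)"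
    by (simp add: nn_integral_sum[symmetric] sum_distrib_right)
  finally show ?thesis .
qed

text \<open>For a fixed offset z inside a cell the coefficients \<open>b k z\<close> are constants
  and the points i/N form a full grid, so \<open>discrete_parseval\<close> applies; z is integrated
  afterwards. Letting the coefficients depend on the offset puts an exact mode and a rounded mode of
  the same index into one coefficient, since e_{-k}(y) is e_{-k}(z) times e_{-k} at the rounded
  point.\<close>

lemma cell_parseval:
  fixes b :: "int \<Rightarrow> real \<Rightarrow> complex"
  assumes N: "0 < N" and F: "finite F" "inj_mod N F"
    and b_meas [measurable]: "\<And>k. b k \<in> borel_measurable borel"
    and b_le: "\<And>k z. k \<in> F \<Longrightarrow> 0 \<le> z \<Longrightarrow> z < 1 / real N \<Longrightarrow> (cmod (b k z))\<^sup>2 \<le> B k"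
  shows "(\<integral>\<^sup>+y\<in>{0..<1}. ennreal ((cmod (\<Sum>k\<in>F. b k (y - cell_round N y) * ee (- k) (cell_round N y)))\<^sup>2) \<partial>lborel)
    \<le> ennreal (\<Sum>k\<in>F. B k)"
proof -
  let ?g = "\<lambda>y. ennreal ((cmod (\<Sum>k\<in>F. b k (y - cell_round N y) * ee (- k) (cell_round N y)))\<^sup>2)"
  have "(\<integral>\<^sup>+y\<in>{0..<1}. ?g y \<partial>lborel)
      = (\<integral>\<^sup>+z\<in>{0..<1 / real N}. (\<Sum>i<N. ?g (real i / real N + z)) \<partial>lborel)"
    by (rule nn_integral_cells[OF N]) measurable
  also have "\<dots> \<le> (\<integral>\<^sup>+z\<in>{0..<1 / real N}. ennreal (real N * (\<Sum>k\<in>F. B k)) \<partial>lborel)"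
  proof (intro nn_integral_mono)
    fix z
    show "(\<Sum>i<N. ?g (real i / real N + z)) * indicator {0..<1 / real N} z
        \<le> ennreal (real N * (\<Sum>k\<in>F. B k)) * indicator {0..<1 / real N} z"
    proof (cases "z \<in> {0..<1 / real N}")
      case True
      then have "(\<Sum>i<N. ?g (real i / real N + z))
          = (\<Sum>i<N. ennreal ((cmod (\<Sum>k\<in>F. b k z * ee (- k) (real i / real N)))\<^sup>2))"
        by (intro sum.cong refl) (simp add: cell_round_grid[OF N])
      also have "\<dots> = ennreal (\<Sum>i<N. (cmod (\<Sum>k\<in>F. b k z * ee (- k) (real i / real N)))\<^sup>2)"
        by (intro sum_ennreal) auto
      also have "\<dots> \<le> ennreal (real N * (\<Sum>k\<in>F. B k))"
        unfolding discrete_parseval[OF N F]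
        using True by (intro ennreal_leI mult_left_mono sum_mono b_le) auto
      finally show ?thesis
        using True by simp
    qed simp
  qed
  also have "\<dots> = ennreal (real N * (\<Sum>k\<in>F. B k)) * ennreal (1 / real N)"
    by (simp add: nn_integral_cmult_indicator)
  also have "\<dots> = ennreal (\<Sum>k\<in>F. B k)"
    using N by (subst ennreal_mult''[symmetric]) auto
  finally show ?thesis .
qed

text \<open>The Bessel inequality as a special case of \<open>cell_parseval\<close>: the mesh is
  chosen so fine that no two frequencies of \<open>F\<close> are aliases, and the phase inside a
  cell is put into the coefficient without changing its modulus.\<close>

lemma exponential_parseval:
  assumes F: "finite F"
  shows "(\<integral>\<^sup>+y\<in>{0..<1}. ennreal ((cmod (\<Sum>k\<in>F. a k * ee (- k) y))\<^sup>2) \<partial>lborel)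
    \<le> ennreal (\<Sum>k\<in>F. (cmod (a k))\<^sup>2)"
proof -
  define L where "L = (\<Sum>k\<in>F. nat \<bar>k\<bar>)"
  define N where "N = 2 * L + 1"
  have L: "\<bar>k\<bar> \<le> int L" if "k \<in> F" for k
    using member_le_sum[OF that, of "\<lambda>k. nat \<bar>k\<bar>"] F by (simp add: L_def nat_le_iff)
  have "F \<subseteq> {- int L..int L}"
    using L by (force simp: abs_le_iff)
  then have inj: "inj_mod N F"
    by (rule inj_mod_interval) (simp add: N_def)
  have "(\<Sum>k\<in>F. a k * ee (- k) y) =
      (\<Sum>k\<in>F. (a k * ee (- k) (y - cell_round N y)) * ee (- k) (cell_round N y))" for y
    by (simp add: mult.assoc ee_add_arg[symmetric])
  then show ?thesis
    using cell_parseval[OF _ F inj, of "\<lambda>k z. a k * ee (- k) z" "\<lambda>k. (cmod (a k))\<^sup>2"]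
    by (simp add: N_def norm_mult)
qed

section \<open>Comparison of the Fourier multipliers\<close>

definition heat_mode :: "int \<Rightarrow> real \<Rightarrow> real" where
  "heat_mode k u = exp (- 4 * pi\<^sup>2 * (of_int k)\<^sup>2 * u)"

definition euler_mode :: "real \<Rightarrow> nat \<Rightarrow> int \<Rightarrow> real \<Rightarrow> real" where
  "euler_mode c n k u = (1 + step c n * eigval n k) powr (kappa c n u / step c n)"

text \<open>From (sin x)^2 = (1 - cos 2x)/2 and the cubic Taylor polynomial of exp(2ix), whose
  remainder is at most (2x)^4/24.\<close>

lemma sin_sq_lower: "x\<^sup>2 - x ^ 4 \<le> (sin x)\<^sup>2" for x :: real
proof -
  define w where "w = iexp (2 * x) - (\<Sum>k\<le>3. (\<i> * (2 * x)) ^ k / fact k)"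
  have "cmod w \<le> \<bar>2 * x\<bar> ^ 4 / fact 4"
    unfolding w_def using iexp_approx1[of "2 * x" 3] by (simp add: numeral_eq_Suc)
  moreover have "Re w = cos (2 * x) - (1 - 2 * x\<^sup>2)"
    unfolding w_def by (simp add: numeral_eq_Suc Re_exp power2_eq_square algebra_simps)
  moreover have "Re w \<le> cmod w"
    by (rule complex_Re_le_cmod)
  ultimately have "cos (2 * x) - (1 - 2 * x\<^sup>2) \<le> \<bar>2 * x\<bar> ^ 4 / fact 4"
    by linarith
  then have "cos (2 * x) \<le> 1 - 2 * x\<^sup>2 + 2 / 3 * x ^ 4"
    by (simp add: power_mult_distrib fact_numeral)
  moreover have "0 \<le> x ^ 4"
    by simp
  ultimately show ?thesis
    using cos_double_sin[of x] by linarith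
qed

text \<open>Jordan's inequality squared: on [0, pi/2] the concave sine lies above its chord. It
  provides a decay rate of the Euler multipliers that is uniform in n.\<close>

lemma Jordan_sq:
  assumes "\<bar>x\<bar> \<le> pi / 2"
  shows "4 * x\<^sup>2 / pi\<^sup>2 \<le> (sin x)\<^sup>2"
proof -
  have pos: "2 * y / pi \<le> sin y" if "0 \<le> y" "y \<le> pi / 2" for y
  proof -
    have "concave_on {0..pi} sin"
    proof (rule f''_le0_imp_concave)
      show "\<And>x. x \<in> {0..pi} \<Longrightarrow> (sin has_real_derivative cos x) (at x)"
        by (auto intro!: derivative_eq_intros)
      show "\<And>x. x \<in> {0..pi} \<Longrightarrow> (cos has_real_derivative - sin x) (at x)"
        by (auto intro!: derivative_eq_intros)
    qed (auto intro: sin_ge_zero)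
    moreover have "y = (1 - 2 * y / pi) *\<^sub>R 0 + (2 * y / pi) *\<^sub>R (pi / 2)"
      by simp
    ultimately have "(1 - 2 * y / pi) * sin 0 + (2 * y / pi) * sin (pi / 2) \<le> sin ((1 - 2 * y / pi) *\<^sub>R 0 + (2 * y / pi) *\<^sub>R (pi / 2))"
      using that by (intro concave_onD) (auto simp: field_simps)
    then show ?thesis by simp
  qed
  have "2 * \<bar>x\<bar> / pi \<le> sin \<bar>x\<bar>"
    using assms by (intro pos) auto
  then have "(2 * \<bar>x\<bar> / pi)\<^sup>2 \<le> (sin \<bar>x\<bar>)\<^sup>2"
    by (intro power_mono) auto
  then show ?thesis
    by (simp add: power_divide power_mult_distrib abs_if split: if_splits)
qed

text \<open>A mean value estimate that retains the common decay exp(-m) of both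
  exponentials.\<close>

lemma exp_diff_le:
  fixes a b m :: real
  assumes "m \<le> a" "m \<le> b"
  shows "\<bar>exp (- a) - exp (- b)\<bar> \<le> \<bar>a - b\<bar> * exp (- m)"
proof -
  have *: "\<bar>exp (- a) - exp (- b)\<bar> \<le> \<bar>a - b\<bar> * exp (- m)" if "a \<le> b" "m \<le> a" for a b :: real
  proof -
    have "1 - exp (a - b) \<le> b - a"
      using exp_ge_add_one_self[of "a - b"] by linarith
    then have "exp (- a) * (1 - exp (a - b)) \<le> exp (- a) * (b - a)"
      by (intro mult_left_mono) auto
    also have "exp (- a) * (1 - exp (a - b)) = exp (- a) - exp (- b)"
      by (simp add: right_diff_distrib exp_add[symmetric])
    also have "exp (- a) * (b - a) \<le> exp (- m) * (b - a)"
      using that by (intro mult_right_mono) auto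
    finally show ?thesis
      using that by (simp add: mult.commute)
  qed
  show ?thesis
    using *[of a b] *[of b a] assms by (cases "a \<le> b") (auto simp: abs_minus_commute)
qed

text \<open>Both bounds are ln y \<le> y - 1, taken at y = 1 - x and at y = 1/(1 - x).\<close>

lemma neg_ln_bounds:
  fixes x :: real
  assumes "0 \<le> x" "x \<le> \<delta>" "\<delta> < 1"
  shows "x \<le> - ln (1 - x)" "- ln (1 - x) \<le> x + x\<^sup>2 / (1 - \<delta>)"
proof -
  show "x \<le> - ln (1 - x)"
    using ln_le_minus_one[of "1 - x"] assms by simp
  have "- ln (1 - x) = ln (1 / (1 - x))"
    using assms by (simp add: ln_div)
  also have "\<dots> \<le> 1 / (1 - x) - 1"
    using assms by (intro ln_le_minus_one) auto
  also have "\<dots> = x + x\<^sup>2 / (1 - x)"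
    using assms by (simp add: field_simps power2_eq_square)
  also have "\<dots> \<le> x + x\<^sup>2 / (1 - \<delta>)"
    using assms by (intro add_left_mono divide_left_mono) auto
  finally show "- ln (1 - x) \<le> x + x\<^sup>2 / (1 - \<delta>)" .
qed

text \<open>With \<theta> = k pi/(2n) and s = u/h, the heat multiplier is exp(-4c \<theta>^2 s) and
  the Euler multiplier is exp(-m L), where m is the integer part of s and L = -ln(1 - x). By
  Jordan's inequality both exponents are at least 16 k^2 u - 1, and they differ by O(\<theta>^2 (1 +
  k^2 u)). Half of the decay rate 16 absorbs the factor k^2 u, which leaves the rate 8.\<close>

lemma euler_mode_bounds:
  assumes c: "0 < c" "c < 1 / 4"
  shows "\<exists>C>0. \<forall>n\<ge>1. \<forall>k\<in>{- int n..int n - 1}. \<forall>u\<ge>0.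
    0 \<le> euler_mode c n k u \<and> euler_mode c n k u \<le> C * exp (- 16 * (of_int k)\<^sup>2 * u) \<and>
    \<bar>heat_mode k u - euler_mode c n k u\<bar> \<le> C * (of_int k / real n)\<^sup>2 * exp (- 8 * (of_int k)\<^sup>2 * u)"
proof -
  \<comment> \<open>\<open>A\<close> will bound the symbol error by \<open>A * \<theta> ^ 4\<close>,
    and \<open>B\<close> will bound \<open>L\<close> by \<open>B * \<theta>\<^sup>2\<close> with the
    help of \<theta>^2 \<le> pi^2/4. The \<open>exp 1\<close> in \<open>C\<close> pays for rounding
    the time down to the time grid.\<close>
  define A where "A = 4 * c + 16 * c\<^sup>2 / (1 - 4 * c)"
  define B where "B = 4 * c + 16 * c\<^sup>2 * (pi\<^sup>2 / 4) / (1 - 4 * c)"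
  define C where "C = max (exp 1) (exp 1 * (A * pi\<^sup>2 / c + B) * (pi\<^sup>2 / 4))"
  have A0: "0 \<le> A" and B0: "0 \<le> B"
    using c by (simp_all add: A_def B_def)
  have "0 < C"
    unfolding C_def by (rule less_max_iff_disj[THEN iffD2]) simp
  moreover have "0 \<le> euler_mode c n k u \<and> euler_mode c n k u \<le> C * exp (- 16 * (of_int k)\<^sup>2 * u) \<and>
    \<bar>heat_mode k u - euler_mode c n k u\<bar> \<le> C * (of_int k / real n)\<^sup>2 * exp (- 8 * (of_int k)\<^sup>2 * u)"
    if n: "1 \<le> n" and k: "k \<in> {- int n..int n - 1}" and u: "0 \<le> u" for n k u
  proof -
    define K where "K = real_of_int k"
    define \<theta> where "\<theta> = K * pi / (2 * real n)"
    \<comment> \<open>This is \<open>- step c n * eigval n k\<close>: one Euler step multiplies mode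
      k by \<open>1 - x\<close>, and c < 1/4 keeps x at most 4c, away from 1.\<close>
    define x where "x = 4 * c * (sin \<theta>)\<^sup>2"
    define s where "s = u / step c n"
    define m where "m = real_of_int \<lfloor>s\<rfloor>"
    define L where "L = - ln (1 - x)"
    have n0: "0 < real n" using n by simp
    have h: "0 < step c n" using c n by (simp add: step_def)
    have s0: "0 \<le> s" using u h by (simp add: s_def)
    have m: "0 \<le> m" "m \<le> s" "s \<le> m + 1"
      using s0 by (simp_all add: m_def)
    have "\<bar>K\<bar> \<le> real n"
      using k by (auto simp: K_def)
    then have \<theta>: "\<bar>\<theta>\<bar> \<le> pi / 2"
      using n0 by (simp add: \<theta>_def abs_mult field_simps)
    have \<theta>2: "\<theta>\<^sup>2 = pi\<^sup>2 / 4 * (K / real n)\<^sup>2"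
      by (simp add: \<theta>_def power_mult_distrib power_divide)
    have \<theta>2le: "\<theta>\<^sup>2 \<le> pi\<^sup>2 / 4"
      using power_mono[OF \<theta>, of 2] by (simp add: power_divide)
    have su: "s = 4 * (real n)\<^sup>2 * u / c"
      by (simp add: s_def step_def power_mult_distrib)
    have \<theta>s: "\<theta>\<^sup>2 * s = pi\<^sup>2 * K\<^sup>2 * u / c"
      using n0 by (simp add: \<theta>2 su power_divide)
    have x: "0 \<le> x" "x \<le> 4 * c" "x \<le> 4 * c * \<theta>\<^sup>2" "x < 1"
    proof -
      show "0 \<le> x" using c by (simp add: x_def)
      have "(sin \<theta>)\<^sup>2 \<le> 1"
        by (simp add: abs_square_le_1)
      then show "x \<le> 4 * c"
        using c by (simp add: x_def)
      then show "x < 1" using c by linarith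
      have "(sin \<theta>)\<^sup>2 \<le> \<theta>\<^sup>2"
        using abs_sin_x_le_abs_x[of \<theta>] by (simp add: abs_le_square_iff)
      then show "x \<le> 4 * c * \<theta>\<^sup>2"
        using c by (simp add: x_def)
    qed
    have x2: "x\<^sup>2 \<le> 16 * c\<^sup>2 * \<theta> ^ 4"
      using power_mono[OF x(3,1), of 2] by (simp add: power_mult_distrib power_mult[symmetric])
    have R: "euler_mode c n k u = exp (- (m * L))"
    proof -
      have "1 + step c n * eigval n k = 1 - x"
        using n0 by (simp add: step_def eigval_def x_def \<theta>_def K_def field_simps)
      moreover have "kappa c n u / step c n = m"
        using h by (simp add: kappa_def m_def s_def)
      ultimately show ?thesis
        using x by (simp add: euler_mode_def powr_def L_def)
    qed
    have G: "heat_mode k u = exp (- (4 * c * \<theta>\<^sup>2 * s))"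
      using \<theta>s c by (simp add: heat_mode_def K_def mult.assoc)
    have L: "x \<le> L" "L \<le> x + x\<^sup>2 / (1 - 4 * c)"
      unfolding L_def using neg_ln_bounds[of x "4 * c"] x c by auto
    have "4 * c * (4 * \<theta>\<^sup>2 / pi\<^sup>2) \<le> x"
      unfolding x_def using Jordan_sq[OF \<theta>] c by (intro mult_left_mono) auto
    then have "4 * c * (4 * \<theta>\<^sup>2 / pi\<^sup>2) * s \<le> x * s"
      using s0 by (rule mult_right_mono)
    moreover have "4 * c * (4 * \<theta>\<^sup>2 / pi\<^sup>2) * s = 16 * K\<^sup>2 * u"
    proof -
      have "4 * c * (4 * \<theta>\<^sup>2 / pi\<^sup>2) * s = 16 * c / pi\<^sup>2 * (\<theta>\<^sup>2 * s)"
        by simp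
      also have "\<dots> = 16 * K\<^sup>2 * u"
        unfolding \<theta>s using c by simp
      finally show ?thesis .
    qed
    ultimately have xs: "16 * K\<^sup>2 * u \<le> x * s" by simp
    \<comment> \<open>Rounding s down loses at most one time step, and one step is worth
      \<open>x\<close>, which is less than 1.\<close>
    have mL: "16 * K\<^sup>2 * u - 1 \<le> m * L"
    proof -
      have "x * s \<le> x * m + x * 1"
        using m x by (simp only: distrib_left[symmetric] mult_left_mono)
      moreover have "x * m \<le> m * L"
        using mult_right_mono[OF L(1) m(1)] by (simp add: mult.commute)
      ultimately show ?thesis
        using xs x by simp
    qed
    have cs: "16 * K\<^sup>2 * u - 1 \<le> 4 * c * \<theta>\<^sup>2 * s"
      using xs mult_right_mono[OF x(3) s0] by simp
    have "euler_mode c n k u \<le> exp (1 - 16 * K\<^sup>2 * u)"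
      unfolding R using mL by simp
    also have "\<dots> = exp 1 * exp (- 16 * K\<^sup>2 * u)"
      by (simp add: exp_add[symmetric])
    also have "\<dots> \<le> C * exp (- 16 * K\<^sup>2 * u)"
      by (intro mult_right_mono) (auto simp: C_def)
    finally have 1: "euler_mode c n k u \<le> C * exp (- 16 * K\<^sup>2 * u)" .
    have Lb: "\<bar>4 * c * \<theta>\<^sup>2 - L\<bar> \<le> A * \<theta> ^ 4"
    proof -
      have "4 * c * (\<theta>\<^sup>2 - \<theta> ^ 4) \<le> x"
        unfolding x_def using sin_sq_lower c by (intro mult_left_mono) auto
      then have "4 * c * \<theta>\<^sup>2 - L \<le> 4 * c * \<theta> ^ 4"
        using L(1) by (simp add: right_diff_distrib)
      moreover have "4 * c * \<theta> ^ 4 \<le> A * \<theta> ^ 4"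
        using c by (intro mult_right_mono) (auto simp: A_def)
      moreover have "L - 4 * c * \<theta>\<^sup>2 \<le> A * \<theta> ^ 4"
      proof -
        have "x\<^sup>2 / (1 - 4 * c) \<le> 16 * c\<^sup>2 * \<theta> ^ 4 / (1 - 4 * c)"
          using x2 c by (intro divide_right_mono) auto
        also have "\<dots> \<le> A * \<theta> ^ 4"
          using c by (simp add: A_def distrib_right)
        finally show ?thesis
          using L(2) x(3) by linarith
      qed
      ultimately show ?thesis by linarith
    qed
    have LB: "L \<le> B * \<theta>\<^sup>2"
    proof -
      have "\<theta> ^ 4 = \<theta>\<^sup>2 * \<theta>\<^sup>2"
        by (simp add: power2_eq_square power4_eq_xxxx)
      also have "\<dots> \<le> pi\<^sup>2 / 4 * \<theta>\<^sup>2"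
        using \<theta>2le by (intro mult_right_mono) auto
      finally have "16 * c\<^sup>2 * \<theta> ^ 4 \<le> 16 * c\<^sup>2 * (pi\<^sup>2 / 4 * \<theta>\<^sup>2)"
        by (intro mult_left_mono) auto
      then have "x\<^sup>2 \<le> 16 * c\<^sup>2 * (pi\<^sup>2 / 4 * \<theta>\<^sup>2)"
        using x2 by linarith
      then have "x\<^sup>2 / (1 - 4 * c) \<le> 16 * c\<^sup>2 * (pi\<^sup>2 / 4 * \<theta>\<^sup>2) / (1 - 4 * c)"
        using c by (intro divide_right_mono) auto
      moreover have "B * \<theta>\<^sup>2 = 4 * c * \<theta>\<^sup>2 + 16 * c\<^sup>2 * (pi\<^sup>2 / 4 * \<theta>\<^sup>2) / (1 - 4 * c)"
        by (simp add: B_def distrib_right)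
      ultimately show ?thesis
        using L(2) x(3) by linarith
    qed
    have L0: "0 \<le> L" using L x by linarith
    \<comment> \<open>The error of the symbol, accumulated over time s, is separated from the error
      of rounding the time: (4c \<theta>^2 - L) s + L (s - m). In the first part \<theta>^4 s is
      \<theta>^2 times a multiple of k^2 u.\<close>
    have diff: "\<bar>4 * c * \<theta>\<^sup>2 * s - m * L\<bar> \<le> \<theta>\<^sup>2 * (A * pi\<^sup>2 / c * (K\<^sup>2 * u) + B)"
    proof -
      have "4 * c * \<theta>\<^sup>2 * s - m * L = (4 * c * \<theta>\<^sup>2 - L) * s + L * (s - m)"
        by (simp add: algebra_simps)
      then have "\<bar>4 * c * \<theta>\<^sup>2 * s - m * L\<bar> \<le> \<bar>4 * c * \<theta>\<^sup>2 - L\<bar> * s + L * (s - m)"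
        using abs_triangle_ineq[of "(4 * c * \<theta>\<^sup>2 - L) * s" "L * (s - m)"] s0 L0 m
        by (simp add: abs_mult)
      also have "\<dots> \<le> (A * \<theta> ^ 4) * s + (B * \<theta>\<^sup>2) * 1"
        using Lb LB s0 m L0 by (intro add_mono mult_mono) auto
      also have "(A * \<theta> ^ 4) * s = A * \<theta>\<^sup>2 * (\<theta>\<^sup>2 * s)"
        by (simp add: power2_eq_square power4_eq_xxxx)
      also have "\<dots> + (B * \<theta>\<^sup>2) * 1 = \<theta>\<^sup>2 * (A * pi\<^sup>2 / c * (K\<^sup>2 * u) + B)"
        unfolding \<theta>s by (simp add: algebra_simps)
      finally show ?thesis .
    qed
    define E where "E = exp (- 8 * K\<^sup>2 * u)"
    have E: "0 < E" "exp (- 16 * K\<^sup>2 * u) = E * E" "E \<le> 1" "K\<^sup>2 * u * E \<le> 1"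
    proof -
      show "0 < E" "exp (- 16 * K\<^sup>2 * u) = E * E" "E \<le> 1"
        using u by (simp_all add: E_def exp_add[symmetric])
      have "K\<^sup>2 * u \<le> exp (8 * K\<^sup>2 * u)"
        using exp_ge_add_one_self[of "8 * K\<^sup>2 * u"] mult_nonneg_nonneg[OF zero_le_power2[of K] u]
        unfolding mult.assoc by linarith
      then have "K\<^sup>2 * u * E \<le> exp (8 * K\<^sup>2 * u) * E"
        by (intro mult_right_mono) (auto simp: E_def)
      then show "K\<^sup>2 * u * E \<le> 1"
        by (simp add: E_def exp_add[symmetric])
    qed
    have "\<bar>heat_mode k u - euler_mode c n k u\<bar> \<le> \<bar>4 * c * \<theta>\<^sup>2 * s - m * L\<bar> * exp (- (16 * K\<^sup>2 * u - 1))"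
      unfolding R G by (rule exp_diff_le[OF cs mL])
    also have "\<dots> \<le> \<theta>\<^sup>2 * (A * pi\<^sup>2 / c * (K\<^sup>2 * u) + B) * exp (- (16 * K\<^sup>2 * u - 1))"
      by (intro mult_right_mono diff) auto
    also have "exp (- (16 * K\<^sup>2 * u - 1)) = exp 1 * (E * E)"
      unfolding E(2)[symmetric] by (simp add: exp_add[symmetric])
    also have "\<theta>\<^sup>2 * (A * pi\<^sup>2 / c * (K\<^sup>2 * u) + B) * (exp 1 * (E * E))
       = \<theta>\<^sup>2 * exp 1 * (A * pi\<^sup>2 / c * (K\<^sup>2 * u * E) + B * E) * E"
      by (simp add: algebra_simps)
    also have "\<dots> \<le> \<theta>\<^sup>2 * exp 1 * (A * pi\<^sup>2 / c * 1 + B * 1) * E"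
      using E A0 B0 c by (intro mult_right_mono mult_left_mono add_mono) auto
    also have "\<dots> = exp 1 * (A * pi\<^sup>2 / c + B) * (pi\<^sup>2 / 4) * (K / real n)\<^sup>2 * E"
      by (simp add: \<theta>2)
    also have "\<dots> \<le> C * (K / real n)\<^sup>2 * E"
      using E by (intro mult_right_mono) (auto simp: C_def)
    finally have 2: "\<bar>heat_mode k u - euler_mode c n k u\<bar> \<le> C * (K / real n)\<^sup>2 * E" .
    show ?thesis
      using 1 2 by (simp add: R E_def K_def)
  qed
  ultimately show ?thesis by blast
qed

text \<open>The multipliers alone differ to second order in k/n. The first-order loss comes from
  rounding the space variable: inside a cell of width 1/(2n) the phase of e_{-k} moves by at most pi
  |k|/n. Squaring the bound doubles the decay rate from 8 to 16.\<close>

lemma mode_difference_bound: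
  assumes c: "0 < c" "c < 1 / 4"
  shows "\<exists>C>0. \<forall>n\<ge>1. \<forall>k\<in>{- int n..int n - 1}. \<forall>u\<ge>0. \<forall>z\<ge>0. z < 1 / (2 * real n) \<longrightarrow>
    (cmod (heat_mode k u * ee (- k) z - euler_mode c n k u))\<^sup>2
      \<le> C * (of_int k / real n)\<^sup>2 * exp (- 16 * (of_int k)\<^sup>2 * u)"
proof -
  obtain C where C: "0 < C" and bd: "\<And>n k u. 1 \<le> n \<Longrightarrow> k \<in> {- int n..int n - 1} \<Longrightarrow> 0 \<le> u \<Longrightarrow>
    0 \<le> euler_mode c n k u \<and> euler_mode c n k u \<le> C * exp (- 16 * (of_int k)\<^sup>2 * u) \<and>
    \<bar>heat_mode k u - euler_mode c n k u\<bar> \<le> C * (of_int k / real n)\<^sup>2 * exp (- 8 * (of_int k)\<^sup>2 * u)"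
    using euler_mode_bounds[OF c] by blast
  have "(cmod (heat_mode k u * ee (- k) z - euler_mode c n k u))\<^sup>2
      \<le> (C * (1 + pi))\<^sup>2 * (of_int k / real n)\<^sup>2 * exp (- 16 * (of_int k)\<^sup>2 * u)"
    if n: "1 \<le> n" and k: "k \<in> {- int n..int n - 1}" and u: "0 \<le> u" and z: "0 \<le> z" "z < 1 / (2 * real n)"
    for n k u z
  proof -
    define r where "r = \<bar>real_of_int k\<bar> / real n"
    define E where "E = exp (- 8 * (real_of_int k)\<^sup>2 * u)"
    have n0: "0 < real n" using n by simp
    have r: "0 \<le> r" "r \<le> 1"
      using k n0 by (auto simp: r_def field_simps)
    have E: "0 < E" "E \<le> 1" "exp (- 16 * (real_of_int k)\<^sup>2 * u) = E * E"
      using u by (simp_all add: E_def exp_add[symmetric])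
    have rr: "(of_int k / real n)\<^sup>2 = r\<^sup>2"
      by (simp add: r_def power_divide)
    note b = bd[OF n k u, unfolded E(3) rr E_def[symmetric]]
    have "heat_mode k u * ee (- k) z - euler_mode c n k u
        = complex_of_real (heat_mode k u - euler_mode c n k u) * ee (- k) z
          + complex_of_real (euler_mode c n k u) * (ee (- k) z - 1)"
      by (simp add: algebra_simps)
    then have "cmod (heat_mode k u * ee (- k) z - euler_mode c n k u)
        \<le> \<bar>heat_mode k u - euler_mode c n k u\<bar> + euler_mode c n k u * cmod (ee (- k) z - 1)"
      using b by (metis abs_of_nonneg mult.right_neutral norm_ee norm_mult norm_of_real norm_triangle_ineq)
    also have "\<dots> \<le> C * r\<^sup>2 * E + C * (E * E) * (pi * r)"
    proof (intro add_mono mult_mono)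
      have "cmod (ee (- k) z - 1) \<le> 2 * pi * \<bar>of_int k\<bar> * z"
        using norm_ee_minus_1[of "- k" z] z by simp
      also have "\<dots> \<le> 2 * pi * \<bar>of_int k\<bar> * (1 / (2 * real n))"
        using z by (intro mult_left_mono) auto
      finally show "cmod (ee (- k) z - 1) \<le> pi * r"
        by (simp add: r_def)
    qed (use b C E in auto)
    also have "\<dots> \<le> C * r * E + C * E * (pi * r)"
    proof (intro add_mono mult_mono mult_left_mono)
      show "r\<^sup>2 \<le> r"
        using r by (simp add: power2_eq_square mult_left_le)
      show "E * E \<le> E"
        using E by (simp add: mult_left_le)
    qed (use C E r in auto)
    also have "\<dots> = C * (1 + pi) * r * E"
      by (simp add: algebra_simps)
    finally have "(cmod (heat_mode k u * ee (- k) z - euler_mode c n k u))\<^sup>2 \<le> (C * (1 + pi) * r * E)\<^sup>2"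
      by (intro power_mono) auto
    also have "\<dots> = (C * (1 + pi))\<^sup>2 * r\<^sup>2 * (E * E)"
      by (simp add: power_mult_distrib power2_eq_square)
    finally show ?thesis
      unfolding E(3) rr .
  qed
  moreover have "0 < (C * (1 + pi))\<^sup>2"
    using C pi_gt_zero by (simp add: add_pos_pos less_imp_neq[symmetric])
  ultimately show ?thesis by blast
qed

section \<open>Variance of the aliased Fourier modes\<close>

text \<open>Telescoping through 1/(L+1)^2 \<le> 1/L - 1/(L+1), with each square occurring twice. A
  term with l = 0 contributes 0, since division by zero yields 0.\<close>

lemma sum_inverse_squares_le:
  fixes T :: "int set"
  assumes "finite T"
  shows "(\<Sum>l\<in>T. 1 / (real_of_int l)\<^sup>2) \<le> 4"
proof -
  \<comment> \<open>At L = 0 the right-hand side is 4 by the convention for division by zero, and at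
    L = 1 both sides equal 2; genuine telescoping starts there.\<close>
  have tele: "(\<Sum>l\<in>{- int L..int L}. 1 / (real_of_int l)\<^sup>2) \<le> 4 - 2 / real L" for L
  proof (induction L)
    case (Suc L)
    have S: "{- int (Suc L)..int (Suc L)} = insert (- int (Suc L)) (insert (int (Suc L)) {- int L..int L})"
      by auto
    have "(\<Sum>l\<in>{- int (Suc L)..int (Suc L)}. 1 / (real_of_int l)\<^sup>2)
        = 1 / (real_of_int (- int (Suc L)))\<^sup>2 + (1 / (real_of_int (int (Suc L)))\<^sup>2
          + (\<Sum>l\<in>{- int L..int L}. 1 / (real_of_int l)\<^sup>2))"
      unfolding S by (subst sum.insert, simp, simp, subst sum.insert, simp, simp, rule refl)
    also have "\<dots> = 2 / (real (Suc L))\<^sup>2 + (\<Sum>l\<in>{- int L..int L}. 1 / (real_of_int l)\<^sup>2)"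
      by (simp only: of_int_minus power2_minus of_int_of_nat_eq)
    also have "\<dots> \<le> 4 - 2 / real (Suc L)"
    proof (cases "L = 0")
      case False
      then have L: "0 < real L" by simp
      have "2 / (real (Suc L))\<^sup>2 \<le> 2 / (real L * real (Suc L))"
        using L by (intro divide_left_mono) (auto simp: power2_eq_square)
      also have "\<dots> = 2 / real L - 2 / real (Suc L)"
        using L by (simp add: field_simps)
      finally show ?thesis
        using Suc by simp
    qed simp
    finally show ?case .
  qed simp
  have "\<bar>k\<bar> \<le> sum abs T" if "k \<in> T" for k
    using assms member_le_sum[OF that, of abs] by simp
  then have L: "T \<subseteq> {- int (nat (sum abs T))..int (nat (sum abs T))}"
    by (fastforce simp: abs_le_iff)
  have "(\<Sum>l\<in>T. 1 / (real_of_int l)\<^sup>2) \<le> (\<Sum>l\<in>{- int (nat (sum abs T))..int (nat (sum abs T))}. 1 / (real_of_int l)\<^sup>2)"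
    by (rule sum_mono2[OF _ L]) auto
  also have "\<dots> \<le> 4"
    using tele by (rule order_trans) simp
  finally show ?thesis .
qed

text \<open>The kernel is an unordered infinite sum. For u > 0 it converges absolutely, by exp(-x)
  \<le> 1/x and the sum of inverse squares, and can therefore be computed along the symmetric
  intervals.\<close>

lemma heat_kernel_tendsto:
  assumes u: "0 < u"
  shows "(\<lambda>L. \<Sum>m\<in>{- int L..int L}. heat_mode m u * ee m (x - y)) \<longlonglongrightarrow> heat_kernel u x y"
proof -
  have "(\<lambda>m. heat_mode m u) summable_on UNIV"
  proof (rule nonneg_bdd_above_summable_on)
    show "bdd_above (sum (\<lambda>m. heat_mode m u) ` {F. F \<subseteq> UNIV \<and> finite F})"
    proof (rule bdd_aboveI2)
      fix F :: "int set" assume "F \<in> {F. F \<subseteq> UNIV \<and> finite F}"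
      then have F: "finite F" by simp
      have "heat_mode m u \<le> (if m = 0 then 1 else 0) + 1 / (4 * pi\<^sup>2 * u) * (1 / (real_of_int m)\<^sup>2)" for m
      proof (cases "m = 0")
        case False
        have "exp (- x) \<le> 1 / x" if "0 < x" for x :: real
        proof -
          have "x \<le> exp x"
            using exp_ge_add_one_self[of x] by linarith
          then have "inverse (exp x) \<le> inverse x"
            using that by (rule le_imp_inverse_le)
          then show ?thesis
            by (simp add: exp_minus inverse_eq_divide)
        qed
        from this[of "4 * pi\<^sup>2 * (real_of_int m)\<^sup>2 * u"] show ?thesis
          using False u by (simp add: heat_mode_def field_simps)
      qed (simp add: heat_mode_def)
      then have "(\<Sum>m\<in>F. heat_mode m u) \<le> (\<Sum>m\<in>F. (if m = 0 then 1 else 0) + 1 / (4 * pi\<^sup>2 * u) * (1 / (real_of_int m)\<^sup>2))"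
        by (intro sum_mono)
      also have "\<dots> = (if 0 \<in> F then 1 else 0) + 1 / (4 * pi\<^sup>2 * u) * (\<Sum>m\<in>F. 1 / (real_of_int m)\<^sup>2)"
        unfolding sum.distrib sum_distrib_left[symmetric] using F by simp
      also have "\<dots> \<le> 1 + 1 / (4 * pi\<^sup>2 * u) * 4"
        using u sum_inverse_squares_le[OF F] by (intro add_mono mult_left_mono) auto
      finally show "(\<Sum>m\<in>F. heat_mode m u) \<le> 1 + 1 / (4 * pi\<^sup>2 * u) * 4" .
    qed
  qed (simp add: heat_mode_def)
  then have "(\<lambda>m. norm (complex_of_real (heat_mode m u) * ee m (x - y))) summable_on UNIV"
    by (simp add: norm_mult heat_mode_def)
  then have "(\<lambda>m. complex_of_real (heat_mode m u) * ee m (x - y)) summable_on UNIV"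
    by (rule Infinite_Sum.abs_summable_summable)
  then have "((\<lambda>m. complex_of_real (heat_mode m u) * ee m (x - y)) has_sum heat_kernel u x y) UNIV"
    unfolding heat_kernel_def
    by (simp add: heat_mode_def scaleR_conv_of_real has_sum_infsum)
  moreover have "filterlim (\<lambda>L. {- int L..int L}) (finite_subsets_at_top UNIV) sequentially"
    unfolding filterlim_finite_subsets_at_top
  proof (intro allI impI)
    fix X :: "int set" assume "finite X \<and> X \<subseteq> UNIV"
    then have X: "finite X" by simp
    have "X \<subseteq> {- int L..int L}" if "nat (Max (abs ` X)) \<le> L" for L
    proof
      fix k assume "k \<in> X"
      then have "\<bar>k\<bar> \<le> Max (abs ` X)"
        using X by simp
      then show "k \<in> {- int L..int L}"
        using that by auto
    qed
    then show "\<forall>\<^sub>F L in sequentially. finite {- int L..int L} \<and> X \<subseteq> {- int L..int L} \<and> {- int L..int L} \<subseteq> UNIV"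
      by (intro eventually_mono[OF eventually_ge_at_top[of "nat (Max (abs ` X))"]]) simp
  qed
  ultimately show ?thesis
    unfolding has_sum_def by (rule filterlim_compose)
qed

lemma nn_integral_exp_decay:
  assumes a: "0 < a" and t: "0 \<le> t"
  shows "(\<integral>\<^sup>+s\<in>{0..<t}. ennreal (exp (- a * (t - s))) \<partial>lborel) \<le> ennreal (1 / a)"
proof -
  have "(\<integral>\<^sup>+s\<in>{0..<t}. ennreal (exp (- a * (t - s))) \<partial>lborel)
      \<le> (\<integral>\<^sup>+s\<in>{0..t}. ennreal (exp (- a * (t - s))) \<partial>lborel)"
    by (intro nn_integral_mono) (auto simp: indicator_def)
  also have "\<dots> = ennreal (exp (- a * (t - t)) / a - exp (- a * (t - 0)) / a)"
    using a t by (intro nn_integral_FTC_Icc) (auto intro!: derivative_eq_intros)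
  also have "\<dots> \<le> ennreal (1 / a)"
    using a by (intro ennreal_leI) simp
  finally show ?thesis .
qed

text \<open>Tonelli's theorem turns a bound in space at each time into a bound in space-time. A mode
  decaying at rate a integrates to at most 1/a whatever t is; this is where the gain of two powers
  of the frequency comes from.\<close>

lemma noise_sq_time_slices:
  fixes F :: "real \<Rightarrow> real \<Rightarrow> complex"
  assumes t: "0 \<le> t" and F [measurable]: "(\<lambda>(s, y). F s y) \<in> borel_measurable (borel \<Otimes>\<^sub>M borel)"
    and S: "finite S" "\<And>k. k \<in> S \<Longrightarrow> 0 \<le> b k" "\<And>k. k \<in> S \<Longrightarrow> 0 < a k"
    and le: "\<And>s. 0 \<le> s \<Longrightarrow> s < t \<Longrightarrow> (\<integral>\<^sup>+y\<in>{0..<1}. ennreal ((cmod (F s y))\<^sup>2) \<partial>lborel)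
      \<le> ennreal (\<Sum>k\<in>S. b k * exp (- a k * (t - s)))"
  shows "noise_sq (\<lambda>(s, y). indicator ({0..<t} \<times> {0..<1}) (s, y) * F s y) \<le> ennreal (\<Sum>k\<in>S. b k / a k)"
proof -
  have "noise_sq (\<lambda>(s, y). indicator ({0..<t} \<times> {0..<1}) (s, y) * F s y)
      = (\<integral>\<^sup>+z. (case z of (s, y) \<Rightarrow> ennreal ((cmod (F s y))\<^sup>2) * indicator {0..<t} s * indicator {0..<1} y) \<partial>lborel)"
    unfolding noise_sq_def by (intro nn_integral_cong) (auto simp: indicator_def)
  also have "\<dots> = (\<integral>\<^sup>+z. (case z of (s, y) \<Rightarrow> ennreal ((cmod (F s y))\<^sup>2) * indicator {0..<t} s * indicator {0..<1} y) \<partial>(lborel \<Otimes>\<^sub>M lborel))"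
    by (simp only: lborel_prod)
  also have "\<dots> = (\<integral>\<^sup>+s. \<integral>\<^sup>+y. ennreal ((cmod (F s y))\<^sup>2) * indicator {0..<t} s * indicator {0..<1} y \<partial>lborel \<partial>lborel)"
    by (subst lborel.nn_integral_fst[symmetric]) simp_all
  also have "\<dots> \<le> (\<integral>\<^sup>+s. (\<Sum>k\<in>S. ennreal (b k) * (ennreal (exp (- a k * (t - s))) * indicator {0..<t} s)) \<partial>lborel)"
  proof (rule nn_integral_mono)
    fix s
    show "(\<integral>\<^sup>+y. ennreal ((cmod (F s y))\<^sup>2) * indicator {0..<t} s * indicator {0..<1} y \<partial>lborel)
        \<le> (\<Sum>k\<in>S. ennreal (b k) * (ennreal (exp (- a k * (t - s))) * indicator {0..<t} s))"
    proof (cases "s \<in> {0..<t}")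
      case True
      then have "(\<integral>\<^sup>+y. ennreal ((cmod (F s y))\<^sup>2) * indicator {0..<t} s * indicator {0..<1} y \<partial>lborel)
          \<le> ennreal (\<Sum>k\<in>S. b k * exp (- a k * (t - s)))"
        using le[of s] by simp
      also have "\<dots> = (\<Sum>k\<in>S. ennreal (b k) * ennreal (exp (- a k * (t - s))))"
        using S by (subst sum_ennreal[symmetric]) (auto simp: ennreal_mult intro!: sum.cong)
      finally show ?thesis
        using True by simp
    qed simp
  qed
  also have "\<dots> = (\<Sum>k\<in>S. ennreal (b k) * (\<integral>\<^sup>+s\<in>{0..<t}. ennreal (exp (- a k * (t - s))) \<partial>lborel))"
    by (subst nn_integral_sum, measurable) (intro sum.cong refl nn_integral_cmult, measurable)
  also have "\<dots> \<le> (\<Sum>k\<in>S. ennreal (b k) * ennreal (1 / a k))"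
    by (intro sum_mono mult_left_mono nn_integral_exp_decay S t) auto
  also have "\<dots> = ennreal (\<Sum>k\<in>S. b k / a k)"
    using S by (subst sum_ennreal[symmetric]) (auto simp: ennreal_mult[symmetric] less_imp_le intro!: sum.cong)
  finally show ?thesis .
qed

lemma heat_mode_measurable [measurable]: "heat_mode k \<in> borel_measurable borel"
  unfolding heat_mode_def by measurable

lemma euler_mode_measurable [measurable]: "euler_mode c n k \<in> borel_measurable borel"
  unfolding euler_mode_def kappa_def by measurable

section \<open>Aliasing of frequencies modulo the number of sampling points\<close>

lemma inj_mod_modes: "inj_mod (2 * n) {- int n..int n - 1}"
  unfolding inj_mod_def
proof (intro ballI impI)
  fix k l assume *: "k \<in> {- int n..int n - 1}" "l \<in> {- int n..int n - 1}" "int (2 * n) dvd k - l"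
  then have "\<bar>k - l\<bar> < int (2 * n)"
    by auto
  then show "k = l"
    using *(3) zdvd_not_zless[of "\<bar>k - l\<bar>" "int (2 * n)"] by auto
qed

lemma inj_mod_subset: "inj_mod N T \<Longrightarrow> S \<subseteq> T \<Longrightarrow> inj_mod N S"
  unfolding inj_mod_def by blast

text \<open>An N-point average against e_{-k} picks up every frequency m congruent to k modulo N.
  This is the total weight that frequency m receives when these averages are combined with weights
  \<open>w\<close> over \<open>S\<close>.\<close>

definition alias_coeff :: "nat \<Rightarrow> int set \<Rightarrow> (int \<Rightarrow> complex) \<Rightarrow> int \<Rightarrow> complex" where
  "alias_coeff N S w m = (\<Sum>k\<in>S. if int N dvd m - k then w k else 0)"

lemma alias_coeff_unique:
  assumes "finite S" "inj_mod N S" "k \<in> S" "int N dvd m - k"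
  shows "alias_coeff N S w m = w k"
proof -
  have "int N dvd m - l \<longleftrightarrow> l = k" if "l \<in> S" for l
  proof
    assume "int N dvd m - l"
    with assms(4) have "int N dvd (m - k) - (m - l)"
      by (rule dvd_diff)
    moreover have "(m - k) - (m - l) = l - k"
      by simp
    ultimately have "int N dvd l - k"
      by (simp only:)
    then show "l = k"
      using assms(2,3) that unfolding inj_mod_def by blast
  qed (use assms(4) in simp)
  then have "alias_coeff N S w m = (\<Sum>l\<in>S. if l = k then w l else 0)"
    unfolding alias_coeff_def by (intro sum.cong) auto
  then show ?thesis
    using assms by simp
qed

text \<open>With \<open>T\<close> the frequencies of the Euler scheme, these carry exactly their
  intended weight: aliasing only contaminates frequencies outside that range.\<close>

lemma alias_coeff_inside:
  assumes "finite S" "inj_mod N (S \<union> T)" "m \<in> T"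
  shows "alias_coeff N S w m = (if m \<in> S then w m else 0)"
proof (cases "m \<in> S")
  case True
  then show ?thesis
    using alias_coeff_unique[OF assms(1) inj_mod_subset[OF assms(2)] True, of m w] by simp
next
  case False
  have "\<not> int N dvd m - k" if "k \<in> S" for k
    using assms(2,3) False that unfolding inj_mod_def by (metis UnCI)
  then show ?thesis
    using False by (simp add: alias_coeff_def)
qed

text \<open>At most one k in \<open>S\<close> is congruent to m, so the square may be moved inside
  the sum without cross terms.\<close>

lemma norm_alias_coeff:
  assumes "finite S" "inj_mod N S"
  shows "(cmod (alias_coeff N S w m))\<^sup>2 \<le> (\<Sum>k\<in>S. if int N dvd m - k then (cmod (w k))\<^sup>2 else 0)"
proof (cases "\<exists>k\<in>S. int N dvd m - k")
  case True
  then obtain k where k: "k \<in> S" "int N dvd m - k" by blast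
  have "(cmod (w k))\<^sup>2 = (if int N dvd m - k then (cmod (w k))\<^sup>2 else 0)"
    using k by simp
  also have "\<dots> \<le> (\<Sum>k\<in>S. if int N dvd m - k then (cmod (w k))\<^sup>2 else 0)"
    using assms(1) k by (intro member_le_sum) auto
  finally show ?thesis
    using alias_coeff_unique[OF assms k] by simp
next
  case False
  then have "alias_coeff N S w m = 0"
    unfolding alias_coeff_def by (intro sum.neutral) auto
  then show ?thesis
    by (simp add: sum_nonneg)
qed

text \<open>Write m = k + N l and Q = max(n, |k|), so that 2Q \<le> N. For l \<noteq> 0 this gives
  |m| \<ge> 2Q|l| - Q \<ge> Q|l|. The case l = 0 means m = k, which lies in \<open>F\<close> only if
  |k| \<ge> n, and then |m| = Q. Hence 5 = 1 + 4: one for l = 0 and four for the sum of inverse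
  squares.\<close>

lemma alias_tail:
  assumes n: "1 \<le> n" "2 * n \<le> N" and k: "2 * \<bar>k\<bar> \<le> int N" and F: "finite F" "F \<inter> {- int n..int n - 1} = {}"
  shows "(\<Sum>m\<in>F. if int N dvd m - k then 1 / (real_of_int m)\<^sup>2 else 0) \<le> 5 / (max (real n) \<bar>real_of_int k\<bar>)\<^sup>2"
proof -
  define Q where "Q = max (real n) \<bar>real_of_int k\<bar>"
  have Q: "0 < Q" "2 * Q \<le> real N" "\<bar>real_of_int k\<bar> \<le> Q"
  proof -
    have "2 * real n \<le> real N"
      using n by (simp flip: of_nat_mult)
    moreover have "2 * \<bar>real_of_int k\<bar> \<le> real N"
      using k by linarith
    ultimately show "2 * Q \<le> real N" by (simp add: Q_def)
  qed (use n in \<open>auto simp: Q_def\<close>)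
  define T where "T = (\<lambda>m. (m - k) div int N) ` {m \<in> F. int N dvd m - k}"
  have N0: "0 < int N" using n by simp
  have inj: "inj_on (\<lambda>m. (m - k) div int N) {m \<in> F. int N dvd m - k}"
    by (rule inj_onI) (auto simp: dvd_div_eq_iff)
  have bd: "1 / (real_of_int m)\<^sup>2 \<le> (if (m - k) div int N = 0 then 1 else 0) / Q\<^sup>2
      + 1 / Q\<^sup>2 * (1 / (real_of_int ((m - k) div int N))\<^sup>2)" if m: "m \<in> F" "int N dvd m - k" for m
  proof (cases "(m - k) div int N = 0")
    case True
    then have "m = k"
      using m(2) by (metis dvd_div_eq_0_iff right_minus_eq)
    then have "k \<notin> {- int n..int n - 1}"
      using F(2) m(1) by blast
    then have "int n \<le> \<bar>k\<bar>"
      unfolding atLeastAtMost_iff by linarith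
    then have "real n \<le> \<bar>real_of_int k\<bar>"
      by linarith
    then have "Q\<^sup>2 = (real_of_int k)\<^sup>2"
      by (simp add: Q_def max_absorb2)
    then show ?thesis
      using \<open>m = k\<close> by simp
  next
    case False
    define l where "l = (m - k) div int N"
    have "m = k + int N * l"
      using m(2) by (simp add: l_def)
    then have ml: "real_of_int m = real_of_int k + real N * real_of_int l"
      by simp
    have l: "1 \<le> \<bar>real_of_int l\<bar>"
      using False by (simp add: l_def)
    have "Q * \<bar>real_of_int l\<bar> \<le> (2 * Q) * \<bar>real_of_int l\<bar> - Q"
      using mult_left_mono[OF l, of Q] Q by simp
    also have "\<dots> \<le> real N * \<bar>real_of_int l\<bar> - \<bar>real_of_int k\<bar>"
      using Q by (intro diff_mono mult_right_mono) auto
    also have "\<dots> \<le> \<bar>real_of_int m\<bar>"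
      unfolding ml using abs_triangle_ineq2[of "real N * real_of_int l" "- real_of_int k"]
      by (simp add: abs_mult add.commute)
    finally have "(Q * \<bar>real_of_int l\<bar>)\<^sup>2 \<le> \<bar>real_of_int m\<bar>\<^sup>2"
      using Q by (intro power_mono) auto
    then have "Q\<^sup>2 * (real_of_int l)\<^sup>2 \<le> (real_of_int m)\<^sup>2"
      by (simp add: power_mult_distrib)
    moreover have "0 < Q\<^sup>2 * (real_of_int l)\<^sup>2"
      using Q l by (intro mult_pos_pos) auto
    ultimately have "1 / (real_of_int m)\<^sup>2 \<le> 1 / (Q\<^sup>2 * (real_of_int l)\<^sup>2)"
      by (intro frac_le) auto
    then show ?thesis
      using False by (simp add: l_def)
  qed
  have "(\<Sum>m\<in>F. if int N dvd m - k then 1 / (real_of_int m)\<^sup>2 else 0)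
      = (\<Sum>m\<in>{m \<in> F. int N dvd m - k}. 1 / (real_of_int m)\<^sup>2)"
    using F(1) by (simp add: sum.inter_filter)
  also have "\<dots> \<le> (\<Sum>m\<in>{m \<in> F. int N dvd m - k}. (if (m - k) div int N = 0 then 1 else 0) / Q\<^sup>2
      + 1 / Q\<^sup>2 * (1 / (real_of_int ((m - k) div int N))\<^sup>2))"
    by (rule sum_mono) (use bd in simp)
  also have "\<dots> = (\<Sum>l\<in>T. (if l = 0 then 1 else 0) / Q\<^sup>2 + 1 / Q\<^sup>2 * (1 / (real_of_int l)\<^sup>2))"
    unfolding T_def by (simp add: sum.reindex[OF inj] o_def)
  also have "\<dots> = (if 0 \<in> T then 1 else 0) / Q\<^sup>2 + 1 / Q\<^sup>2 * (\<Sum>l\<in>T. 1 / (real_of_int l)\<^sup>2)"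
    unfolding sum.distrib sum_distrib_left[symmetric] sum_divide_distrib[symmetric]
    using F(1) by (simp add: T_def)
  also have "\<dots> \<le> 1 / Q\<^sup>2 + 1 / Q\<^sup>2 * 4"
    using F(1) by (intro add_mono divide_right_mono mult_left_mono sum_inverse_squares_le) (auto simp: T_def)
  finally show ?thesis
    by (simp add: Q_def)
qed

text \<open>The integrand splits into the modes in [-n, n), where heat and Euler parts are paired,
  and a tail of heat modes. An inner mode gives (k/n)^2 times the integrated decay 1/(16 k^2), of
  order n^-2 for every k. The tail has no counterpart in the scheme; its integrated decay 1/(8 pi^2
  m^2) is summed over each alias class by \<open>alias_tail\<close>. The constant
  \<open>2 * D + 10\<close> arises from the bounds D and 5 through |x + y|^2 \<le> 2|x|^2 + 2|y|^2.
  The function \<open>H\<close> enters only through its Fourier expansion for u > 0.\<close>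

lemma kernel_variance:
  assumes c: "0 < c" "c < 1 / 4"
  shows "\<exists>C>0. \<forall>n\<ge>1. \<forall>t\<ge>0. \<forall>N S w H. 2 * n \<le> N \<longrightarrow> finite S \<longrightarrow> (\<forall>k\<in>S. 2 * \<bar>k\<bar> \<le> int N) \<longrightarrow>
    inj_mod N (S \<union> {- int n..int n - 1}) \<longrightarrow>
    (\<forall>u>0. \<forall>y. (\<lambda>L. \<Sum>m\<in>{- int L..int L}. alias_coeff N S w m * (heat_mode m u * ee (- m) y)) \<longlonglongrightarrow> H u y) \<longrightarrow>
    noise_sq (\<lambda>(s, y). indicator ({0..<t} \<times> {0..<1}) (s, y) *
        (H (t - s) y - (\<Sum>k\<in>S \<inter> {- int n..int n - 1}. w k * (euler_mode c n k (t - s) * ee (- k) (cell_round (2 * n) y)))))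
      \<le> ennreal (C * (\<Sum>k\<in>S. (cmod (w k))\<^sup>2 / (max (real n) \<bar>real_of_int k\<bar>)\<^sup>2))"
proof -
  obtain D where D: "0 < D" and mode: "\<And>n k u z. 1 \<le> n \<Longrightarrow> k \<in> {- int n..int n - 1} \<Longrightarrow> 0 \<le> u \<Longrightarrow>
      0 \<le> z \<Longrightarrow> z < 1 / (2 * real n) \<Longrightarrow>
    (cmod (heat_mode k u * ee (- k) z - euler_mode c n k u))\<^sup>2
      \<le> D * (of_int k / real n)\<^sup>2 * exp (- 16 * (of_int k)\<^sup>2 * u)"
    using mode_difference_bound[OF c] by blast
  have main: "noise_sq (\<lambda>(s, y). indicator ({0..<t} \<times> {0..<1}) (s, y) *
        (H (t - s) y - (\<Sum>k\<in>S \<inter> {- int n..int n - 1}. w k * (euler_mode c n k (t - s) * ee (- k) (cell_round (2 * n) y)))))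
      \<le> ennreal ((2 * D + 10) * (\<Sum>k\<in>S. (cmod (w k))\<^sup>2 / (max (real n) \<bar>real_of_int k\<bar>)\<^sup>2))"
    if n: "1 \<le> n" and t: "0 \<le> t" and N: "2 * n \<le> N" and S: "finite S" "\<And>k. k \<in> S \<Longrightarrow> 2 * \<bar>k\<bar> \<le> int N"
      "inj_mod N (S \<union> {- int n..int n - 1})"
      and H: "\<And>u y. 0 < u \<Longrightarrow> (\<lambda>L. \<Sum>m\<in>{- int L..int L}. alias_coeff N S w m * (heat_mode m u * ee (- m) y)) \<longlonglongrightarrow> H u y"
    for n t N S w and H :: "real \<Rightarrow> real \<Rightarrow> complex"
  proof -
    let ?I = "{- int n..int n - 1}"
    define a where "a = alias_coeff N S w"
    define V where "V = (\<Sum>k\<in>S. (cmod (w k))\<^sup>2 / (max (real n) \<bar>real_of_int k\<bar>)\<^sup>2)"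
    define ind where "ind = (indicator ({0..<t} \<times> {0..<1}) :: real \<times> real \<Rightarrow> complex)"
    define P where "P s y = (\<Sum>k\<in>?I. a k * (heat_mode k (t - s) * ee (- k) y - euler_mode c n k (t - s) * ee (- k) (cell_round (2 * n) y)))" for s y
    define Q where "Q L s y = (\<Sum>m\<in>{- int L..int L} - ?I. a m * (heat_mode m (t - s) * ee (- m) y))" for L s y
    have V0: "0 \<le> V" unfolding V_def by (intro sum_nonneg) auto
    have n0: "0 < real n" using n by simp
    have a_in: "a k = (if k \<in> S then w k else 0)" if "k \<in> ?I" for k
      unfolding a_def by (rule alias_coeff_inside[OF S(1,3) that])
    have SN: "inj_mod N S" using S(3) by (rule inj_mod_subset) auto
    have [measurable]: "(\<lambda>(s, y). P s y) \<in> borel_measurable (borel \<Otimes>\<^sub>M borel)"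
      "(\<lambda>(s, y). Q L s y) \<in> borel_measurable (borel \<Otimes>\<^sub>M borel)" for L
      unfolding P_def Q_def by measurable
    have [measurable]: "(\<lambda>(s, y). P s y) \<in> borel_measurable borel"
      "(\<lambda>(s, y). Q L s y) \<in> borel_measurable borel" for L
      by (simp_all add: borel_prod[symmetric])
    have [measurable]: "ind \<in> borel_measurable borel"
      unfolding ind_def by (intro borel_measurable_indicator borel_Times) auto
    have mP: "(\<lambda>(s, y). ind (s, y) * P s y) \<in> borel_measurable borel"
      and mQ: "(\<lambda>(s, y). ind (s, y) * Q L s y) \<in> borel_measurable borel" for L
    proof -
      have "(\<lambda>z. ind z * (case z of (s, y) \<Rightarrow> P s y)) \<in> borel_measurable borel"
        by (intro borel_measurable_times) measurable
      moreover have "(\<lambda>z. ind z * (case z of (s, y) \<Rightarrow> P s y)) = (\<lambda>(s, y). ind (s, y) * P s y)"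
        by (auto simp: fun_eq_iff)
      ultimately show "(\<lambda>(s, y). ind (s, y) * P s y) \<in> borel_measurable borel"
        by simp
      have "(\<lambda>z. ind z * (case z of (s, y) \<Rightarrow> Q L s y)) \<in> borel_measurable borel" for L
        by (intro borel_measurable_times) measurable
      moreover have "(\<lambda>z. ind z * (case z of (s, y) \<Rightarrow> Q L s y)) = (\<lambda>(s, y). ind (s, y) * Q L s y)" for L
        by (auto simp: fun_eq_iff)
      ultimately show "(\<lambda>(s, y). ind (s, y) * Q L s y) \<in> borel_measurable borel" for L
        by simp
    qed
    have boundP: "noise_sq (\<lambda>(s, y). ind (s, y) * P s y) \<le> ennreal (D * V)"
    proof -
      \<comment> \<open>The value at k = 0 only keeps the rate positive: there \<open>be\<close>
        vanishes, because the constant mode is reproduced without error.\<close>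
      define al where "al k = (if k = 0 then 1 else 16 * (real_of_int k)\<^sup>2)" for k
      define be where "be k = (cmod (a k))\<^sup>2 * (D * (of_int k / real n)\<^sup>2)" for k
      have "noise_sq (\<lambda>(s, y). ind (s, y) * P s y) \<le> ennreal (\<Sum>k\<in>?I. be k / al k)"
        unfolding ind_def
      proof (rule noise_sq_time_slices[OF t])
        fix s assume s: "0 \<le> s" "s < t"
        have P_eq: "P s y = (\<Sum>k\<in>?I. (a k * (heat_mode k (t - s) * ee (- k) (y - cell_round (2 * n) y) - euler_mode c n k (t - s)))
            * ee (- k) (cell_round (2 * n) y))" for y
          unfolding P_def
        proof (intro sum.cong refl)
          fix k
          have "ee (- k) y = ee (- k) (y - cell_round (2 * n) y) * ee (- k) (cell_round (2 * n) y)"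
            by (simp add: ee_add_arg[symmetric])
          then show "a k * (heat_mode k (t - s) * ee (- k) y - euler_mode c n k (t - s) * ee (- k) (cell_round (2 * n) y))
            = (a k * (heat_mode k (t - s) * ee (- k) (y - cell_round (2 * n) y) - euler_mode c n k (t - s))) * ee (- k) (cell_round (2 * n) y)"
            by (simp add: algebra_simps)
        qed
        have "(\<integral>\<^sup>+y\<in>{0..<1}. ennreal ((cmod (P s y))\<^sup>2) \<partial>lborel)
            \<le> ennreal (\<Sum>k\<in>?I. (cmod (a k))\<^sup>2 * (D * (of_int k / real n)\<^sup>2 * exp (- 16 * (of_int k)\<^sup>2 * (t - s))))"
          unfolding P_eq
        proof (rule cell_parseval)
          show "(cmod (a k * (heat_mode k (t - s) * ee (- k) z - euler_mode c n k (t - s))))\<^sup>2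
              \<le> (cmod (a k))\<^sup>2 * (D * (of_int k / real n)\<^sup>2 * exp (- 16 * (of_int k)\<^sup>2 * (t - s)))"
            if "k \<in> ?I" "0 \<le> z" "z < 1 / real (2 * n)" for k z
            unfolding norm_mult power_mult_distrib
            using mode[OF n that(1), of "t - s" z] that s by (intro mult_left_mono) auto
        qed (use n inj_mod_modes in auto)
        also have "(\<Sum>k\<in>?I. (cmod (a k))\<^sup>2 * (D * (of_int k / real n)\<^sup>2 * exp (- 16 * (of_int k)\<^sup>2 * (t - s))))
            = (\<Sum>k\<in>?I. be k * exp (- al k * (t - s)))"
          by (intro sum.cong refl) (simp add: be_def al_def)
        finally show "(\<integral>\<^sup>+y\<in>{0..<1}. ennreal ((cmod (P s y))\<^sup>2) \<partial>lborel) \<le> ennreal (\<Sum>k\<in>?I. be k * exp (- al k * (t - s)))" .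
      qed (use D in \<open>auto simp: al_def be_def\<close>)
      also have "\<dots> \<le> ennreal (D * V)"
      proof (rule ennreal_leI)
        have "(\<Sum>k\<in>?I. be k / al k) \<le> (\<Sum>k\<in>?I. D * (if k \<in> S then (cmod (w k))\<^sup>2 / (max (real n) \<bar>real_of_int k\<bar>)\<^sup>2 else 0))"
        proof (rule sum_mono)
          fix k assume k: "k \<in> ?I"
          have mx: "max (real n) \<bar>real_of_int k\<bar> = real n"
            using k by auto
          have "be k / al k \<le> (cmod (a k))\<^sup>2 * D / (real n)\<^sup>2"
            using D n0 by (cases "k = 0") (auto simp: be_def al_def power_divide field_simps)
          then show "be k / al k \<le> D * (if k \<in> S then (cmod (w k))\<^sup>2 / (max (real n) \<bar>real_of_int k\<bar>)\<^sup>2 else 0)"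
            unfolding mx a_in[OF k] by (simp add: mult.commute split: if_splits)
        qed
        also have "\<dots> = D * (\<Sum>k\<in>?I \<inter> S. (cmod (w k))\<^sup>2 / (max (real n) \<bar>real_of_int k\<bar>)\<^sup>2)"
          by (simp add: sum_distrib_left[symmetric] sum.inter_restrict)
        also have "\<dots> \<le> D * V"
          unfolding V_def using D S(1) by (intro mult_left_mono sum_mono2) auto
        finally show "(\<Sum>k\<in>?I. be k / al k) \<le> D * V" .
      qed
      finally show ?thesis .
    qed
    have boundQ: "noise_sq (\<lambda>(s, y). ind (s, y) * Q L s y) \<le> ennreal (5 * V)" for L
    proof -
      let ?F = "{- int L..int L} - ?I"
      have F0: "m \<noteq> 0" if "m \<in> ?F" for m
        using that n by auto
      have "noise_sq (\<lambda>(s, y). ind (s, y) * Q L s y) \<le> ennreal (\<Sum>m\<in>?F. (cmod (a m))\<^sup>2 / (8 * pi\<^sup>2 * (real_of_int m)\<^sup>2))"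
        unfolding ind_def
      proof (rule noise_sq_time_slices[OF t])
        fix s assume s: "0 \<le> s" "s < t"
        have "(\<integral>\<^sup>+y\<in>{0..<1}. ennreal ((cmod (Q L s y))\<^sup>2) \<partial>lborel)
            \<le> ennreal (\<Sum>m\<in>?F. (cmod (a m * heat_mode m (t - s)))\<^sup>2)"
          using exponential_parseval[of ?F "\<lambda>m. a m * heat_mode m (t - s)"] by (simp add: Q_def mult.assoc)
        also have "(\<Sum>m\<in>?F. (cmod (a m * heat_mode m (t - s)))\<^sup>2)
            = (\<Sum>m\<in>?F. (cmod (a m))\<^sup>2 * exp (- (8 * pi\<^sup>2 * (real_of_int m)\<^sup>2) * (t - s)))"
          by (intro sum.cong refl) (simp add: norm_mult power_mult_distrib heat_mode_def exp_of_nat_mult[symmetric] exp_add[symmetric] power2_eq_square[of "exp _"])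
        finally show "(\<integral>\<^sup>+y\<in>{0..<1}. ennreal ((cmod (Q L s y))\<^sup>2) \<partial>lborel)
            \<le> ennreal (\<Sum>m\<in>?F. (cmod (a m))\<^sup>2 * exp (- (8 * pi\<^sup>2 * (real_of_int m)\<^sup>2) * (t - s)))" .
      qed (use F0 in auto)
      also have "\<dots> \<le> ennreal (5 * V)"
      proof (rule ennreal_leI)
        have pi8: "1 \<le> 8 * pi\<^sup>2"
          using pi_gt3 power_mono[of 3 pi 2] by simp
        have "(\<Sum>m\<in>?F. (cmod (a m))\<^sup>2 / (8 * pi\<^sup>2 * (real_of_int m)\<^sup>2))
            \<le> (\<Sum>m\<in>?F. \<Sum>k\<in>S. (cmod (w k))\<^sup>2 * (if int N dvd m - k then 1 / (real_of_int m)\<^sup>2 else 0))"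
        proof (rule sum_mono)
          fix m assume m: "m \<in> ?F"
          have "(cmod (a m))\<^sup>2 / (8 * pi\<^sup>2 * (real_of_int m)\<^sup>2) \<le> (cmod (a m))\<^sup>2 / (1 * (real_of_int m)\<^sup>2)"
            using F0[OF m] pi8 by (intro divide_left_mono mult_right_mono) auto
          also have "\<dots> \<le> (\<Sum>k\<in>S. if int N dvd m - k then (cmod (w k))\<^sup>2 else 0) / (real_of_int m)\<^sup>2"
            using norm_alias_coeff[OF S(1) SN, of w m] by (simp add: a_def divide_right_mono)
          also have "\<dots> = (\<Sum>k\<in>S. (cmod (w k))\<^sup>2 * (if int N dvd m - k then 1 / (real_of_int m)\<^sup>2 else 0))"
            unfolding sum_divide_distrib by (intro sum.cong refl) auto
          finally show "(cmod (a m))\<^sup>2 / (8 * pi\<^sup>2 * (real_of_int m)\<^sup>2)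
              \<le> (\<Sum>k\<in>S. (cmod (w k))\<^sup>2 * (if int N dvd m - k then 1 / (real_of_int m)\<^sup>2 else 0))" .
        qed
        also have "\<dots> = (\<Sum>k\<in>S. (cmod (w k))\<^sup>2 * (\<Sum>m\<in>?F. if int N dvd m - k then 1 / (real_of_int m)\<^sup>2 else 0))"
          unfolding sum_distrib_left by (rule sum.swap)
        also have "\<dots> \<le> (\<Sum>k\<in>S. (cmod (w k))\<^sup>2 * (5 / (max (real n) \<bar>real_of_int k\<bar>)\<^sup>2))"
          by (intro sum_mono mult_left_mono alias_tail[OF n N] S) auto
        also have "\<dots> = 5 * V"
          unfolding V_def sum_distrib_left by (intro sum.cong refl) simp
        finally show "(\<Sum>m\<in>?F. (cmod (a m))\<^sup>2 / (8 * pi\<^sup>2 * (real_of_int m)\<^sup>2)) \<le> 5 * V" .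
      qed
      finally show ?thesis .
    qed
    have W_eq: "(\<Sum>k\<in>S \<inter> ?I. w k * (euler_mode c n k u * ee (- k) z)) = (\<Sum>k\<in>?I. a k * (euler_mode c n k u * ee (- k) z))" for u z
    proof -
      have "(\<Sum>k\<in>?I. a k * (euler_mode c n k u * ee (- k) z)) = (\<Sum>k\<in>?I. if k \<in> S then w k * (euler_mode c n k u * ee (- k) z) else 0)"
        by (intro sum.cong refl) (simp add: a_in)
      also have "\<dots> = (\<Sum>k\<in>?I \<inter> S. w k * (euler_mode c n k u * ee (- k) z))"
        by (simp add: sum.inter_restrict)
      finally show ?thesis by (simp add: Int_commute)
    qed
    have split: "P s y + Q L s y = (\<Sum>m\<in>{- int L..int L}. a m * (heat_mode m (t - s) * ee (- m) y))
        - (\<Sum>k\<in>?I. a k * (euler_mode c n k (t - s) * ee (- k) (cell_round (2 * n) y)))" if "n \<le> L" for L s y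
    proof -
      have "{- int L..int L} = ?I \<union> ({- int L..int L} - ?I)"
        using that by auto
      then have "(\<Sum>m\<in>{- int L..int L}. a m * (heat_mode m (t - s) * ee (- m) y))
          = (\<Sum>m\<in>?I. a m * (heat_mode m (t - s) * ee (- m) y)) + Q L s y"
        unfolding Q_def by (metis (no_types, lifting) Diff_disjoint finite_Diff finite_atLeastAtMost_int sum.union_disjoint)
      then show ?thesis
        by (simp add: P_def right_diff_distrib sum_subtractf)
    qed
    let ?K = "\<lambda>(s, y). ind (s, y) * (H (t - s) y - (\<Sum>k\<in>S \<inter> ?I. w k * (euler_mode c n k (t - s) * ee (- k) (cell_round (2 * n) y))))"
    have "noise_sq ?K \<le> ennreal ((2 * D + 10) * V)"
      unfolding noise_sq_def
    \<comment> \<open>Fatou's lemma as the frequency cut-off L grows. Pointwise convergence holds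
      everywhere since \<open>ind\<close> restricts to s < t, where the elapsed time is
      positive.\<close>
    proof (rule nn_integral_limit_le[where u = "\<lambda>L z. ennreal ((cmod ((case z of (s, y) \<Rightarrow> ind (s, y) * P s y) + (case z of (s, y) \<Rightarrow> ind (s, y) * Q L s y)))\<^sup>2) * indicator ({0..} \<times> {0..<1}) z"])
      have mS: "{0..} \<times> {0..<1} \<in> sets (borel :: (real \<times> real) measure)"
        by (intro borel_Times) auto
      have "(\<lambda>z. ennreal ((cmod ((case z of (s, y) \<Rightarrow> ind (s, y) * P s y) + (case z of (s, y) \<Rightarrow> ind (s, y) * Q L s y)))\<^sup>2) * indicator ({0..} \<times> {0..<1}) z) \<in> borel_measurable borel" for L
        by (intro borel_measurable_times_ennreal measurable_compose[OF _ measurable_ennreal] borel_measurable_power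
            measurable_compose[OF _ borel_measurable_norm] borel_measurable_add mP mQ borel_measurable_indicator mS)
      then show "(\<lambda>z. ennreal ((cmod ((case z of (s, y) \<Rightarrow> ind (s, y) * P s y) + (case z of (s, y) \<Rightarrow> ind (s, y) * Q L s y)))\<^sup>2) * indicator ({0..} \<times> {0..<1}) z) \<in> borel_measurable lborel" for L
        by simp
      show "AE z in lborel. (\<lambda>L. ennreal ((cmod ((case z of (s, y) \<Rightarrow> ind (s, y) * P s y) + (case z of (s, y) \<Rightarrow> ind (s, y) * Q L s y)))\<^sup>2) * indicator ({0..} \<times> {0..<1}) z)
          \<longlonglongrightarrow> ennreal ((cmod (?K z))\<^sup>2) * indicator ({0..} \<times> {0..<1}) z"
      proof (rule AE_I2)
        fix z :: "real \<times> real"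
        obtain s y where z: "z = (s, y)" by (cases z)
        show "(\<lambda>L. ennreal ((cmod ((case z of (s, y) \<Rightarrow> ind (s, y) * P s y) + (case z of (s, y) \<Rightarrow> ind (s, y) * Q L s y)))\<^sup>2) * indicator ({0..} \<times> {0..<1}) z)
          \<longlonglongrightarrow> ennreal ((cmod (?K z))\<^sup>2) * indicator ({0..} \<times> {0..<1}) z"
        proof (cases "(s, y) \<in> {0..<t} \<times> {0..<1}")
          case True
          then have "0 < t - s" by auto
          have ev: "\<forall>\<^sub>F L in sequentially. (\<Sum>m\<in>{- int L..int L}. a m * (heat_mode m (t - s) * ee (- m) y))
              - (\<Sum>k\<in>?I. a k * (euler_mode c n k (t - s) * ee (- k) (cell_round (2 * n) y))) = P s y + Q L s y"
            using split by (intro eventually_mono[OF eventually_ge_at_top[of n]]) simp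
          have "(\<lambda>L. (\<Sum>m\<in>{- int L..int L}. a m * (heat_mode m (t - s) * ee (- m) y))
              - (\<Sum>k\<in>?I. a k * (euler_mode c n k (t - s) * ee (- k) (cell_round (2 * n) y))))
              \<longlonglongrightarrow> H (t - s) y - (\<Sum>k\<in>?I. a k * (euler_mode c n k (t - s) * ee (- k) (cell_round (2 * n) y)))"
            unfolding a_def by (intro tendsto_diff tendsto_const H \<open>0 < t - s\<close>)
          then have "(\<lambda>L. P s y + Q L s y) \<longlonglongrightarrow> H (t - s) y - (\<Sum>k\<in>?I. a k * (euler_mode c n k (t - s) * ee (- k) (cell_round (2 * n) y)))"
            by (rule Lim_transform_eventually[OF _ ev])
          then have "(\<lambda>L. ennreal ((cmod (P s y + Q L s y))\<^sup>2)) \<longlonglongrightarrow>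
              ennreal ((cmod (H (t - s) y - (\<Sum>k\<in>?I. a k * (euler_mode c n k (t - s) * ee (- k) (cell_round (2 * n) y)))))\<^sup>2)"
            by (intro tendsto_ennrealI tendsto_power tendsto_norm)
          moreover have "ind (s, y) = 1" "(s, y) \<in> {0..} \<times> {0..<1}"
            using True by (auto simp: ind_def)
          ultimately show ?thesis
            by (simp add: z W_eq)
        next
          case False
          then have "ind (s, y) = 0" by (simp add: ind_def)
          then show ?thesis by (simp add: z)
        qed
      qed
      show "\<forall>\<^sub>F L in sequentially. (\<integral>\<^sup>+z. ennreal ((cmod ((case z of (s, y) \<Rightarrow> ind (s, y) * P s y) + (case z of (s, y) \<Rightarrow> ind (s, y) * Q L s y)))\<^sup>2) * indicator ({0..} \<times> {0..<1}) z \<partial>lborel)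
          \<le> ennreal ((2 * D + 10) * V)"
      proof (rule always_eventually, rule allI)
        fix L
        have "noise_sq (\<lambda>z. (case z of (s, y) \<Rightarrow> ind (s, y) * P s y) + (case z of (s, y) \<Rightarrow> ind (s, y) * Q L s y))
            \<le> 2 * noise_sq (\<lambda>(s, y). ind (s, y) * P s y) + 2 * noise_sq (\<lambda>(s, y). ind (s, y) * Q L s y)"
          by (rule noise_sq_add[OF mP mQ])
        also have "\<dots> \<le> 2 * ennreal (D * V) + 2 * ennreal (5 * V)"
          by (intro add_mono mult_left_mono boundP boundQ) auto
        also have "\<dots> = ennreal 2 * ennreal (D * V) + ennreal 2 * ennreal (5 * V)"
          by simp
        also have "\<dots> = ennreal ((2 * D + 10) * V)"
          using D V0 by (simp add: ennreal_mult[symmetric] ennreal_plus[symmetric] distrib_right mult.assoc del: ennreal_plus ennreal_numeral)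
        finally show "(\<integral>\<^sup>+z. ennreal ((cmod ((case z of (s, y) \<Rightarrow> ind (s, y) * P s y) + (case z of (s, y) \<Rightarrow> ind (s, y) * Q L s y)))\<^sup>2) * indicator ({0..} \<times> {0..<1}) z \<partial>lborel)
          \<le> ennreal ((2 * D + 10) * V)"
          unfolding noise_sq_def .
      qed
    qed
    then show ?thesis
      unfolding V_def ind_def .
  qed
  show ?thesis
    using main D by (intro exI[of _ "2 * D + 10"]) auto
qed

section \<open>Sampled Fourier coefficients of the error as Wiener integrals\<close>

lemma sum_grid:
  assumes "1 \<le> n"
  shows "(\<Sum>x\<in>grid n. f x) = (\<Sum>i<2 * n. f (real i / real (2 * n)))"
proof -
  have "inj_on (\<lambda>i. real i / (2 * real n)) {..<2 * n}"
    using assms by (intro inj_onI) simp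
  then show ?thesis
    by (simp add: grid_def sum.reindex o_def)
qed

lemma finite_grid: "finite (grid n)"
  by (simp add: grid_def)

lemma inner_grid_ee:
  "inner_grid n f (grid_restrict n (ee k)) = (\<Sum>x\<in>grid n. f x * ee (- k) x) / (2 * of_nat n)"
  unfolding inner_grid_def grid_restrict_def
  by (intro arg_cong2[where f = "(/)"] sum.cong refl) simp

lemma average_ee:
  assumes "0 < N"
  shows "(\<Sum>i<N. ee j (real i / real N) * ee (- k) (real i / real N)) / of_nat N
    = (if int N dvd j - k then 1 else 0)"
  using assms sum_ee[OF assms, of "j - k"] by (simp add: ee_add[symmetric])

text \<open>A weighted combination of Fourier coefficients of the error, with those of
  \<open>f\<close> replaced by N-point averages so that only finitely many point values occur. The
  coefficients of \<open>g\<close> are taken on its own grid, and count as 0 outside [-n, n), as for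
  the interpolant.\<close>

definition mode_error :: "nat \<Rightarrow> nat \<Rightarrow> int set \<Rightarrow> (int \<Rightarrow> complex) \<Rightarrow> (real \<Rightarrow> complex) \<Rightarrow>
    (real \<Rightarrow> complex) \<Rightarrow> complex" where
  "mode_error n N S w f g =
     (\<Sum>k\<in>S. w k * ((\<Sum>i<N. f (real i / real N) * ee (- k) (real i / real N)) / of_nat N))
     - (\<Sum>k\<in>S \<inter> {- int n..int n - 1}. w k * inner_grid n g (grid_restrict n (ee k)))"

lemma sum_swap_average:
  fixes w :: "'a \<Rightarrow> complex"
  shows "(\<Sum>k\<in>S. w k * ((\<Sum>x\<in>G. f x * e k x) / N)) = (\<Sum>x\<in>G. ((\<Sum>k\<in>S. w k * e k x) / N) * f x)"
proof -
  have "(\<Sum>k\<in>S. w k * ((\<Sum>x\<in>G. f x * e k x) / N)) = (\<Sum>k\<in>S. \<Sum>x\<in>G. w k * e k x / N * f x)"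
    by (intro sum.cong refl) (simp add: sum_distrib_left sum_divide_distrib mult_ac)
  also have "\<dots> = (\<Sum>x\<in>G. \<Sum>k\<in>S. w k * e k x / N * f x)"
    by (rule sum.swap)
  finally show ?thesis
    by (simp add: sum_distrib_right sum_divide_distrib)
qed

text \<open>Exchanging the sums over modes and over points shows a finite linear combination of
  point values, so linearity gives the integrand. \<open>H\<close> is the same combination of heat
  kernels; sampling produces the aliased weights in its expansion.\<close>

lemma mode_error_wiener:
  assumes M: "prob_space M" and W: "white_noise M \<xi>"
    and Z: "heat_solution M \<xi> Z" and Y: "discrete_solution c M \<xi> n Y"
    and n: "1 \<le> n" and t: "0 \<le> t" and N: "0 < N" and S: "finite S"
  shows "\<exists>H. (\<forall>u>0. \<forall>y. (\<lambda>L. \<Sum>m\<in>{- int L..int L}. alias_coeff N S w m * (heat_mode m u * ee (- m) y)) \<longlonglongrightarrow> H u y) \<and>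
    has_wiener_integral M \<xi> (\<lambda>(s, y). indicator ({0..<t} \<times> {0..<1}) (s, y) *
        (H (t - s) y - (\<Sum>k\<in>S \<inter> {- int n..int n - 1}. w k * (euler_mode c n k (t - s) * ee (- k) (cell_round (2 * n) y)))))
      (\<lambda>\<omega>. mode_error n N S w (\<lambda>x. Z t x \<omega>) (\<lambda>x. Y t x \<omega>))"
proof -
  interpret prob_space M by (rule M)
  let ?I = "{- int n..int n - 1}"
  define a where "a i = (\<Sum>k\<in>S. w k * ee (- k) (real i / real N)) / of_nat N" for i
  define b where "b x = - ((\<Sum>k\<in>S \<inter> ?I. w k * ee (- k) x) / (2 * of_nat n))" for x
  define H where "H u y = (\<Sum>i<N. a i * heat_kernel u (real i / real N) y)" for u y
  have "(\<lambda>L. \<Sum>m\<in>{- int L..int L}. alias_coeff N S w m * (heat_mode m u * ee (- m) y)) \<longlonglongrightarrow> H u y"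
    if u: "0 < u" for u y
  proof -
    have coeff: "alias_coeff N S w m = (\<Sum>i<N. a i * ee m (real i / real N))" for m
    proof -
      have "(\<Sum>i<N. a i * ee m (real i / real N))
          = (\<Sum>k\<in>S. w k * ((\<Sum>i<N. ee m (real i / real N) * ee (- k) (real i / real N)) / of_nat N))"
        unfolding a_def by (rule sum_swap_average[symmetric])
      then show ?thesis
        unfolding average_ee[OF N] alias_coeff_def by (simp add: if_distrib cong: if_cong)
    qed
    have "(\<Sum>m\<in>{- int L..int L}. alias_coeff N S w m * (heat_mode m u * ee (- m) y))
        = (\<Sum>i<N. a i * (\<Sum>m\<in>{- int L..int L}. heat_mode m u * ee m (real i / real N - y)))" for L
    proof -
      have "(\<Sum>m\<in>{- int L..int L}. alias_coeff N S w m * (heat_mode m u * ee (- m) y))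
          = (\<Sum>m\<in>{- int L..int L}. \<Sum>i<N. a i * (heat_mode m u * ee m (real i / real N - y)))"
        unfolding coeff sum_distrib_right by (intro sum.cong refl) (simp add: ee_diff_arg mult_ac)
      also have "\<dots> = (\<Sum>i<N. \<Sum>m\<in>{- int L..int L}. a i * (heat_mode m u * ee m (real i / real N - y)))"
        by (rule sum.swap)
      finally show ?thesis
        by (simp add: sum_distrib_left)
    qed
    then show ?thesis
      unfolding H_def by (simp only:) (intro tendsto_sum tendsto_mult tendsto_const heat_kernel_tendsto u)
  qed
  moreover have "has_wiener_integral M \<xi> (\<lambda>(s, y). indicator ({0..<t} \<times> {0..<1}) (s, y) *
        (H (t - s) y - (\<Sum>k\<in>S \<inter> ?I. w k * (euler_mode c n k (t - s) * ee (- k) (cell_round (2 * n) y)))))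
      (\<lambda>\<omega>. mode_error n N S w (\<lambda>x. Z t x \<omega>) (\<lambda>x. Y t x \<omega>))"
  proof -
    let ?fZ = "\<lambda>i (s, y). indicator ({0..<t} \<times> {0..<1}) (s, y) * heat_kernel (t - s) (real i / real N) y"
    let ?fY = "\<lambda>x (s, y). indicator ({0..<t} \<times> {0..<1}) (s, y) * discrete_kernel c n (kappa c n (t - s)) x (grid_round n y)"
    have "has_wiener_integral M \<xi> (\<lambda>z. (\<Sum>i<N. a i * ?fZ i z) + (\<Sum>x\<in>grid n. b x * ?fY x z))
        (\<lambda>\<omega>. (\<Sum>i<N. a i * Z t (real i / real N) \<omega>) + (\<Sum>x\<in>grid n. b x * Y t x \<omega>))"
      using Z Y t unfolding heat_solution_def discrete_solution_def
      by (intro has_wiener_integral_add has_wiener_integral_sum W finite_grid finite_lessThan) auto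
    moreover have "(\<Sum>i<N. a i * Z t (real i / real N) \<omega>) + (\<Sum>x\<in>grid n. b x * Y t x \<omega>)
        = mode_error n N S w (\<lambda>x. Z t x \<omega>) (\<lambda>x. Y t x \<omega>)" for \<omega>
      unfolding mode_error_def a_def b_def inner_grid_ee sum_swap_average by (simp add: sum_negf)
    moreover have "(\<Sum>x\<in>grid n. b x * discrete_kernel c n (kappa c n u) x (grid_round n y))
        = - (\<Sum>k\<in>S \<inter> ?I. w k * (euler_mode c n k u * ee (- k) (cell_round (2 * n) y)))" for u y
    proof -
      have r: "grid_round n y = cell_round (2 * n) y"
        by (simp add: grid_round_def cell_round_def)
      have "(\<Sum>x\<in>grid n. b x * discrete_kernel c n (kappa c n u) x (grid_round n y))
          = - (\<Sum>x\<in>grid n. ((\<Sum>k\<in>S \<inter> ?I. w k * ee (- k) x) / (2 * of_nat n)) * discrete_kernel c n (kappa c n u) x (grid_round n y))"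
        unfolding b_def by (simp add: sum_negf)
      also have "\<dots> = - (\<Sum>k\<in>S \<inter> ?I. w k * ((\<Sum>x\<in>grid n. discrete_kernel c n (kappa c n u) x (grid_round n y) * ee (- k) x) / (2 * of_nat n)))"
        by (simp only: sum_swap_average)
      also have "(\<Sum>k\<in>S \<inter> ?I. w k * ((\<Sum>x\<in>grid n. discrete_kernel c n (kappa c n u) x (grid_round n y) * ee (- k) x) / (2 * of_nat n)))
          = (\<Sum>k\<in>S \<inter> ?I. w k * (euler_mode c n k u * ee (- k) (cell_round (2 * n) y)))"
      proof (intro sum.cong refl arg_cong2[where f = "(*)"])
        fix k assume k: "k \<in> S \<inter> ?I"
        \<comment> \<open>The 2n indices of the scheme are distinct modulo 2n, so averaging over the
          grid isolates a single term of the discrete kernel.\<close>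
        have av: "(\<Sum>x\<in>grid n. ee j x * ee (- k) x) / (2 * of_nat n) = (if j = k then 1 else 0)" if "j \<in> ?I" for j
        proof -
          have "(\<Sum>x\<in>grid n. ee j x * ee (- k) x) / (2 * of_nat n) = (if int (2 * n) dvd j - k then 1 else 0)"
            using average_ee[of "2 * n" j k] n by (simp add: sum_grid)
          also have "\<dots> = (if j = k then 1 else 0)"
            using inj_mod_modes[of n] that k unfolding inj_mod_def by auto
          finally show ?thesis .
        qed
        have "(\<Sum>x\<in>grid n. discrete_kernel c n (kappa c n u) x (grid_round n y) * ee (- k) x) / (2 * of_nat n)
            = (\<Sum>x\<in>grid n. \<Sum>j\<in>?I. euler_mode c n j u * ee (- j) (cell_round (2 * n) y) * (ee j x * ee (- k) x)) / (2 * of_nat n)"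
          unfolding discrete_kernel_def euler_mode_def[symmetric] r sum_distrib_right
          by (intro arg_cong2[where f = "(/)"] sum.cong refl) (simp add: ee_diff_arg scaleR_conv_of_real mult_ac)
        also have "\<dots> = (\<Sum>j\<in>?I. euler_mode c n j u * ee (- j) (cell_round (2 * n) y) * ((\<Sum>x\<in>grid n. ee j x * ee (- k) x) / (2 * of_nat n)))"
          by (subst sum.swap) (simp add: sum_distrib_left sum_divide_distrib)
        also have "\<dots> = (\<Sum>j\<in>?I. if j = k then euler_mode c n j u * ee (- j) (cell_round (2 * n) y) else 0)"
          by (intro sum.cong refl) (simp add: av)
        also have "\<dots> = euler_mode c n k u * ee (- k) (cell_round (2 * n) y)"
          using k by simp
        finally show "(\<Sum>x\<in>grid n. discrete_kernel c n (kappa c n u) x (grid_round n y) * ee (- k) x) / (2 * of_nat n)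
            = euler_mode c n k u * ee (- k) (cell_round (2 * n) y)" .
      qed
      finally show ?thesis .
    qed
    then have "(\<lambda>z. (\<Sum>i<N. a i * ?fZ i z) + (\<Sum>x\<in>grid n. b x * ?fY x z))
        = (\<lambda>(s, y). indicator ({0..<t} \<times> {0..<1}) (s, y) *
        (H (t - s) y - (\<Sum>k\<in>S \<inter> ?I. w k * (euler_mode c n k (t - s) * ee (- k) (cell_round (2 * n) y)))))"
      by (auto simp: fun_eq_iff H_def indicator_def)
    ultimately show ?thesis by simp
  qed
  ultimately show ?thesis by blast
qed

text \<open>The constant stands in front of all other quantifiers: it depends on c and p only, not
  on the probability space, the noise, n, t, the sampling or the weights. This uniformity is
  inherited by the final bounds.\<close>

lemma mode_error_moment:
  assumes c: "0 < c" "c < 1 / 4" and p: "1 \<le> p"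
  shows "\<exists>C>0. \<forall>(M :: 'w measure) \<xi> Z Y n t N S w.
    prob_space M \<and> white_noise M \<xi> \<and> heat_solution M \<xi> Z \<and> discrete_solution c M \<xi> n Y \<and>
    1 \<le> n \<and> 0 \<le> t \<and> 2 * n \<le> N \<and> finite S \<and> (\<forall>k\<in>S. 2 * \<bar>k\<bar> \<le> int N) \<and>
    inj_mod N (S \<union> {- int n..int n - 1}) \<longrightarrow>
    (\<lambda>\<omega>. mode_error n N S w (\<lambda>x. Z t x \<omega>) (\<lambda>x. Y t x \<omega>)) \<in> borel_measurable M \<and>
    (\<integral>\<^sup>+\<omega>. ennreal (cmod (mode_error n N S w (\<lambda>x. Z t x \<omega>) (\<lambda>x. Y t x \<omega>)) ^ (2 * p)) \<partial>M)
      \<le> ennreal (C * (\<Sum>k\<in>S. (cmod (w k))\<^sup>2 / (max (real n) \<bar>real_of_int k\<bar>)\<^sup>2) ^ p)"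
proof -
  obtain D where D: "0 < D" and var: "\<forall>n\<ge>1. \<forall>t\<ge>0. \<forall>N S w H. 2 * n \<le> N \<longrightarrow> finite S \<longrightarrow> (\<forall>k\<in>S. 2 * \<bar>k\<bar> \<le> int N) \<longrightarrow>
    inj_mod N (S \<union> {- int n..int n - 1}) \<longrightarrow>
    (\<forall>u>0. \<forall>y. (\<lambda>L. \<Sum>m\<in>{- int L..int L}. alias_coeff N S w m * (heat_mode m u * ee (- m) y)) \<longlonglongrightarrow> H u y) \<longrightarrow>
    noise_sq (\<lambda>(s, y). indicator ({0..<t} \<times> {0..<1}) (s, y) *
        (H (t - s) y - (\<Sum>k\<in>S \<inter> {- int n..int n - 1}. w k * (euler_mode c n k (t - s) * ee (- k) (cell_round (2 * n) y)))))
      \<le> ennreal (D * (\<Sum>k\<in>S. (cmod (w k))\<^sup>2 / (max (real n) \<bar>real_of_int k\<bar>)\<^sup>2))"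
    using kernel_variance[OF c] by (elim exE conjE) (rule that)
  define C where "C = 4 ^ p * (2 ^ (p + 1) * moment_const p) * (2 * D) ^ p"
  have "0 < C"
    using D moment_const_pos[of p] by (simp add: C_def)
  moreover have "X \<in> borel_measurable M \<and>
    (\<integral>\<^sup>+\<omega>. ennreal (cmod (X \<omega>) ^ (2 * p)) \<partial>M)
      \<le> ennreal (C * (\<Sum>k\<in>S. (cmod (w k))\<^sup>2 / (max (real n) \<bar>real_of_int k\<bar>)\<^sup>2) ^ p)"
    if M: "prob_space M" and W: "white_noise M \<xi>" and Z: "heat_solution M \<xi> Z" and Y: "discrete_solution c M \<xi> n Y"
      and n: "1 \<le> n" and t: "0 \<le> t" and N: "2 * n \<le> N" and S: "finite S" "\<forall>k\<in>S. 2 * \<bar>k\<bar> \<le> int N"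
      "inj_mod N (S \<union> {- int n..int n - 1})"
      and X: "X = (\<lambda>\<omega>. mode_error n N S w (\<lambda>x. Z t x \<omega>) (\<lambda>x. Y t x \<omega>))"
    for M :: "'w measure" and \<xi> Z Y n t N S w X
  proof -
    interpret prob_space M by (rule M)
    have N0: "0 < N" using n N by simp
    obtain H where H: "\<forall>u>0. \<forall>y. (\<lambda>L. \<Sum>m\<in>{- int L..int L}. alias_coeff N S w m * (heat_mode m u * ee (- m) y)) \<longlonglongrightarrow> H u y"
      and wi: "has_wiener_integral M \<xi> (\<lambda>(s, y). indicator ({0..<t} \<times> {0..<1}) (s, y) *
        (H (t - s) y - (\<Sum>k\<in>S \<inter> {- int n..int n - 1}. w k * (euler_mode c n k (t - s) * ee (- k) (cell_round (2 * n) y))))) X"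
      using mode_error_wiener[OF M W Z Y n t N0 S(1), of w] unfolding X[symmetric] by (elim exE conjE) (rule that)
    define V where "V = (\<Sum>k\<in>S. (cmod (w k))\<^sup>2 / (max (real n) \<bar>real_of_int k\<bar>)\<^sup>2)"
    have V: "0 \<le> V" unfolding V_def by (intro sum_nonneg) auto
    note v = var[rule_format, OF n t N S(1) S(2)[rule_format] S(3) H[rule_format], folded V_def]
    have "(\<integral>\<^sup>+\<omega>. ennreal (cmod (X \<omega>) ^ (2 * p)) \<partial>M)
        \<le> ennreal (4 ^ p * (2 ^ (p + 1) * moment_const p) * (2 * (D * V)) ^ p)"
      using D V by (intro wiener_integral_even_moment[OF W wi p v]) auto
    also have "4 ^ p * (2 ^ (p + 1) * moment_const p) * (2 * (D * V)) ^ p = C * V ^ p"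
      by (simp add: C_def power_mult_distrib)
    finally show ?thesis
      using wi by (simp add: V_def has_wiener_integral_def)
  qed
  ultimately show ?thesis
    by (intro exI[of _ C] conjI allI impI) auto
qed

section \<open>Littlewood--Paley blocks and trigonometric polynomials\<close>

text \<open>The dilation factor \<open>r0\<close> lies in [1/2, 3/2] for every admissible scale, so
  one pair of bounds covers both the torus and the grid blocks. Below 2^j/4 both dilated arguments
  are at most 3/4, where the cutoff equals 1, so the difference vanishes.\<close>

lemma phi_block_support:
  assumes e: "0 < \<epsilon>\<^sub>0" "\<epsilon>\<^sub>0 < 1 / 10" and phi: "cutoff \<epsilon>\<^sub>0 \<phi>" and r: "1 \<le> \<rho>" "\<rho> \<le> 2"
  shows "\<bar>phi_block \<epsilon>\<^sub>0 \<phi> \<rho> j x\<bar> \<le> 1"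
    and "phi_block \<epsilon>\<^sub>0 \<phi> \<rho> j x \<noteq> 0 \<Longrightarrow> \<bar>x\<bar> \<le> 2 * 2 ^ j"
    and "phi_block \<epsilon>\<^sub>0 \<phi> \<rho> j x \<noteq> 0 \<Longrightarrow> 0 < j \<Longrightarrow> 2 ^ j / 4 \<le> \<bar>x\<bar>"
proof -
  define r0 where "r0 = (3 - 2 * \<epsilon>\<^sub>0) / 2 / \<rho>"
  have r0: "1 / 2 \<le> r0" "r0 \<le> 3 / 2"
  proof -
    have "\<rho> / 2 \<le> (3 - 2 * \<epsilon>\<^sub>0) / 2" "(3 - 2 * \<epsilon>\<^sub>0) / 2 \<le> 3 / 2 * \<rho>"
      using e r by simp_all
    then show "1 / 2 \<le> r0" "r0 \<le> 3 / 2"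
      using r by (simp_all add: r0_def field_simps)
  qed
  have sc: "phi0_scaled \<epsilon>\<^sub>0 \<phi> \<rho> y = \<phi> (r0 * y)" for y
    by (simp add: phi0_scaled_def Let_def r0_def)
  have range: "0 \<le> \<phi> y" "\<phi> y \<le> 1" for y
    using phi by (auto simp: cutoff_def)
  have one: "\<phi> y = 1" if "\<bar>y\<bar> \<le> 9 / 10" for y
    using phi that e by (auto simp: cutoff_def)
  have supp: "\<bar>y\<bar> \<le> 1" if "\<phi> y \<noteq> 0" for y
    using phi that closure_subset[of "{x. \<phi> x \<noteq> 0}"] unfolding cutoff_def by blast
  have pw: "2 powr (- real j) = 1 / 2 ^ j" "2 powr (- real j + 1) = 2 / 2 ^ j"
  proof -
    show *: "2 powr (- real j) = 1 / 2 ^ j"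
      by (simp add: powr_minus powr_realpow divide_inverse)
    show "2 powr (- real j + 1) = 2 / 2 ^ j"
      unfolding powr_add * by simp
  qed
  \<comment> \<open>\<open>s\<close> is 1 or 2, according to which of the two dilated cutoffs in a
    block is nonzero.\<close>
  have near: "\<bar>x\<bar> \<le> 2 * 2 ^ j" if "\<bar>r0 * (s / 2 ^ j * x)\<bar> \<le> 1" "1 \<le> s" for s
  proof -
    have "1 / 2 * (1 / 2 ^ j * \<bar>x\<bar>) \<le> r0 * (s / 2 ^ j * \<bar>x\<bar>)"
      using r0 that by (intro mult_mono divide_right_mono) auto
    also have "\<dots> \<le> 1"
      using that r0 by (simp add: abs_mult)
    finally show ?thesis
      by (simp add: field_simps)
  qed
  show "\<bar>phi_block \<epsilon>\<^sub>0 \<phi> \<rho> j x\<bar> \<le> 1"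
    unfolding phi_block_def sc using range[of "r0 * x"]
      range[of "r0 * (2 powr (- real j) * x)"] range[of "r0 * (2 powr (- real j + 1) * x)"] by auto
  show "\<bar>x\<bar> \<le> 2 * 2 ^ j" if nz: "phi_block \<epsilon>\<^sub>0 \<phi> \<rho> j x \<noteq> 0"
  proof (cases "j = 0")
    case True
    then have "\<bar>r0 * x\<bar> \<le> 1"
      using nz supp by (simp add: phi_block_def sc)
    then show ?thesis
      using near[of 1] True by simp
  next
    case False
    then have "\<phi> (r0 * (1 / 2 ^ j * x)) \<noteq> 0 \<or> \<phi> (r0 * (2 / 2 ^ j * x)) \<noteq> 0"
      using nz unfolding phi_block_def sc pw by auto
    then show ?thesis
      using near[of 1] near[of 2] supp by fastforce
  qed
  show "2 ^ j / 4 \<le> \<bar>x\<bar>" if nz: "phi_block \<epsilon>\<^sub>0 \<phi> \<rho> j x \<noteq> 0" and j: "0 < j"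
  proof (rule ccontr)
    assume "\<not> 2 ^ j / 4 \<le> \<bar>x\<bar>"
    then have x: "\<bar>x\<bar> / 2 ^ j \<le> 1 / 4"
      by (simp add: field_simps)
    have "\<bar>r0 * (s / 2 ^ j * x)\<bar> \<le> 9 / 10" if "0 \<le> s" "s \<le> 2" for s
    proof -
      have "\<bar>r0 * (s / 2 ^ j * x)\<bar> = r0 * (s * (\<bar>x\<bar> / 2 ^ j))"
        using r0 that by (simp add: abs_mult)
      also have "\<dots> \<le> 3 / 2 * (2 * (1 / 4))"
        using r0 that x by (intro mult_mono) auto
      finally show ?thesis by simp
    qed
    from this[of 1] this[of 2] have "phi_block \<epsilon>\<^sub>0 \<phi> \<rho> j x = 0"
      using j one unfolding phi_block_def sc pw by simp
    with nz show False by simp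
  qed
qed

text \<open>The scale is 2 raised to the fractional part of the binary logarithm of n.\<close>

lemma grid_scale_bounds:
  assumes "1 \<le> n"
  shows "1 \<le> grid_scale n" "grid_scale n \<le> 2"
proof -
  define l where "l = log 2 (real n)"
  have eq: "grid_scale n = 2 powr (l - of_int \<lfloor>l\<rfloor>)"
    using assms by (simp add: grid_scale_def l_def powr_diff powr_minus divide_inverse)
  show "1 \<le> grid_scale n"
    unfolding eq by (intro ge_one_powr_ge_zero) auto
  have "2 powr (l - of_int \<lfloor>l\<rfloor>) \<le> 2 powr 1"
    by (intro powr_mono) linarith+
  then show "grid_scale n \<le> 2"
    unfolding eq by simp
qed

definition block_modes :: "real \<Rightarrow> (real \<Rightarrow> real) \<Rightarrow> real \<Rightarrow> nat \<Rightarrow> int set" where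
  "block_modes \<epsilon>\<^sub>0 \<phi> \<rho> j = {k. phi_block \<epsilon>\<^sub>0 \<phi> \<rho> j (of_int k) \<noteq> 0}"

lemma block_modes_subset:
  assumes "0 < \<epsilon>\<^sub>0" "\<epsilon>\<^sub>0 < 1 / 10" "cutoff \<epsilon>\<^sub>0 \<phi>" "1 \<le> \<rho>" "\<rho> \<le> 2"
  shows "block_modes \<epsilon>\<^sub>0 \<phi> \<rho> j \<subseteq> {- 2 * 2 ^ j..2 * 2 ^ j}"
proof
  fix k assume "k \<in> block_modes \<epsilon>\<^sub>0 \<phi> \<rho> j"
  then have "\<bar>real_of_int k\<bar> \<le> 2 * 2 ^ j"
    using phi_block_support(2)[OF assms, of j "of_int k"] by (simp add: block_modes_def)
  then have "real_of_int \<bar>k\<bar> \<le> real_of_int (2 * 2 ^ j)"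
    by simp
  then have "\<bar>k\<bar> \<le> 2 * 2 ^ j"
    by (simp only: of_int_le_iff)
  then show "k \<in> {- 2 * 2 ^ j..2 * 2 ^ j}"
    by auto
qed

text \<open>On block j the maximum of n and |k| dominates both n and 2^j/4, hence their geometric
  mean with weights \<theta> and 1 - \<theta>. The factor 1/4 costs at most 16 after squaring, and
  at most 5 * 2^j modes occur, whence 80.\<close>

lemma block_modes_weight:
  assumes phi: "0 < \<epsilon>\<^sub>0" "\<epsilon>\<^sub>0 < 1 / 10" "cutoff \<epsilon>\<^sub>0 \<phi>" "1 \<le> \<rho>" "\<rho> \<le> 2"
    and n: "1 \<le> n" and th: "0 \<le> \<theta>" "\<theta> \<le> 1" and S: "S \<subseteq> block_modes \<epsilon>\<^sub>0 \<phi> \<rho> j"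
    and w: "\<And>k. k \<in> S \<Longrightarrow> cmod (w k) \<le> 1"
  shows "(\<Sum>k\<in>S. (cmod (w k))\<^sup>2 / (max (real n) \<bar>real_of_int k\<bar>)\<^sup>2)
    \<le> 80 * (real n powr (- 2 * \<theta>) * 2 powr (real j * (2 * \<theta> - 1)))"
proof -
  have fin: "finite S" and sub: "S \<subseteq> {- 2 * 2 ^ j..2 * 2 ^ j}"
    using block_modes_subset[OF phi, of j] S finite_subset[of S "{- 2 * 2 ^ j..2 * 2 ^ j}"] by auto
  have n0: "1 \<le> real n" using n by simp
  have each: "(cmod (w k))\<^sup>2 / (max (real n) \<bar>real_of_int k\<bar>)\<^sup>2 \<le> 16 * (real n powr (- 2 * \<theta>) * 2 powr (real j * (2 * \<theta> - 2)))"
    if k: "k \<in> S" for k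
  proof -
    let ?m = "max (real n) \<bar>real_of_int k\<bar>"
    \<comment> \<open>The lowest block contains frequencies near 0; for it the bound comes from n
      \<ge> 1 instead of |k|.\<close>
    have m: "2 ^ j / 4 \<le> ?m"
    proof (cases "j = 0")
      case False
      then have "2 ^ j / 4 \<le> \<bar>real_of_int k\<bar>"
        using phi_block_support(3)[OF phi, of j "of_int k"] k S by (auto simp: block_modes_def)
      then show ?thesis by simp
    qed (use n0 in simp)
    have "real n powr \<theta> * (2 ^ j / 4) powr (1 - \<theta>) \<le> ?m powr \<theta> * ?m powr (1 - \<theta>)"
      using th m n0 by (intro mult_mono powr_mono2) auto
    also have "\<dots> = ?m"
      using n0 by (simp add: powr_add[symmetric])
    finally have "(real n powr \<theta> * (2 ^ j / 4) powr (1 - \<theta>))\<^sup>2 \<le> ?m\<^sup>2"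
      by (intro power_mono) auto
    moreover have "0 < (real n powr \<theta> * (2 ^ j / 4) powr (1 - \<theta>))\<^sup>2"
      using n0 by simp
    ultimately have "(cmod (w k))\<^sup>2 / ?m\<^sup>2 \<le> 1 / (real n powr \<theta> * (2 ^ j / 4) powr (1 - \<theta>))\<^sup>2"
      using w[OF k] by (intro frac_le) (auto simp: abs_square_le_1)
    also have "(real n powr \<theta> * (2 ^ j / 4) powr (1 - \<theta>))\<^sup>2 = real n powr (2 * \<theta>) * (2 ^ j / 4) powr (2 - 2 * \<theta>)"
    proof -
      have "(a powr s)\<^sup>2 = a powr (2 * s)" for a s :: real
        by (simp add: power2_eq_square powr_add[symmetric])
      then show ?thesis
        by (simp add: power_mult_distrib right_diff_distrib)
    qed
    also have "1 / \<dots> = real n powr (- 2 * \<theta>) * (2 powr (- (real j * (2 - 2 * \<theta>))) * 4 powr (2 - 2 * \<theta>))"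
    proof -
      have "(2 ^ j / 4) powr (2 - 2 * \<theta>) = 2 powr (real j * (2 - 2 * \<theta>)) / (4 powr (2 - 2 * \<theta>) :: real)"
        by (simp add: powr_divide powr_realpow[symmetric] powr_powr)
      then show ?thesis
        by (simp only: mult_minus_left powr_minus_divide) simp
    qed
    also have "\<dots> \<le> real n powr (- 2 * \<theta>) * (2 powr (- (real j * (2 - 2 * \<theta>))) * 4 powr 2)"
      using th by (intro mult_left_mono powr_mono) auto
    also have "\<dots> = 16 * (real n powr (- 2 * \<theta>) * 2 powr (real j * (2 * \<theta> - 2)))"
      by (simp add: algebra_simps)
    finally show ?thesis .
  qed
  have "(\<Sum>k\<in>S. (cmod (w k))\<^sup>2 / (max (real n) \<bar>real_of_int k\<bar>)\<^sup>2)
      \<le> real (card S) * (16 * (real n powr (- 2 * \<theta>) * 2 powr (real j * (2 * \<theta> - 2))))"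
    using sum_bounded_above[OF each, of S "\<lambda>k. k"] by simp
  also have "\<dots> \<le> (5 * 2 ^ j) * (16 * (real n powr (- 2 * \<theta>) * 2 powr (real j * (2 * \<theta> - 2))))"
  proof (rule mult_right_mono)
    have "card S \<le> card {- 2 * 2 ^ j..2 * 2 ^ j :: int}"
      by (rule card_mono[OF _ sub]) simp
    also have "\<dots> = 4 * 2 ^ j + 1"
      by (simp add: nat_add_distrib nat_mult_distrib nat_power_eq)
    finally have "real (card S) \<le> real (4 * 2 ^ j + 1)"
      by (rule of_nat_mono)
    also have "\<dots> \<le> 5 * 2 ^ j"
      by simp
    finally show "real (card S) \<le> 5 * 2 ^ j" .
  qed simp
  also have "\<dots> = 80 * (real n powr (- 2 * \<theta>) * (2 powr real j * 2 powr (real j * (2 * \<theta> - 2))))"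
    by (simp add: powr_realpow)
  also have "2 powr real j * 2 powr (real j * (2 * \<theta> - 2)) = 2 powr (real j * (2 * \<theta> - 1))"
    by (simp add: powr_add[symmetric] algebra_simps)
  finally show ?thesis .
qed

text \<open>The grid is far finer than Bernstein's inequality would require; the crude bound of the
  coefficients by the maximum over the grid then suffices.\<close>

lemma trig_poly_sup:
  fixes b :: "int \<Rightarrow> complex"
  assumes S: "S \<subseteq> {- 2 * 2 ^ j..2 * 2 ^ j}" and x: "0 \<le> x" "x < 1"
  shows "\<exists>i<128 * 4 ^ j. cmod (\<Sum>k\<in>S. b k * ee k x) \<le> 2 * cmod (\<Sum>k\<in>S. b k * ee k (real i / real (128 * 4 ^ j)))"
proof -
  \<comment> \<open>Between x and the nearest grid point below, each of at most 5 * 2^j terms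
    changes by at most 16 * 2^j / N times the maximum \<open>m\<close>, in total 80 * 4^j / N, which
    must not exceed 1.\<close>
  define N :: nat where "N = 128 * 4 ^ j"
  define g where "g x = (\<Sum>k\<in>S. b k * ee k x)" for x
  define m where "m = Max ((\<lambda>i. cmod (g (real i / real N))) ` {..<N})"
  have N0: "0 < N" by (simp add: N_def)
  have fin: "finite S"
    using S finite_subset by blast
  have p24: "(2::int) ^ j \<le> 4 ^ j" by (rule power_mono) auto
  have "2 * (2 * 2 ^ j) < int N"
    using p24 zero_less_power[of "4::int" j] unfolding N_def by (simp, linarith)
  then have inj: "inj_mod N S"
    using S by (intro inj_mod_interval[of S "2 * 2 ^ j"]) auto
  have m: "cmod (g (real i / real N)) \<le> m" if "i < N" for i
    unfolding m_def using that by (intro Max_ge) auto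
  have m0: "0 \<le> m"
    using m[OF N0] norm_ge_zero order_trans by blast
  have b: "cmod (b k) \<le> m" if k: "k \<in> S" for k
  proof -
    have "(\<Sum>i<N. g (real i / real N) * ee (- k) (real i / real N)) / of_nat N
        = (\<Sum>i<N. \<Sum>l\<in>S. b l * (ee l (real i / real N) * ee (- k) (real i / real N))) / of_nat N"
      by (simp add: g_def sum_distrib_right mult.assoc)
    also have "\<dots> = (\<Sum>l\<in>S. b l * ((\<Sum>i<N. ee l (real i / real N) * ee (- k) (real i / real N)) / of_nat N))"
      by (subst sum.swap) (simp add: sum_distrib_left sum_divide_distrib)
    also have "\<dots> = (\<Sum>l\<in>S. if l = k then b l else 0)"
      unfolding average_ee[OF N0] using inj k by (intro sum.cong refl) (auto simp: inj_mod_def)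
    also have "\<dots> = b k"
      using fin k by simp
    finally have "cmod (b k) = cmod (\<Sum>i<N. g (real i / real N) * ee (- k) (real i / real N)) / real N"
      by (metis norm_divide norm_of_nat)
    also have "\<dots> \<le> (\<Sum>i<N. m) / real N"
      by (intro divide_right_mono sum_norm_le) (auto simp: norm_mult m)
    also have "\<dots> = m"
      using N0 by simp
    finally show ?thesis .
  qed
  define i where "i = nat \<lfloor>real N * x\<rfloor>"
  have i: "real i \<le> real N * x" "real N * x < real i + 1"
    using x by (simp_all add: i_def)
  have "real N * x < real N"
    using x N0 by simp
  then have iN: "i < N"
    using i by linarith
  have dist: "\<bar>x - real i / real N\<bar> \<le> 1 / real N"
  proof -
    have "x - real i / real N = (real N * x - real i) / real N"
      using N0 by (simp add: diff_divide_distrib)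
    moreover have "\<bar>real N * x - real i\<bar> \<le> 1"
      using i by linarith
    ultimately show ?thesis
      by (simp add: divide_right_mono)
  qed
  have "cmod (g x - g (real i / real N)) \<le> (\<Sum>k\<in>S. cmod (b k) * cmod (ee k x - ee k (real i / real N)))"
    unfolding g_def sum_subtractf[symmetric] right_diff_distrib[symmetric]
    by (intro sum_norm_le) (simp add: norm_mult)
  also have "\<dots> \<le> (\<Sum>k\<in>S. m * (2 * 4 * (2 * 2 ^ j) * (1 / real N)))"
  proof (intro sum_mono mult_mono b)
    fix k assume "k \<in> S"
    then have "k \<in> {- 2 * 2 ^ j..2 * 2 ^ j}"
      using S by blast
    then have "\<bar>k\<bar> \<le> 2 * 2 ^ j"
      by auto
    then have "real_of_int \<bar>k\<bar> \<le> real_of_int (2 * 2 ^ j)"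
      by (rule of_int_le_iff[THEN iffD2])
    then have k: "\<bar>real_of_int k\<bar> \<le> 2 * 2 ^ j"
      by simp
    have "cmod (ee k x - ee k (real i / real N)) \<le> 2 * pi * \<bar>real_of_int k\<bar> * \<bar>x - real i / real N\<bar>"
      by (rule norm_ee_diff)
    also have "\<dots> \<le> 2 * 4 * (2 * 2 ^ j) * (1 / real N)"
      using k dist pi_less_4 by (intro mult_mono) auto
    finally show "cmod (ee k x - ee k (real i / real N)) \<le> 2 * 4 * (2 * 2 ^ j) * (1 / real N)" .
  qed (use m0 in auto)
  also have "\<dots> = real (card S) * (16 * 2 ^ j / real N) * m"
    by simp
  also have "\<dots> \<le> 1 * m"
  proof (intro mult_right_mono m0)
    have "card S \<le> card {- 2 * 2 ^ j..2 * 2 ^ j :: int}"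
      by (rule card_mono[OF _ S]) simp
    also have "\<dots> = 4 * 2 ^ j + 1"
      by (simp add: nat_add_distrib nat_mult_distrib nat_power_eq)
    finally have "real (card S) \<le> real (4 * 2 ^ j + 1)"
      by (rule of_nat_mono)
    also have "\<dots> \<le> 5 * 2 ^ j"
      by simp
    finally have "real (card S) * (16 * 2 ^ j / real N) \<le> (5 * 2 ^ j) * (16 * 2 ^ j / real N)"
      by (intro mult_right_mono) auto
    also have "\<dots> = 80 * 4 ^ j / real N"
      by (simp add: power_mult_distrib[symmetric])
    also have "\<dots> \<le> 1"
      by (simp add: N_def)
    finally show "real (card S) * (16 * 2 ^ j / real N) \<le> 1" .
  qed
  finally have diff: "cmod (g x - g (real i / real N)) \<le> m" by simp
  have "m \<in> (\<lambda>i. cmod (g (real i / real N))) ` {..<N}"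
    unfolding m_def using N0 by (intro Max_in) auto
  then obtain l where l: "l < N" "m = cmod (g (real l / real N))"
    by auto
  have "cmod (g x) \<le> cmod (g (real i / real N)) + cmod (g x - g (real i / real N))"
    by (metis add.commute diff_add_cancel norm_triangle_ineq)
  also have "\<dots> \<le> 2 * m"
    using m[OF iN] diff by simp
  finally show ?thesis
    using l unfolding g_def N_def by blast
qed

text \<open>The Riemann sum is the integral of \<open>f\<close> composed with
  \<open>cell_round\<close>, so dominated convergence applies.\<close>

lemma Riemann_sum_unit_interval:
  fixes f :: "real \<Rightarrow> complex"
  assumes f: "continuous_on UNIV f"
  shows "(\<lambda>N. (\<Sum>i<N. f (real i / real N)) / of_nat N) \<longlonglongrightarrow> (LINT x:{0..<1}|lborel. f x)"
proof -
  let ?s = "\<lambda>N x. indicator {0..<1} x *\<^sub>R f (cell_round N x)"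
  have [measurable]: "f \<in> borel_measurable borel"
    by (rule borel_measurable_continuous_onI[OF f])
  have "compact (f ` {0..1})"
    by (intro compact_continuous_image continuous_on_subset[OF f]) auto
  then have "\<exists>B. \<forall>x\<in>{0..1}. cmod (f x) \<le> B"
    by (auto dest!: compact_imp_bounded simp: bounded_iff)
  then obtain B where B: "\<And>x. x \<in> {0..1} \<Longrightarrow> cmod (f x) \<le> B"
    by blast
  have round: "\<bar>cell_round N x - x\<bar> \<le> 1 / real N" "x \<in> {0..<1} \<Longrightarrow> cell_round N x \<in> {0..1}" if "0 < N" for N x
  proof -
    have *: "of_int \<lfloor>real N * x\<rfloor> \<le> real N * x" "real N * x < of_int \<lfloor>real N * x\<rfloor> + 1"
      by linarith+
    have le: "cell_round N x \<le> x" "x \<le> cell_round N x + 1 / real N"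
      using * that by (simp_all add: cell_round_def field_simps)
    then show "\<bar>cell_round N x - x\<bar> \<le> 1 / real N" by linarith
    assume x: "x \<in> {0..<1}"
    then have "0 \<le> cell_round N x"
      by (simp add: cell_round_def)
    then show "cell_round N x \<in> {0..1}"
      using le x by simp
  qed
  have "(\<lambda>N. LINT x|lborel. ?s N x) \<longlonglongrightarrow> (LINT x|lborel. indicator {0..<1} x *\<^sub>R f x)"
  \<comment> \<open>The term \<open>cmod (f 0)\<close> covers N = 0, where division by zero makes
    \<open>cell_round\<close> vanish.\<close>
  proof (rule integral_dominated_convergence[where w = "\<lambda>x. indicator {0..<1} x *\<^sub>R max B (cmod (f 0))"])
    show "AE x in lborel. (\<lambda>N. ?s N x) \<longlonglongrightarrow> indicator {0..<1} x *\<^sub>R f x"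
    proof (rule AE_I2)
      fix x
      have "(\<lambda>N. cell_round N x - x) \<longlonglongrightarrow> 0"
      proof (rule Lim_null_comparison)
        show "\<forall>\<^sub>F N in sequentially. norm (cell_round N x - x) \<le> 1 / real N"
          using round(1) by (intro eventually_mono[OF eventually_gt_at_top[of 0]]) auto
      qed (rule lim_1_over_n)
      then have "(\<lambda>N. cell_round N x) \<longlonglongrightarrow> x"
        by (simp add: LIM_zero_iff)
      then have "(\<lambda>N. f (cell_round N x)) \<longlonglongrightarrow> f x"
        by (rule continuous_on_tendsto_compose[OF f]) auto
      then show "(\<lambda>N. ?s N x) \<longlonglongrightarrow> indicator {0..<1} x *\<^sub>R f x"
        by (intro tendsto_intros)
    qed
    show "AE x in lborel. norm (?s N x) \<le> indicator {0..<1} x *\<^sub>R max B (cmod (f 0))" for N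
    proof (rule AE_I2)
      fix x
      show "norm (?s N x) \<le> indicator {0..<1} x *\<^sub>R max B (cmod (f 0))"
        using round(2)[of N x] B[of "cell_round N x"]
        by (cases "N = 0") (auto simp: indicator_def cell_round_def le_max_iff_disj)
    qed
  qed (auto intro!: integrable_real_indicator)
  moreover have "(LINT x|lborel. ?s N x) = (\<Sum>i<N. f (real i / real N)) / of_nat N" if N: "0 < N" for N
  proof -
    let ?C = "\<lambda>i. {real i / real N..<real (Suc i) / real N}"
    have "?s N x = (\<Sum>i<N. indicator (?C i) x *\<^sub>R f (real i / real N))" for x
    proof -
      have "?s N x = (\<Sum>i<N. indicator (?C i) x *\<^sub>R f (cell_round N x))"
        unfolding unit_interval_cells(1)[OF N] indicator_UN_disjoint[OF finite_lessThan unit_interval_cells(2)[OF N]]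
        by (rule scaleR_sum_left)
      also have "\<dots> = (\<Sum>i<N. indicator (?C i) x *\<^sub>R f (real i / real N))"
      proof (intro sum.cong refl)
        fix i
        show "indicator (?C i) x *\<^sub>R f (cell_round N x) = indicator (?C i) x *\<^sub>R f (real i / real N)"
        proof (cases "x \<in> ?C i")
          case True
          then have "cell_round N x = real i / real N"
            using cell_round_grid[OF N, of "x - real i / real N" i] by (simp add: add_divide_distrib)
          then show ?thesis by simp
        qed simp
      qed
      finally show ?thesis .
    qed
    moreover have "(LINT x|lborel. (\<Sum>i<N. indicator (?C i) x *\<^sub>R f (real i / real N)))
        = (\<Sum>i<N. (1 / real N) *\<^sub>R f (real i / real N))"
      using N by (subst Bochner_Integration.integral_sum)
        (auto intro!: integrable_scaleR_left integrable_real_indicator sum.cong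
          simp: divide_right_mono diff_divide_distrib[symmetric])
    ultimately have "(LINT x|lborel. ?s N x) = (\<Sum>i<N. (1 / real N) *\<^sub>R f (real i / real N))"
      by (simp only:)
    then show ?thesis
      by (simp add: sum_divide_distrib scaleR_conv_of_real)
  qed
  ultimately show ?thesis
    unfolding set_lebesgue_integral_def
    by (elim Lim_transform_eventually) (intro eventually_mono[OF eventually_gt_at_top[of 0]], simp)
qed

section \<open>From moments of single blocks to the q-th moment of the supremum\<close>

lemma powr_le_power_split:
  fixes b K :: real
  assumes "0 \<le> b" "0 < K" "0 < q" "q \<le> real (2 * p)"
  shows "b powr q \<le> K powr q + K powr (q - 2 * p) * b ^ (2 * p)"
proof (cases "b \<le> K")
  case True
  then have "b powr q \<le> K powr q"
    using assms by (intro powr_mono2) auto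
  moreover have "0 \<le> K powr (q - 2 * p) * b ^ (2 * p)"
    using assms by simp
  ultimately show ?thesis by linarith
next
  case False
  then have b: "0 < b" using assms by simp
  have "b powr q = b powr (q - 2 * p) * b powr (2 * p)"
    by (simp add: powr_add[symmetric])
  also have "b powr (2 * p) = b ^ (2 * p)"
    using b powr_realpow[of b "2 * p"] by simp
  also have "b powr (q - 2 * p) * b ^ (2 * p) \<le> K powr (q - 2 * p) * b ^ (2 * p)"
    using False assms by (intro mult_right_mono powr_mono2') auto
  finally show ?thesis
    by (simp add: add_increasing)
qed

text \<open>A pointwise substitute for Hoelder's inequality between the orders q and 2p: below the
  level K the q-th power is at most K^q, above it at most K^(q-2p) times the 2p-th power, which
  \<open>T\<close> controls. Being pointwise, it dominates the power of the random Besov norm by a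
  measurable function directly.\<close>

lemma ennreal_powr_moment_split:
  fixes T :: ennreal
  assumes q: "0 < q" "q \<le> real (2 * p)" and p: "1 \<le> p" and K: "0 < K"
    and B: "B \<le> (SUP (j, x)\<in>J. ennreal (u j x))"
    and u: "\<And>j x. (j, x) \<in> J \<Longrightarrow> 0 \<le> u j x \<and> ennreal (u j x ^ (2 * p)) \<le> T"
  shows "ennreal_powr B q \<le> ennreal (K powr q) + ennreal (K powr (q - 2 * p)) * T"
proof (cases "T = \<infinity>")
  case True
  then show ?thesis
    using K by (simp add: ennreal_mult_top)
next
  case False
  then obtain \<tau> where T: "T = ennreal \<tau>" "0 \<le> \<tau>"
    by (metis ennreal_cases infinity_ennreal_def)
  define s where "s = root (2 * p) \<tau>"
  have p0: "0 < 2 * p" using p by simp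
  have "u j x \<le> s" if "(j, x) \<in> J" for j x
  proof -
    have "u j x ^ (2 * p) \<le> \<tau>"
      using u[OF that] T by simp
    then have "root (2 * p) (u j x ^ (2 * p)) \<le> s"
      unfolding s_def using p0 by (rule real_root_le_mono[rotated])
    then show ?thesis
      using u[OF that] p0 by (simp add: real_root_power_cancel)
  qed
  then have "(SUP (j, x)\<in>J. ennreal (u j x)) \<le> ennreal s"
    by (intro SUP_least) (auto intro: ennreal_leI)
  then have Bs: "B \<le> ennreal s"
    using B by simp
  have s0: "0 \<le> s" using T p0 by (simp add: s_def)
  obtain b where b: "B = ennreal b" "0 \<le> b"
    using Bs by (metis ennreal_cases ennreal_less_top leD top_greatest infinity_ennreal_def)
  have bs: "b \<le> s"
    using Bs b s0 by simp
  have "b ^ (2 * p) \<le> s ^ (2 * p)"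
    using bs b by (intro power_mono)
  also have "\<dots> = \<tau>"
    using T p0 by (simp add: s_def)
  finally have b\<tau>: "b ^ (2 * p) \<le> \<tau>" .
  have "b powr q \<le> K powr q + K powr (q - 2 * p) * b ^ (2 * p)"
    by (rule powr_le_power_split[OF b(2) K q])
  also have "\<dots> \<le> K powr q + K powr (q - 2 * p) * \<tau>"
    using b\<tau> by (intro add_left_mono mult_left_mono) auto
  finally have "ennreal (b powr q) \<le> ennreal (K powr q + K powr (q - 2 * p) * \<tau>)"
    by (rule ennreal_leI)
  then show ?thesis
    using b T by (simp add: ennreal_powr_def ennreal_mult)
qed

text \<open>Shared by both norms. The supremum over all blocks and points is dominated by the sum
  \<open>T\<close> over blocks and over the finite grids of \<open>trig_poly_sup\<close>.
  \<open>W\<close> is a measurable majorant of the single moments, so the coefficients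
  \<open>b\<close> themselves enter only through an almost sure bound.\<close>

lemma block_moment_assembly:
  fixes M :: "'w measure" and b :: "'w \<Rightarrow> nat \<Rightarrow> int \<Rightarrow> complex" and W :: "nat \<Rightarrow> real \<Rightarrow> 'w \<Rightarrow> ennreal"
  assumes M: "prob_space M" and p: "1 \<le> p" and q: "0 < q" "q \<le> real (2 * p)"
    and n: "1 \<le> n" and C: "0 \<le> C"
    and decay: "1 < real p * (1 / 2 - \<alpha> - \<theta>)"
    and S: "\<And>j. S j \<subseteq> {- 2 * 2 ^ j..2 * 2 ^ j}"
    and W: "\<And>j x. W j x \<in> borel_measurable M"
    and dom: "\<And>j x. AE \<omega> in M. ennreal (cmod (\<Sum>k\<in>S j. b \<omega> j k * ee k x) ^ (2 * p)) \<le> W j x \<omega>"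
    and int_W: "\<And>j x. (\<integral>\<^sup>+\<omega>. W j x \<omega> \<partial>M) \<le> ennreal (C * (real n powr (- 2 * \<theta>) * 2 powr (real j * (2 * \<theta> - 1))) ^ p)"
    and B: "\<And>\<omega>. B \<omega> \<le> (SUP (j, x)\<in>UNIV \<times> {0..<1}. ennreal (2 powr (\<alpha> * real j) * cmod (\<Sum>k\<in>S j. b \<omega> j k * ee k x)))"
  shows "(\<integral>\<^sup>+\<omega>. ennreal_powr (B \<omega>) q \<partial>M)
    \<le> ennreal ((1 + C * (128 * 4 ^ p / (1 - 2 powr (2 - 2 * p * (1 / 2 - \<alpha> - \<theta>))))) * real n powr (- q * \<theta>))"
proof -
  interpret prob_space M by (rule M)
  note [measurable] = W
  \<comment> \<open>Ratio of consecutive blocks: 2^(2p \<alpha>) from the Besov weight, 4 from the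
    number of grid points and 2^(p(2\<theta>-1)) from the moment bound. The assumption
    \<open>decay\<close> says exactly that it is less than 1.\<close>
  define r where "r = 2 powr (2 - 2 * real p * (1 / 2 - \<alpha> - \<theta>))"
  have r: "0 < r" "r < 1"
  proof -
    have "r < 2 powr 0"
      unfolding r_def using decay by (intro powr_less_mono) auto
    then show "r < 1" by simp
  qed (simp add: r_def)
  define N :: "nat \<Rightarrow> nat" where "N j = 128 * 4 ^ j" for j
  \<comment> \<open>The expected size of the norm: with this level both terms of
    \<open>ennreal_powr_moment_split\<close> have expectation of order n^(-q\<theta>).\<close>
  define K where "K = real n powr (- \<theta>)"
  have n0: "0 < real n" using n by simp
  have K0: "0 < K" unfolding K_def using n0 by simp
  define T where "T \<omega> = (\<Sum>j. ennreal (2 powr (2 * p * \<alpha> * j) * 4 ^ p) * (\<Sum>i<N j. W j (real i / real (N j)) \<omega>))" for \<omega>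
  have [measurable]: "T \<in> borel_measurable M"
    unfolding T_def by measurable
  have int_T: "(\<integral>\<^sup>+\<omega>. T \<omega> \<partial>M) \<le> ennreal (C * (128 * 4 ^ p / (1 - r)) * real n powr (- 2 * \<theta> * p))"
  proof -
    have "(\<integral>\<^sup>+\<omega>. T \<omega> \<partial>M) = (\<Sum>j. ennreal (2 powr (2 * p * \<alpha> * j) * 4 ^ p) * (\<Sum>i<N j. \<integral>\<^sup>+\<omega>. W j (real i / real (N j)) \<omega> \<partial>M))"
      unfolding T_def by (simp add: nn_integral_suminf nn_integral_cmult nn_integral_sum)
    also have "\<dots> \<le> (\<Sum>j. ennreal (C * (128 * 4 ^ p) * real n powr (- 2 * \<theta> * p) * r ^ j))"
    proof (rule suminf_le)
      fix j
      have "(\<Sum>i<N j. \<integral>\<^sup>+\<omega>. W j (real i / real (N j)) \<omega> \<partial>M)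
          \<le> (\<Sum>i<N j. ennreal (C * (real n powr (- 2 * \<theta>) * 2 powr (real j * (2 * \<theta> - 1))) ^ p))"
        by (intro sum_mono int_W)
      also have "\<dots> = ennreal (real (N j) * (C * (real n powr (- 2 * \<theta>) * 2 powr (real j * (2 * \<theta> - 1))) ^ p))"
        using C by (simp add: ennreal_mult ennreal_of_nat_eq_real_of_nat)
      finally have "ennreal (2 powr (2 * p * \<alpha> * j) * 4 ^ p) * (\<Sum>i<N j. \<integral>\<^sup>+\<omega>. W j (real i / real (N j)) \<omega> \<partial>M)
          \<le> ennreal (2 powr (2 * p * \<alpha> * j) * 4 ^ p) * ennreal (real (N j) * (C * (real n powr (- 2 * \<theta>) * 2 powr (real j * (2 * \<theta> - 1))) ^ p))"
        by (intro mult_left_mono) auto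
      also have "\<dots> = ennreal ((2 powr (2 * p * \<alpha> * j) * 4 ^ p) * (real (N j) * (C * (real n powr (- 2 * \<theta>) * 2 powr (real j * (2 * \<theta> - 1))) ^ p)))"
        using C by (intro ennreal_mult[symmetric]) auto
      also have "(2 powr (2 * p * \<alpha> * j) * 4 ^ p) * (real (N j) * (C * (real n powr (- 2 * \<theta>) * 2 powr (real j * (2 * \<theta> - 1))) ^ p))
          = C * (128 * 4 ^ p) * real n powr (- 2 * \<theta> * p) * r ^ j"
      proof -
        have 1: "(real n powr (- 2 * \<theta>)) ^ p = real n powr (- 2 * \<theta> * p)"
          using n0 by (simp add: powr_realpow[symmetric] powr_powr)
        have 2: "(2 powr (real j * (2 * \<theta> - 1))) ^ p = (2::real) powr (real j * (2 * \<theta> - 1) * p)"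
          by (simp add: powr_realpow[symmetric] powr_powr)
        have 3: "real (N j) = 128 * 2 powr (2 * real j)"
        proof -
          have "(4::real) ^ j = 2 powr (2 * real j)"
            using powr_realpow[of 2 "2 * j"] by (simp add: power_mult)
          then show ?thesis by (simp add: N_def)
        qed
        have 4: "r ^ j = 2 powr (2 * p * \<alpha> * j) * (2 powr (2 * real j) * 2 powr (real j * (2 * \<theta> - 1) * p))"
          unfolding r_def by (simp add: powr_realpow[symmetric] powr_powr powr_add[symmetric] algebra_simps)
        show ?thesis
          unfolding power_mult_distrib 1 2 3 4 by (simp add: mult_ac)
      qed
      finally show "ennreal (2 powr (2 * p * \<alpha> * j) * 4 ^ p) * (\<Sum>i<N j. \<integral>\<^sup>+\<omega>. W j (real i / real (N j)) \<omega> \<partial>M)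
          \<le> ennreal (C * (128 * 4 ^ p) * real n powr (- 2 * \<theta> * p) * r ^ j)" .
    qed auto
    also have "\<dots> = ennreal (\<Sum>j. C * (128 * 4 ^ p) * real n powr (- 2 * \<theta> * p) * r ^ j)"
      using C r by (intro suminf_ennreal2 summable_mult summable_geometric) auto
    also have "(\<Sum>j. C * (128 * 4 ^ p) * real n powr (- 2 * \<theta> * p) * r ^ j) = C * (128 * 4 ^ p / (1 - r)) * real n powr (- 2 * \<theta> * p)"
      using r by (simp add: suminf_mult suminf_geometric)
    finally show ?thesis .
  qed
  have pointwise: "AE \<omega> in M. ennreal_powr (B \<omega>) q \<le> ennreal (K powr q) + ennreal (K powr (q - 2 * p)) * T \<omega>"
  proof -
    have "AE \<omega> in M. \<forall>j i. ennreal (cmod (\<Sum>k\<in>S j. b \<omega> j k * ee k (real i / real (N j))) ^ (2 * p)) \<le> W j (real i / real (N j)) \<omega>"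
      unfolding AE_all_countable using dom by blast
    then show ?thesis
    proof (rule AE_mp, intro AE_I2 impI)
      fix \<omega>
      assume d: "\<forall>j i. ennreal (cmod (\<Sum>k\<in>S j. b \<omega> j k * ee k (real i / real (N j))) ^ (2 * p)) \<le> W j (real i / real (N j)) \<omega>"
      show "ennreal_powr (B \<omega>) q \<le> ennreal (K powr q) + ennreal (K powr (q - 2 * p)) * T \<omega>"
      proof (rule ennreal_powr_moment_split[OF q p K0 B])
        fix j :: nat and x :: real assume "(j, x) \<in> UNIV \<times> {0..<1}"
        then have x: "0 \<le> x" "x < 1" by auto
        let ?f = "\<lambda>x. cmod (\<Sum>k\<in>S j. b \<omega> j k * ee k x)"
        obtain i where i: "i < N j" "?f x \<le> 2 * ?f (real i / real (N j))"
          using trig_poly_sup[OF S x, where b = "b \<omega> j"] unfolding N_def by blast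
        have "(2 powr (\<alpha> * real j) * ?f x) ^ (2 * p) \<le> (2 powr (\<alpha> * real j) * (2 * ?f (real i / real (N j)))) ^ (2 * p)"
          using i by (intro power_mono mult_left_mono) auto
        also have "\<dots> = 2 powr (2 * p * \<alpha> * j) * 4 ^ p * ?f (real i / real (N j)) ^ (2 * p)"
        proof -
          have "(2 powr (\<alpha> * real j)) ^ (2 * p) = (2::real) powr (2 * p * \<alpha> * j)"
            by (simp add: powr_realpow[symmetric] powr_powr mult_ac)
          then show ?thesis
            by (simp add: power_mult_distrib power_mult[of 2 2 p])
        qed
        finally have "ennreal ((2 powr (\<alpha> * real j) * ?f x) ^ (2 * p))
            \<le> ennreal (2 powr (2 * p * \<alpha> * j) * 4 ^ p) * ennreal (?f (real i / real (N j)) ^ (2 * p))"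
          by (subst ennreal_mult[symmetric]) (auto intro: ennreal_leI)
        also have "\<dots> \<le> ennreal (2 powr (2 * p * \<alpha> * j) * 4 ^ p) * (\<Sum>i<N j. W j (real i / real (N j)) \<omega>)"
        proof (intro mult_left_mono)
          have "W j (real i / real (N j)) \<omega> \<le> (\<Sum>i<N j. W j (real i / real (N j)) \<omega>)"
            using i(1) by (intro member_le_sum) auto
          then show "ennreal (?f (real i / real (N j)) ^ (2 * p)) \<le> (\<Sum>i<N j. W j (real i / real (N j)) \<omega>)"
            using d order_trans by blast
        qed auto
        also have "\<dots> \<le> T \<omega>"
        proof -
          have "(\<Sum>l\<in>{j}. ennreal (2 powr (2 * p * \<alpha> * l) * 4 ^ p) * (\<Sum>i<N l. W l (real i / real (N l)) \<omega>)) \<le> T \<omega>"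
            unfolding T_def by (intro sum_le_suminf) auto
          then show ?thesis by simp
        qed
        finally show "0 \<le> 2 powr (\<alpha> * real j) * ?f x \<and> ennreal ((2 powr (\<alpha> * real j) * ?f x) ^ (2 * p)) \<le> T \<omega>"
          by simp
      qed
    qed
  qed
  have "(\<integral>\<^sup>+\<omega>. ennreal_powr (B \<omega>) q \<partial>M) \<le> (\<integral>\<^sup>+\<omega>. ennreal (K powr q) + ennreal (K powr (q - 2 * p)) * T \<omega> \<partial>M)"
    by (rule nn_integral_mono_AE[OF pointwise])
  also have "\<dots> = ennreal (K powr q) + ennreal (K powr (q - 2 * p)) * (\<integral>\<^sup>+\<omega>. T \<omega> \<partial>M)"
    by (simp add: nn_integral_add nn_integral_cmult emeasure_space_1)
  also have "\<dots> \<le> ennreal (K powr q) + ennreal (K powr (q - 2 * p)) * ennreal (C * (128 * 4 ^ p / (1 - r)) * real n powr (- 2 * \<theta> * p))"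
    by (intro add_left_mono mult_left_mono int_T) auto
  also have "\<dots> = ennreal (K powr q + K powr (q - 2 * p) * (C * (128 * 4 ^ p / (1 - r)) * real n powr (- 2 * \<theta> * p)))"
    using C r by (simp add: ennreal_mult[symmetric])
  also have "K powr q + K powr (q - 2 * p) * (C * (128 * 4 ^ p / (1 - r)) * real n powr (- 2 * \<theta> * p))
      = (1 + C * (128 * 4 ^ p / (1 - r))) * real n powr (- q * \<theta>)"
  proof -
    have 1: "K powr q = real n powr (- q * \<theta>)"
      by (simp add: K_def powr_powr mult.commute)
    have 2: "K powr (q - 2 * p) * real n powr (- 2 * \<theta> * p) = real n powr (- q * \<theta>)"
      by (simp add: K_def powr_powr powr_add[symmetric] algebra_simps)
    have "K powr (q - 2 * p) * (C * (128 * 4 ^ p / (1 - r)) * real n powr (- 2 * \<theta> * p))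
        = C * (128 * 4 ^ p / (1 - r)) * (K powr (q - 2 * p) * real n powr (- 2 * \<theta> * p))"
      by (simp only: mult_ac)
    then show ?thesis
      unfolding 1 2 by (simp only: distrib_right mult_1_left)
  qed
  finally show ?thesis
    unfolding r_def .
qed

section \<open>Besov norms\<close>

lemma torus_block_eq:
  assumes "finite (block_modes \<epsilon>\<^sub>0 \<phi> 1 j)"
  shows "torus_block \<epsilon>\<^sub>0 \<phi> f j x
    = (\<Sum>k\<in>block_modes \<epsilon>\<^sub>0 \<phi> 1 j. (phi_block \<epsilon>\<^sub>0 \<phi> 1 j (of_int k) * inner_torus f (ee k)) * ee k x)"
proof -
  have "torus_block \<epsilon>\<^sub>0 \<phi> f j x = (\<Sum>\<^sub>\<infinity>k\<in>block_modes \<epsilon>\<^sub>0 \<phi> 1 j.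
      phi_block \<epsilon>\<^sub>0 \<phi> 1 j (of_int k) *\<^sub>R (inner_torus f (ee k) * ee k x))"
    unfolding torus_block_def by (rule infsum_cong_neutral) (auto simp: block_modes_def)
  then show ?thesis
    using assms by (simp add: scaleR_conv_of_real mult.assoc)
qed

lemma besov_torus_le_SUP:
  assumes fin: "\<And>j. finite (block_modes \<epsilon>\<^sub>0 \<phi> 1 j)"
  shows "besov_torus \<epsilon>\<^sub>0 \<phi> \<alpha> \<infinity> \<infinity> f \<le> (SUP (j, x)\<in>UNIV \<times> {0..<1}. ennreal (2 powr (\<alpha> * real j) *
    cmod (\<Sum>k\<in>block_modes \<epsilon>\<^sub>0 \<phi> 1 j. (phi_block \<epsilon>\<^sub>0 \<phi> 1 j (of_int k) * inner_torus f (ee k)) * ee k x)))"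
    (is "_ \<le> ?S")
proof -
  have "ennreal (2 powr (\<alpha> * real j)) * esssup (restrict_space lborel {0..<1})
      (\<lambda>x. ennreal (cmod (torus_block \<epsilon>\<^sub>0 \<phi> f j x))) \<le> ?S" for j
  proof -
    have [measurable]: "(\<lambda>x. torus_block \<epsilon>\<^sub>0 \<phi> f j x) \<in> borel_measurable lborel"
      unfolding torus_block_eq[OF fin] by measurable
    have "esssup (restrict_space lborel {0..<1}) (\<lambda>x. ennreal (cmod (torus_block \<epsilon>\<^sub>0 \<phi> f j x)))
        \<le> (SUP x\<in>{0..<1}. ennreal (cmod (torus_block \<epsilon>\<^sub>0 \<phi> f j x)))"
      by (intro esssup_I measurable_restrict_space1 AE_I2)
         (auto simp: space_restrict_space intro!: SUP_upper)
    then have "ennreal (2 powr (\<alpha> * real j)) * esssup (restrict_space lborel {0..<1}) (\<lambda>x. ennreal (cmod (torus_block \<epsilon>\<^sub>0 \<phi> f j x)))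
        \<le> ennreal (2 powr (\<alpha> * real j)) * (SUP x\<in>{0..<1}. ennreal (cmod (torus_block \<epsilon>\<^sub>0 \<phi> f j x)))"
      by (intro mult_left_mono) auto
    also have "\<dots> = (SUP x\<in>{0..<1}. ennreal (2 powr (\<alpha> * real j)) * ennreal (cmod (torus_block \<epsilon>\<^sub>0 \<phi> f j x)))"
      by (rule SUP_mult_left_ennreal)
    also have "\<dots> \<le> ?S"
      by (intro SUP_least) (auto simp: torus_block_eq[OF fin] ennreal_mult[symmetric] intro!: SUP_upper2[where i = "(j, _)"])
    finally show ?thesis .
  qed
  then show ?thesis
    unfolding besov_torus_def Lp_norm_def by (auto intro!: esssup_I)
qed

lemma grid_subset: "grid n \<subseteq> {0..<1}"
proof
  fix x assume "x \<in> grid n"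
  then obtain i where i: "i < 2 * n" and x: "x = real i / (2 * real n)"
    by (auto simp: grid_def)
  have "real i < real (2 * n)"
    using i by (simp only: of_nat_less_iff)
  then show "x \<in> {0..<1}"
    using i by (simp add: x)
qed

text \<open>The maximum over grid points is enlarged to a supremum over the whole interval of the
  trigonometric polynomial with the same coefficients; this puts the grid norm into the form
  required by \<open>block_moment_assembly\<close>.\<close>

lemma besov_grid_le_SUP:
  fixes n :: nat and \<epsilon>\<^sub>0 :: real and \<phi>
  defines "S \<equiv> (\<lambda>j. block_modes \<epsilon>\<^sub>0 \<phi> (grid_scale n) j \<inter> {- int n..int n - 1})"
  shows "besov_grid \<epsilon>\<^sub>0 \<phi> n \<alpha> \<infinity> \<infinity> f \<le> (SUP (j, x)\<in>UNIV \<times> {0..<1}. ennreal (2 powr (\<alpha> * real j) *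
    cmod (\<Sum>k\<in>S j. (phi_block \<epsilon>\<^sub>0 \<phi> (grid_scale n) j (of_int k) * inner_grid n f (grid_restrict n (ee k))) * ee k x)))"
    (is "_ \<le> ?S")
proof -
  have block: "grid_block \<epsilon>\<^sub>0 \<phi> n f j x
      = (\<Sum>k\<in>S j. (phi_block \<epsilon>\<^sub>0 \<phi> (grid_scale n) j (of_int k) * inner_grid n f (grid_restrict n (ee k))) * ee k x)"
    if "x \<in> grid n" for j x
    unfolding grid_block_def using that
    by (intro sum.mono_neutral_cong_right)
       (auto simp: S_def block_modes_def grid_restrict_def scaleR_conv_of_real mult.assoc)
  have "ennreal (2 powr (\<alpha> * real j)) * esssup (uniform_count_measure (grid n))
      (\<lambda>x. ennreal (cmod (grid_block \<epsilon>\<^sub>0 \<phi> n f j x))) \<le> ?S" for j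
  proof -
    have "esssup (uniform_count_measure (grid n)) (\<lambda>x. ennreal (cmod (grid_block \<epsilon>\<^sub>0 \<phi> n f j x)))
        \<le> (SUP x\<in>grid n. ennreal (cmod (grid_block \<epsilon>\<^sub>0 \<phi> n f j x)))"
      by (intro esssup_I AE_I2)
         (auto simp: measurable_def space_uniform_count_measure sets_uniform_count_measure intro!: SUP_upper)
    then have "ennreal (2 powr (\<alpha> * real j)) * esssup (uniform_count_measure (grid n)) (\<lambda>x. ennreal (cmod (grid_block \<epsilon>\<^sub>0 \<phi> n f j x)))
        \<le> ennreal (2 powr (\<alpha> * real j)) * (SUP x\<in>grid n. ennreal (cmod (grid_block \<epsilon>\<^sub>0 \<phi> n f j x)))"
      by (intro mult_left_mono) auto
    also have "\<dots> = (SUP x\<in>grid n. ennreal (2 powr (\<alpha> * real j)) * ennreal (cmod (grid_block \<epsilon>\<^sub>0 \<phi> n f j x)))"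
      by (rule SUP_mult_left_ennreal)
    also have "\<dots> \<le> ?S"
    proof (rule SUP_least)
      fix x assume x: "x \<in> grid n"
      then have "(j, x) \<in> UNIV \<times> {0..<1}"
        using grid_subset by blast
      then show "ennreal (2 powr (\<alpha> * real j)) * ennreal (cmod (grid_block \<epsilon>\<^sub>0 \<phi> n f j x)) \<le> ?S"
        by (rule SUP_upper2) (simp add: block[OF x] ennreal_mult)
    qed
    finally show ?thesis .
  qed
  then show ?thesis
    unfolding besov_grid_def Lp_norm_def by (auto intro!: esssup_I)
qed

section \<open>Recovering the Fourier coefficients of both errors from sampled ones\<close>

lemma continuous_interp: "continuous_on A (interp n f)"
  unfolding interp_def by (intro continuous_intros continuous_ee)

text \<open>When N separates the frequencies of \<open>S\<close> from those of the interpolant, the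
  N-point average of the interpolant returns its coefficient exactly, so both parts of
  \<open>mode_error\<close> become averages over the same points.\<close>

lemma mode_error_interp:
  assumes N: "0 < N" and inj: "inj_mod N (S \<union> {- int n..int n - 1})" and S: "finite S"
  shows "(\<Sum>k\<in>S. w k * ((\<Sum>i<N. (f (real i / real N) - interp n g (real i / real N)) * ee (- k) (real i / real N)) / of_nat N))
    = mode_error n N S w f g"
proof -
  let ?I = "{- int n..int n - 1}"
  let ?c = "\<lambda>k. inner_grid n g (grid_restrict n (ee k))"
  have av: "(\<Sum>i<N. interp n g (real i / real N) * ee (- k) (real i / real N)) / of_nat N = (if k \<in> ?I then ?c k else 0)"
    if k: "k \<in> S" for k
  proof -
    have "(\<Sum>i<N. interp n g (real i / real N) * ee (- k) (real i / real N)) / of_nat N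
        = (\<Sum>l\<in>?I. ?c l * ((\<Sum>i<N. ee l (real i / real N) * ee (- k) (real i / real N)) / of_nat N))"
      unfolding interp_def sum_distrib_right
      by (subst sum.swap) (simp add: sum_distrib_left sum_divide_distrib mult.assoc)
    also have "\<dots> = (\<Sum>l\<in>?I. if l = k then ?c l else 0)"
      unfolding average_ee[OF N] using inj k by (intro sum.cong refl) (auto simp: inj_mod_def)
    finally show ?thesis by simp
  qed
  have "(\<Sum>k\<in>S. w k * ((\<Sum>i<N. (f (real i / real N) - interp n g (real i / real N)) * ee (- k) (real i / real N)) / of_nat N))
      = (\<Sum>k\<in>S. w k * ((\<Sum>i<N. f (real i / real N) * ee (- k) (real i / real N)) / of_nat N)
          - w k * ((\<Sum>i<N. interp n g (real i / real N) * ee (- k) (real i / real N)) / of_nat N))"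
    by (intro sum.cong refl) (simp add: left_diff_distrib sum_subtractf diff_divide_distrib right_diff_distrib)
  also have "\<dots> = (\<Sum>k\<in>S. w k * ((\<Sum>i<N. f (real i / real N) * ee (- k) (real i / real N)) / of_nat N))
      - (\<Sum>k\<in>S. if k \<in> ?I then w k * ?c k else 0)"
    unfolding sum_subtractf by (intro arg_cong2[where f = "(-)"] sum.cong refl) (simp add: av)
  also have "(\<Sum>k\<in>S. if k \<in> ?I then w k * ?c k else 0) = (\<Sum>k\<in>S \<inter> ?I. w k * ?c k)"
    using S by (simp add: sum.inter_restrict)
  finally show ?thesis
    by (simp add: mode_error_def)
qed

text \<open>For large N the functional is a Riemann sum of the Fourier coefficients of the error,
  whose integrand is continuous.\<close>

lemma mode_error_tendsto:
  assumes f: "continuous_on UNIV f" and S: "finite S" and N0: "\<And>N. N0 \<le> N \<Longrightarrow> 0 < N \<and> inj_mod N (S \<union> {- int n..int n - 1})"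
  shows "(\<lambda>N. mode_error n N S w f g) \<longlonglongrightarrow> (\<Sum>k\<in>S. w k * inner_torus (\<lambda>x. f x - interp n g x) (ee k))"
proof -
  have "(\<lambda>N. \<Sum>k\<in>S. w k * ((\<Sum>i<N. (f (real i / real N) - interp n g (real i / real N)) * ee (- k) (real i / real N)) / of_nat N))
      \<longlonglongrightarrow> (\<Sum>k\<in>S. w k * inner_torus (\<lambda>x. f x - interp n g x) (ee k))"
    unfolding inner_torus_def cnj_ee
    by (intro tendsto_sum tendsto_mult tendsto_const Riemann_sum_unit_interval
        continuous_on_mult continuous_on_diff f continuous_interp continuous_ee)
  moreover have "\<forall>\<^sub>F N in sequentially.
      (\<Sum>k\<in>S. w k * ((\<Sum>i<N. (f (real i / real N) - interp n g (real i / real N)) * ee (- k) (real i / real N)) / of_nat N))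
      = mode_error n N S w f g"
    using N0 by (intro eventually_mono[OF eventually_ge_at_top[of N0]] mode_error_interp S) auto
  ultimately show ?thesis
    by (rule Lim_transform_eventually)
qed

lemma mode_error_grid:
  assumes n: "1 \<le> n" and S: "S \<subseteq> {- int n..int n - 1}"
  shows "mode_error n (2 * n) S w f g = (\<Sum>k\<in>S. w k * inner_grid n (\<lambda>x. grid_restrict n f x - g x) (grid_restrict n (ee k)))"
proof -
  have "S \<inter> {- int n..int n - 1} = S"
    using S by blast
  then have "mode_error n (2 * n) S w f g = (\<Sum>k\<in>S. w k * ((\<Sum>x\<in>grid n. f x * ee (- k) x) / (2 * of_nat n))
      - w k * inner_grid n g (grid_restrict n (ee k)))"
    unfolding mode_error_def sum_grid[OF n] by (simp add: sum_subtractf)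
  also have "\<dots> = (\<Sum>k\<in>S. w k * inner_grid n (\<lambda>x. grid_restrict n f x - g x) (grid_restrict n (ee k)))"
    unfolding inner_grid_ee
    by (intro sum.cong refl)
       (simp add: grid_restrict_def left_diff_distrib sum_subtractf diff_divide_distrib right_diff_distrib cong: sum.cong)
  finally show ?thesis .
qed

text \<open>The rate \<theta> is a free parameter here; both cases of the theorem are
  instances.\<close>

lemma besov_error_rate:
  fixes c \<epsilon>\<^sub>0 \<alpha> q \<theta> :: real and \<phi> :: "real \<Rightarrow> real"
  assumes c: "0 < c" "c < 1 / 4" and phi: "0 < \<epsilon>\<^sub>0" "\<epsilon>\<^sub>0 < 1 / 10" "cutoff \<epsilon>\<^sub>0 \<phi>"
    and q: "0 < q" and th: "0 \<le> \<theta>" "\<theta> \<le> 1" "\<theta> < 1 / 2 - \<alpha>"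
  shows "\<exists>D>0. \<forall>(M :: 'w measure) \<xi> Z Y n t.
    prob_space M \<and> white_noise M \<xi> \<and> heat_solution M \<xi> Z \<and> discrete_solution c M \<xi> n Y \<and> 1 \<le> n \<and> 0 \<le> t \<longrightarrow>
    (\<integral>\<^sup>+\<omega>. ennreal_powr (besov_torus \<epsilon>\<^sub>0 \<phi> \<alpha> \<infinity> \<infinity> (\<lambda>x. Z t x \<omega> - interp n (\<lambda>y. Y t y \<omega>) x)) q \<partial>M)
      \<le> ennreal (D * real n powr (- q * \<theta>)) \<and>
    (\<integral>\<^sup>+\<omega>. ennreal_powr (besov_grid \<epsilon>\<^sub>0 \<phi> n \<alpha> \<infinity> \<infinity> (\<lambda>x. grid_restrict n (\<lambda>y. Z t y \<omega>) x - Y t x \<omega>)) q \<partial>M)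
      \<le> ennreal (D * real n powr (- q * \<theta>))"
proof -
  define g where "g = 1 / 2 - \<alpha> - \<theta>"
  have g: "0 < g" using th by (simp add: g_def)
  \<comment> \<open>The lower bound 1/g makes the series over the blocks converge, and q ensures
    that the moment of order 2p dominates the one of order q.\<close>
  obtain p :: nat where p': "max (max (1 / g) q) 1 < real p"
    using reals_Archimedean2 by blast
  then have p: "1 \<le> p" "1 < real p * g" "q \<le> real (2 * p)"
    using g by (auto simp: field_simps)
  obtain C where C: "0 < C" and mom: "\<forall>(M :: 'w measure) \<xi> Z Y n t N S w.
    prob_space M \<and> white_noise M \<xi> \<and> heat_solution M \<xi> Z \<and> discrete_solution c M \<xi> n Y \<and>
    1 \<le> n \<and> 0 \<le> t \<and> 2 * n \<le> N \<and> finite S \<and> (\<forall>k\<in>S. 2 * \<bar>k\<bar> \<le> int N) \<and>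
    inj_mod N (S \<union> {- int n..int n - 1}) \<longrightarrow>
    (\<lambda>\<omega>. mode_error n N S w (\<lambda>x. Z t x \<omega>) (\<lambda>x. Y t x \<omega>)) \<in> borel_measurable M \<and>
    (\<integral>\<^sup>+\<omega>. ennreal (cmod (mode_error n N S w (\<lambda>x. Z t x \<omega>) (\<lambda>x. Y t x \<omega>)) ^ (2 * p)) \<partial>M)
      \<le> ennreal (C * (\<Sum>k\<in>S. (cmod (w k))\<^sup>2 / (max (real n) \<bar>real_of_int k\<bar>)\<^sup>2) ^ p)"
    using mode_error_moment[OF c p(1), where 'w = 'w] by (elim exE conjE) (rule that)
  define A where "A = C * 80 ^ p"
  have A: "0 < A" using C by (simp add: A_def)
  define D where "D = 1 + A * (128 * 4 ^ p / (1 - 2 powr (2 - 2 * real p * g)))"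
  have "2 powr (2 - 2 * real p * g) < 2 powr 0"
    using p by (intro powr_less_mono) auto
  then have "0 < 128 * 4 ^ p / (1 - 2 powr (2 - 2 * real p * g))"
    by simp
  then have D: "0 < D"
    unfolding D_def using A by (intro add_pos_pos mult_pos_pos) auto
  have main: "(\<integral>\<^sup>+\<omega>. ennreal_powr (besov_torus \<epsilon>\<^sub>0 \<phi> \<alpha> \<infinity> \<infinity> (\<lambda>x. Z t x \<omega> - interp n (\<lambda>y. Y t y \<omega>) x)) q \<partial>M)
      \<le> ennreal (D * real n powr (- q * \<theta>)) \<and>
    (\<integral>\<^sup>+\<omega>. ennreal_powr (besov_grid \<epsilon>\<^sub>0 \<phi> n \<alpha> \<infinity> \<infinity> (\<lambda>x. grid_restrict n (\<lambda>y. Z t y \<omega>) x - Y t x \<omega>)) q \<partial>M)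
      \<le> ennreal (D * real n powr (- q * \<theta>))"
    if M: "prob_space M" and sol: "white_noise M \<xi>" "heat_solution M \<xi> Z" "discrete_solution c M \<xi> n Y"
      and n: "1 \<le> n" and t: "0 \<le> t"
    for M :: "'w measure" and \<xi> Z Y n t
  proof -
    interpret prob_space M by (rule M)
    let ?I = "{- int n..int n - 1}"
    let ?X = "\<lambda>N S w \<omega>. mode_error n N S w (\<lambda>x. Z t x \<omega>) (\<lambda>x. Y t x \<omega>)"
    have moment: "?X N S w \<in> borel_measurable M"
        "(\<integral>\<^sup>+\<omega>. ennreal (cmod (?X N S w \<omega>) ^ (2 * p)) \<partial>M) \<le> ennreal (A * (real n powr (- 2 * \<theta>) * 2 powr (real j * (2 * \<theta> - 1))) ^ p)"
      if N: "2 * n \<le> N" "\<forall>k\<in>S. 2 * \<bar>k\<bar> \<le> int N" "inj_mod N (S \<union> ?I)"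
        and \<rho>: "1 \<le> \<rho>" "\<rho> \<le> 2" and S: "S \<subseteq> block_modes \<epsilon>\<^sub>0 \<phi> \<rho> j" and w: "\<And>k. k \<in> S \<Longrightarrow> cmod (w k) \<le> 1"
      for N S w \<rho> j
    proof -
      have fin: "finite S"
        using S block_modes_subset[OF phi \<rho>, of j] by (meson finite_atLeastAtMost_int finite_subset)
      let ?V = "\<Sum>k\<in>S. (cmod (w k))\<^sup>2 / (max (real n) \<bar>real_of_int k\<bar>)\<^sup>2"
      have mm: "?X N S w \<in> borel_measurable M \<and> (\<integral>\<^sup>+\<omega>. ennreal (cmod (?X N S w \<omega>) ^ (2 * p)) \<partial>M) \<le> ennreal (C * ?V ^ p)"
        by (rule mom[rule_format]) (use M sol n t N fin in auto)
      then show "?X N S w \<in> borel_measurable M" by blast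
      have "?V ^ p \<le> (80 * (real n powr (- 2 * \<theta>) * 2 powr (real j * (2 * \<theta> - 1)))) ^ p"
        by (intro power_mono block_modes_weight[OF phi \<rho> n th(1,2) S w] sum_nonneg) auto
      then have "C * ?V ^ p \<le> C * (80 * (real n powr (- 2 * \<theta>) * 2 powr (real j * (2 * \<theta> - 1)))) ^ p"
        using C by (intro mult_left_mono) auto
      also have "\<dots> = A * (real n powr (- 2 * \<theta>) * 2 powr (real j * (2 * \<theta> - 1))) ^ p"
        by (simp only: A_def power_mult_distrib mult.assoc)
      finally show "(\<integral>\<^sup>+\<omega>. ennreal (cmod (?X N S w \<omega>) ^ (2 * p)) \<partial>M) \<le> ennreal (A * (real n powr (- 2 * \<theta>) * 2 powr (real j * (2 * \<theta> - 1))) ^ p)"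
        using mm by (meson ennreal_leI order_trans)
    qed
    have "(\<integral>\<^sup>+\<omega>. ennreal_powr (besov_torus \<epsilon>\<^sub>0 \<phi> \<alpha> \<infinity> \<infinity> (\<lambda>x. Z t x \<omega> - interp n (\<lambda>y. Y t y \<omega>) x)) q \<partial>M)
      \<le> ennreal (D * real n powr (- q * \<theta>))"
    proof -
      let ?S = "block_modes \<epsilon>\<^sub>0 \<phi> 1"
      let ?b = "\<lambda>\<omega> j k. complex_of_real (phi_block \<epsilon>\<^sub>0 \<phi> 1 j (of_int k)) * inner_torus (\<lambda>x. Z t x \<omega> - interp n (\<lambda>y. Y t y \<omega>) x) (ee k)"
      \<comment> \<open>Evaluation at x is absorbed into the weights: it has modulus 1, so the
        variance bound for the value of a block is uniform in x.\<close>
      define w where "w j x k = complex_of_real (phi_block \<epsilon>\<^sub>0 \<phi> 1 j (of_int k)) * ee k x" for j x k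
      \<comment> \<open>Frequencies of the block and of the scheme lie within n + 2 * 2^j of 0; more
        than twice that many sampling points keeps them apart modulo N.\<close>
      define N0 :: "nat \<Rightarrow> nat" where "N0 j = 2 * n + 4 * 2 ^ j + 1" for j
      have sub: "?S j \<subseteq> {- 2 * 2 ^ j..2 * 2 ^ j}" for j
        using block_modes_subset[OF phi] by simp
      then have fin: "finite (?S j)" for j
        by (meson finite_atLeastAtMost_int finite_subset)
      have w: "cmod (w j x k) \<le> 1" for j x k
        using phi_block_support(1)[OF phi, of 1] by (simp add: w_def norm_mult)
      have N0: "2 * n \<le> N" "0 < N" "\<forall>k\<in>?S j. 2 * \<bar>k\<bar> \<le> int N" "inj_mod N (?S j \<union> ?I)" if N: "N0 j \<le> N" for N j
      proof -
        have N': "2 * int n + 4 * 2 ^ j + 1 \<le> int N"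
          using N of_nat_mono[OF N, where 'a = int] by (simp add: N0_def)
        show "2 * n \<le> N" "0 < N"
          using N by (simp_all add: N0_def)
        show "\<forall>k\<in>?S j. 2 * \<bar>k\<bar> \<le> int N"
        proof
          fix k assume "k \<in> ?S j"
          then have "k \<in> {- 2 * 2 ^ j..2 * 2 ^ j}"
            using sub by blast
          then show "2 * \<bar>k\<bar> \<le> int N"
            using N' by auto
        qed
        show "inj_mod N (?S j \<union> ?I)"
        proof (rule inj_mod_interval[where d = "int n + 2 * 2 ^ j"])
          have "{- 2 * 2 ^ j..2 * 2 ^ j} \<union> ?I \<subseteq> {- (int n + 2 * 2 ^ j)..int n + 2 * 2 ^ j}"
            using zero_less_power[of "2::int" j] by (auto simp del: zero_less_power)
          then show "?S j \<union> ?I \<subseteq> {- (int n + 2 * 2 ^ j)..int n + 2 * 2 ^ j}"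
            using sub[of j] by blast
        qed (use N' in simp)
      qed
      \<comment> \<open>The lower limit is measurable without exception, agrees with the power of
        the torus block wherever the sample path is continuous, and inherits the moment bound by
        Fatou's lemma.\<close>
      define W where "W j x \<omega> = liminf (\<lambda>N. ennreal (cmod (?X (N + N0 j) (?S j) (w j x) \<omega>) ^ (2 * p)))" for j x \<omega>
      have one: "(1::real) \<le> 1" "(1::real) \<le> 2" by simp_all
      note m1 = moment[OF N0(1)[OF le_add2] N0(3)[OF le_add2] N0(4)[OF le_add2] one order_refl w]
      have X_meas [measurable]: "?X (N + N0 j) (?S j) (w j x) \<in> borel_measurable M" for N j x
        by (rule m1(1))
      have lim: "AE \<omega> in M. continuous_on UNIV (\<lambda>x. Z t x \<omega>)"
        using sol(2) t unfolding heat_solution_def by (auto elim: AE_mp)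
      show ?thesis
        unfolding D_def g_def
      proof (rule block_moment_assembly[where S = "\<lambda>j. block_modes \<epsilon>\<^sub>0 \<phi> 1 j" and b = ?b and W = W])
        show "W j x \<in> borel_measurable M" for j x
          unfolding W_def by measurable
        show "(\<integral>\<^sup>+\<omega>. W j x \<omega> \<partial>M) \<le> ennreal (A * (real n powr (- 2 * \<theta>) * 2 powr (real j * (2 * \<theta> - 1))) ^ p)" for j x
        proof -
          have "(\<integral>\<^sup>+\<omega>. W j x \<omega> \<partial>M) \<le> liminf (\<lambda>N. \<integral>\<^sup>+\<omega>. ennreal (cmod (?X (N + N0 j) (?S j) (w j x) \<omega>) ^ (2 * p)) \<partial>M)"
            unfolding W_def by (rule nn_integral_liminf) measurable
          also have "\<dots> \<le> liminf (\<lambda>N::nat. ennreal (A * (real n powr (- 2 * \<theta>) * 2 powr (real j * (2 * \<theta> - 1))) ^ p))"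
            by (intro Liminf_mono always_eventually allI m1(2))
          finally show ?thesis
            by (simp add: Liminf_const)
        qed
        show "AE \<omega> in M. ennreal (cmod (\<Sum>k\<in>?S j. ?b \<omega> j k * ee k x) ^ (2 * p)) \<le> W j x \<omega>" for j x
          using lim
        proof (rule AE_mp, intro AE_I2 impI)
          fix \<omega> assume cont: "continuous_on UNIV (\<lambda>x. Z t x \<omega>)"
          have "(\<lambda>N. ?X N (?S j) (w j x) \<omega>) \<longlonglongrightarrow> (\<Sum>k\<in>?S j. w j x k * inner_torus (\<lambda>x. Z t x \<omega> - interp n (\<lambda>y. Y t y \<omega>) x) (ee k))"
            by (rule mode_error_tendsto[OF cont fin]) (use N0 in blast)
          also have "(\<Sum>k\<in>?S j. w j x k * inner_torus (\<lambda>x. Z t x \<omega> - interp n (\<lambda>y. Y t y \<omega>) x) (ee k)) = (\<Sum>k\<in>?S j. ?b \<omega> j k * ee k x)"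
            by (intro sum.cong refl) (simp add: w_def mult_ac)
          finally have "(\<lambda>N. ?X (N + N0 j) (?S j) (w j x) \<omega>) \<longlonglongrightarrow> (\<Sum>k\<in>?S j. ?b \<omega> j k * ee k x)"
            by (rule LIMSEQ_ignore_initial_segment)
          then have "(\<lambda>N. ennreal (cmod (?X (N + N0 j) (?S j) (w j x) \<omega>) ^ (2 * p))) \<longlonglongrightarrow> ennreal (cmod (\<Sum>k\<in>?S j. ?b \<omega> j k * ee k x) ^ (2 * p))"
            by (intro tendsto_ennrealI tendsto_power tendsto_norm)
          then have "W j x \<omega> = ennreal (cmod (\<Sum>k\<in>?S j. ?b \<omega> j k * ee k x) ^ (2 * p))"
            unfolding W_def by (rule lim_imp_Liminf[rotated]) simp
          then show "ennreal (cmod (\<Sum>k\<in>?S j. ?b \<omega> j k * ee k x) ^ (2 * p)) \<le> W j x \<omega>"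
            by simp
        qed
        show "besov_torus \<epsilon>\<^sub>0 \<phi> \<alpha> \<infinity> \<infinity> (\<lambda>x. Z t x \<omega> - interp n (\<lambda>y. Y t y \<omega>) x)
            \<le> (SUP (j, x)\<in>UNIV \<times> {0..<1}. ennreal (2 powr (\<alpha> * real j) * cmod (\<Sum>k\<in>?S j. ?b \<omega> j k * ee k x)))" for \<omega>
          by (rule besov_torus_le_SUP[OF fin])
      qed (use M p q n A sub in \<open>auto simp: g_def\<close>)
    qed
    moreover have "(\<integral>\<^sup>+\<omega>. ennreal_powr (besov_grid \<epsilon>\<^sub>0 \<phi> n \<alpha> \<infinity> \<infinity> (\<lambda>x. grid_restrict n (\<lambda>y. Z t y \<omega>) x - Y t x \<omega>)) q \<partial>M)
      \<le> ennreal (D * real n powr (- q * \<theta>))"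
    proof -
      let ?r = "grid_scale n"
      let ?S = "\<lambda>j. block_modes \<epsilon>\<^sub>0 \<phi> ?r j \<inter> ?I"
      let ?b = "\<lambda>\<omega> j k. complex_of_real (phi_block \<epsilon>\<^sub>0 \<phi> ?r j (of_int k)) * inner_grid n (\<lambda>x. grid_restrict n (\<lambda>y. Z t y \<omega>) x - Y t x \<omega>) (grid_restrict n (ee k))"
      define w where "w j x k = complex_of_real (phi_block \<epsilon>\<^sub>0 \<phi> ?r j (of_int k)) * ee k x" for j x k
      \<comment> \<open>Sampling at the 2n grid points already gives the grid coefficients exactly,
        so the moment itself is the majorant.\<close>
      define W where "W j x \<omega> = ennreal (cmod (?X (2 * n) (?S j) (w j x) \<omega>) ^ (2 * p))" for j x \<omega>
      note r = grid_scale_bounds[OF n]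
      have sub: "?S j \<subseteq> {- 2 * 2 ^ j..2 * 2 ^ j}" for j
        using block_modes_subset[OF phi r, of j] by blast
      have w: "cmod (w j x k) \<le> 1" for j x k
        using phi_block_support(1)[OF phi r] by (simp add: w_def norm_mult)
      have "?S j \<union> ?I = ?I" for j by blast
      then have inj: "inj_mod (2 * n) (?S j \<union> ?I)" for j
        using inj_mod_modes by simp
      have N: "\<forall>k\<in>?S j. 2 * \<bar>k\<bar> \<le> int (2 * n)" for j
        by auto
      note mm = moment[OF order_refl N inj r Int_lower1 w]
      show ?thesis
        unfolding D_def g_def
      proof (rule block_moment_assembly[where S = ?S and b = ?b and W = W])
        have [measurable]: "?X (2 * n) (?S j) (w j x) \<in> borel_measurable M" for j x
          by (rule mm(1))
        show "W j x \<in> borel_measurable M" for j x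
          unfolding W_def by measurable
        show "(\<integral>\<^sup>+\<omega>. W j x \<omega> \<partial>M) \<le> ennreal (A * (real n powr (- 2 * \<theta>) * 2 powr (real j * (2 * \<theta> - 1))) ^ p)" for j x
          unfolding W_def by (rule mm(2))
        show "AE \<omega> in M. ennreal (cmod (\<Sum>k\<in>?S j. ?b \<omega> j k * ee k x) ^ (2 * p)) \<le> W j x \<omega>" for j x
        proof (rule AE_I2)
          fix \<omega>
          have "?X (2 * n) (?S j) (w j x) \<omega> = (\<Sum>k\<in>?S j. ?b \<omega> j k * ee k x)"
            unfolding mode_error_grid[OF n Int_lower2] by (intro sum.cong refl) (simp add: w_def mult_ac)
          then show "ennreal (cmod (\<Sum>k\<in>?S j. ?b \<omega> j k * ee k x) ^ (2 * p)) \<le> W j x \<omega>"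
            by (simp add: W_def)
        qed
        show "besov_grid \<epsilon>\<^sub>0 \<phi> n \<alpha> \<infinity> \<infinity> (\<lambda>x. grid_restrict n (\<lambda>y. Z t y \<omega>) x - Y t x \<omega>)
            \<le> (SUP (j, x)\<in>UNIV \<times> {0..<1}. ennreal (2 powr (\<alpha> * real j) * cmod (\<Sum>k\<in>?S j. ?b \<omega> j k * ee k x)))" for \<omega>
          by (rule besov_grid_le_SUP)
        show "?S j \<subseteq> {- 2 * 2 ^ j..2 * 2 ^ j}" for j
          by (rule sub)
      qed (use M p q n A in \<open>auto simp: g_def\<close>)
    qed
    ultimately show ?thesis by blast
  qed
  show ?thesis
    using main D by (intro exI[of _ D]) auto
qed

theorem lemma3p3:
  fixes c \<epsilon>\<^sub>0 \<alpha> q :: real and \<phi> :: "real \<Rightarrow> real"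
  assumes "0 < c" "c < 1 / 4"
    and "0 < \<epsilon>\<^sub>0" "\<epsilon>\<^sub>0 < 1 / 10" "cutoff \<epsilon>\<^sub>0 \<phi>"
    and "\<alpha> < 1 / 2" "\<alpha> \<noteq> - 1 / 2" "1 \<le> q"
  shows "\<exists>N>0. \<forall>(M :: 'w measure) \<xi> Z Y.
    prob_space M \<and> complete_measure M \<and> white_noise M \<xi> \<and>
    heat_solution M \<xi> Z \<and> (\<forall>n\<ge>1. discrete_solution c M \<xi> n (Y n)) \<longrightarrow>
    (\<forall>n\<ge>1. \<forall>t\<in>{0..1}.
       (\<integral>\<^sup>+\<omega>. ennreal_powr
                 (besov_torus \<epsilon>\<^sub>0 \<phi> \<alpha> \<infinity> \<infinity>
                    (\<lambda>x. Z t x \<omega> - interp n (\<lambda>y. Y n t y \<omega>) x)) q \<partial>M)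
         \<le> ennreal (if - 1 / 2 < \<alpha> then N * real n powr (- q * (1 / 2 - \<alpha> - 1 / q))
                    else N * real n powr (- q)) \<and>
       (\<integral>\<^sup>+\<omega>. ennreal_powr
                 (besov_grid \<epsilon>\<^sub>0 \<phi> n \<alpha> \<infinity> \<infinity>
                    (\<lambda>x. grid_restrict n (\<lambda>y. Z t y \<omega>) x - Y n t x \<omega>)) q \<partial>M)
         \<le> ennreal (if - 1 / 2 < \<alpha> then N * real n powr (- q * (1 / 2 - \<alpha> - 1 / q))
                    else N * real n powr (- q)))"
proof -
  \<comment> \<open>The margin 1/q gives the strict inequality \<theta> < 1/2 - \<alpha>; below -1/2
    the value 1 satisfies it because \<alpha> = -1/2 is excluded. If 1/2 - \<alpha> - 1/q is
    negative, the claim lets the bound grow with n, and \<theta> = 0 already gives a constant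
    one.\<close>
  define \<theta> where "\<theta> = (if - 1 / 2 < \<alpha> then max 0 (1 / 2 - \<alpha> - 1 / q) else 1)"
  have q: "0 < q" "0 < 1 / q" using assms by simp_all
  have th: "0 \<le> \<theta>" "\<theta> \<le> 1" "\<theta> < 1 / 2 - \<alpha>"
  proof -
    have "1 / 2 - \<alpha> - r \<le> 1" "1 / 2 - \<alpha> - r < 1 / 2 - \<alpha>" if "0 < r" "- 1 / 2 < \<alpha>" for r
      using that by simp_all
    from this[OF q(2)] show "0 \<le> \<theta>" "\<theta> \<le> 1" "\<theta> < 1 / 2 - \<alpha>"
      using assms(6,7) by (simp_all add: \<theta>_def)
  qed
  obtain D where D: "0 < D" and rate: "\<forall>(M :: 'w measure) \<xi> Z Y n t.
    prob_space M \<and> white_noise M \<xi> \<and> heat_solution M \<xi> Z \<and> discrete_solution c M \<xi> n Y \<and> 1 \<le> n \<and> 0 \<le> t \<longrightarrow>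
    (\<integral>\<^sup>+\<omega>. ennreal_powr (besov_torus \<epsilon>\<^sub>0 \<phi> \<alpha> \<infinity> \<infinity> (\<lambda>x. Z t x \<omega> - interp n (\<lambda>y. Y t y \<omega>) x)) q \<partial>M)
      \<le> ennreal (D * real n powr (- q * \<theta>)) \<and>
    (\<integral>\<^sup>+\<omega>. ennreal_powr (besov_grid \<epsilon>\<^sub>0 \<phi> n \<alpha> \<infinity> \<infinity> (\<lambda>x. grid_restrict n (\<lambda>y. Z t y \<omega>) x - Y t x \<omega>)) q \<partial>M)
      \<le> ennreal (D * real n powr (- q * \<theta>))"
    using besov_error_rate[OF assms(1-5) q(1) th, where 'w = 'w] by (elim exE conjE) (rule that)
  have le: "ennreal (D * real n powr (- q * \<theta>)) \<le> ennreal (if - 1 / 2 < \<alpha> then D * real n powr (- q * (1 / 2 - \<alpha> - 1 / q))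
      else D * real n powr (- q))" if "1 \<le> n" for n
  proof (rule ennreal_leI)
    have "real n powr (- q * \<theta>) \<le> real n powr (- q * (1 / 2 - \<alpha> - 1 / q))" if "- 1 / 2 < \<alpha>"
    proof (rule powr_mono)
      show "- q * \<theta> \<le> - q * (1 / 2 - \<alpha> - 1 / q)"
        using that q by (intro mult_left_mono_neg) (auto simp: \<theta>_def)
    qed (use \<open>1 \<le> n\<close> in simp)
    then show "D * real n powr (- q * \<theta>) \<le> (if - 1 / 2 < \<alpha> then D * real n powr (- q * (1 / 2 - \<alpha> - 1 / q))
        else D * real n powr (- q))"
      using D by (auto simp: \<theta>_def)
  qed
  show ?thesis
  proof (intro exI[of _ D] conjI D allI impI ballI)
    fix M :: "'w measure" and \<xi> Z Y and n :: nat and t :: real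
    assume "prob_space M \<and> complete_measure M \<and> white_noise M \<xi> \<and>
      heat_solution M \<xi> Z \<and> (\<forall>n\<ge>1. discrete_solution c M \<xi> n (Y n))" "1 \<le> n" "t \<in> {0..1}"
    then have "prob_space M \<and> white_noise M \<xi> \<and> heat_solution M \<xi> Z \<and> discrete_solution c M \<xi> n (Y n) \<and> 1 \<le> n \<and> 0 \<le> t"
      by auto
    note * = rate[rule_format, OF this] le[OF \<open>1 \<le> n\<close>]
    from order_trans[OF conjunct1[OF *(1)] *(2)] order_trans[OF conjunct2[OF *(1)] *(2)]
    show "(\<integral>\<^sup>+\<omega>. ennreal_powr (besov_torus \<epsilon>\<^sub>0 \<phi> \<alpha> \<infinity> \<infinity> (\<lambda>x. Z t x \<omega> - interp n (\<lambda>y. Y n t y \<omega>) x)) q \<partial>M)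
        \<le> ennreal (if - 1 / 2 < \<alpha> then D * real n powr (- q * (1 / 2 - \<alpha> - 1 / q)) else D * real n powr (- q))"
      "(\<integral>\<^sup>+\<omega>. ennreal_powr (besov_grid \<epsilon>\<^sub>0 \<phi> n \<alpha> \<infinity> \<infinity> (\<lambda>x. grid_restrict n (\<lambda>y. Z t y \<omega>) x - Y n t x \<omega>)) q \<partial>M)
        \<le> ennreal (if - 1 / 2 < \<alpha> then D * real n powr (- q * (1 / 2 - \<alpha> - 1 / q)) else D * real n powr (- q))"
      by blast+
  qed
qed

end
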